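(* Let $0<p\leq u<\infty$ and $m,\ell>0$. Then for all $M\in\mathcal{S}(\mathbb{R}^d)$ with $\operatorname{supp}M\subseteq B(0,m)$ and every tempered distribution $f\in\mathcal{M}^u_p(\mathbb{R}^d)$ with $\operatorname{supp}(\mathcal{F}f)\subseteq B(0,\ell)$ there holds $$\|\mathcal{F}^{-1}[M\,\mathcal{F}f]\mid\mathcal{M}^u_p(\mathbb{R}^d)\|\lesssim(m+\ell)^{\sigma_p}\,\|\mathcal{F}^{-1}M\mid L_{\min\{1,p\}}(\mathbb{R}^d)\|\,\|f\mid\mathcal{M}^u_p(\mathbb{R}^d)\|$$ with an implied constant that does not depend on $f$, $M$, $m$ or $\ell$.
   Context: $B(x,t):=\{y\in\mathbb{R}^d:|x-y|<t\}$. $A\lesssim B$ means $A\leq cB$ with a constant $c>0$ (here depending at most on $d,u,p$). $\sigma_p:=d\max\{0,\frac1p-1\}$. $\mathcal{F}$ and $\mathcal{F}^{-1}$ are the Fourier transform and its inverse on $\mathcal{S}'(\mathbb{R}^d)$. Morrey space: for $0<p\leq u<\infty$, $\mathcal{M}^u_p(\mathbb{R}^d)$ is the set of all (complex-valued) $f\in L_p^{\mathrm{loc}}(\mathbb{R}^d)$ with $$\|f\mid\mathcal{M}^u_p(\mathbb{R}^d)\|:=\sup_{y\in\mathbb{R}^d,R>0}|B(y,R)|^{\frac1u-\frac1p}\Big(\int_{B(y,R)}|f(x)|^p\,dx\Big)^{1/p}<\infty.$$ A tempered distribution whose Fourier transform has compact support is, by the Paley-Wiener-Schwartz theorem, identified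 with a smooth function (the restriction to $\mathbb{R}^d$ of an entire function); $f\in\mathcal{M}^u_p(\mathbb{R}^d)$ and $\mathcal{F}^{-1}[M\mathcal{F}f]\in\mathcal{M}^u_p(\mathbb{R}^d)$ are understood in this sense. For $0<r<\infty$, $\|g\mid L_r(\mathbb{R}^d)\|=(\int_{\mathbb{R}^d}|g|^r)^{1/r}$. *)

theory Defs
  imports "HOL-Analysis.Analysis"
begin

section \<open>Smooth functions and Schwartz functions\<close>

text \<open>
  The space \<open>\<real>\<^sup>d\<close> is rendered by an arbitrary Euclidean space \<open>'a\<close> with \<open>d = DIM('a)\<close>.
  A partial derivative of order \<open>k\<close> is indexed by the list (of length \<open>k\<close>) of the basis vectors in
  whose directions one differentiates; for smooth functions only the underlying multi-index matters.
\<close>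

fun partial_derivs :: "'a::euclidean_space list \<Rightarrow> ('a \<Rightarrow> complex) \<Rightarrow> 'a \<Rightarrow> complex" where
  "partial_derivs [] f = f"
| "partial_derivs (b # bs) f = (\<lambda>x. frechet_derivative (partial_derivs bs f) (at x) b)"

definition smooth :: "('a::euclidean_space \<Rightarrow> complex) \<Rightarrow> bool" where
  "smooth f \<longleftrightarrow>
     (\<forall>bs. set bs \<subseteq> Basis \<longrightarrow> (\<forall>x. partial_derivs bs f differentiable (at x)))"

definition schwartz :: "('a::euclidean_space \<Rightarrow> complex) set" where
  "schwartz = {\<phi>. smooth \<phi> \<and>
     (\<forall>k bs. set bs \<subseteq> Basis \<longrightarrow>
        bounded (range (\<lambda>x. (1 + norm x) ^ k *\<^sub>R partial_derivs bs \<phi> x)))}"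

text \<open>The seminorms generating the topology of the Schwartz space.\<close>

definition schwartz_seminorm :: "nat \<Rightarrow> ('a::euclidean_space \<Rightarrow> complex) \<Rightarrow> real" where
  "schwartz_seminorm N \<phi> =
     (SUP x. (1 + norm x) ^ N *
        (\<Sum>bs | set bs \<subseteq> Basis \<and> length bs \<le> N. norm (partial_derivs bs \<phi> x)))"

definition fun_supp :: "('a::euclidean_space \<Rightarrow> complex) \<Rightarrow> 'a set" where
  "fun_supp \<phi> = closure {x. \<phi> x \<noteq> 0}"

text \<open>Fourier transform and its inverse, with the normalization \<open>(2\<pi>)\<^bsup>-d/2\<^esup>\<close>.\<close>

definition fourier :: "('a::euclidean_space \<Rightarrow> complex) \<Rightarrow> 'a \<Rightarrow> complex" where
  "fourier \<phi> \<xi> =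
     of_real ((2 * pi) powr (- real DIM('a) / 2)) * (LINT x|lborel. cis (- (x \<bullet> \<xi>)) * \<phi> x)"

definition inv_fourier :: "('a::euclidean_space \<Rightarrow> complex) \<Rightarrow> 'a \<Rightarrow> complex" where
  "inv_fourier \<phi> x =
     of_real ((2 * pi) powr (- real DIM('a) / 2)) * (LINT \<xi>|lborel. cis (x \<bullet> \<xi>) * \<phi> \<xi>)"


section \<open>Tempered distributions\<close>

text \<open>
  A tempered distribution is a functional on the Schwartz space; it is encoded as a function defined
  on all of \<open>'a \<Rightarrow> complex\<close>, whose values outside \<^const>\<open>schwartz\<close> are irrelevant.
\<close>

type_synonym 'a functional = "('a \<Rightarrow> complex) \<Rightarrow> complex"

definition tempered :: "'a::euclidean_space functional \<Rightarrow> bool" where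
  "tempered T \<longleftrightarrow>
     (\<forall>\<phi>\<in>schwartz. \<forall>\<psi>\<in>schwartz. T (\<lambda>x. \<phi> x + \<psi> x) = T \<phi> + T \<psi>) \<and>
     (\<forall>c. \<forall>\<phi>\<in>schwartz. T (\<lambda>x. c * \<phi> x) = c * T \<phi>) \<and>
     (\<exists>C N. \<forall>\<phi>\<in>schwartz. norm (T \<phi>) \<le> C * schwartz_seminorm N \<phi>)"

definition dist_fourier :: "'a::euclidean_space functional \<Rightarrow> 'a functional" where
  "dist_fourier T = (\<lambda>\<phi>. T (fourier \<phi>))"

definition dist_inv_fourier :: "'a::euclidean_space functional \<Rightarrow> 'a functional" where
  "dist_inv_fourier T = (\<lambda>\<phi>. T (inv_fourier \<phi>))"

definition dist_mult :: "('a::euclidean_space \<Rightarrow> complex) \<Rightarrow> 'a functional \<Rightarrow> 'a functional" where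
  "dist_mult M T = (\<lambda>\<phi>. T (\<lambda>x. M x * \<phi> x))"

definition dist_supp :: "'a::euclidean_space functional \<Rightarrow> 'a set" where
  "dist_supp T = - \<Union>{U. open U \<and>
     (\<forall>\<phi>. smooth \<phi> \<and> compact (fun_supp \<phi>) \<and> fun_supp \<phi> \<subseteq> U \<longrightarrow> T \<phi> = 0)}"

text \<open>
  Identification of a distribution with a smooth function. The function \<open>g\<close> is unique if it exists;
  by the Paley-Wiener-Schwartz theorem it does exist if \<open>T\<close> is tempered and its Fourier transform
  has compact support.
\<close>

definition represented_by :: "'a::euclidean_space functional \<Rightarrow> ('a \<Rightarrow> complex) \<Rightarrow> bool" where
  "represented_by T g \<longleftrightarrow> smooth g \<and>
     (\<forall>\<phi>\<in>schwartz. integrable lborel (\<lambda>x. g x * \<phi> x) \<and> T \<phi> = (LINT x|lborel. g x * \<phi> x))"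

definition dist_fun :: "'a::euclidean_space functional \<Rightarrow> 'a \<Rightarrow> complex" where
  "dist_fun T = (THE g. represented_by T g)"


section \<open>Lebesgue and Morrey (quasi-)norms\<close>

text \<open>Powers of extended nonnegative reals, for positive exponents only.\<close>

definition enn_powr :: "ennreal \<Rightarrow> real \<Rightarrow> ennreal" where
  "enn_powr a s = (if a = top then top else ennreal (enn2real a powr s))"

definition Lp_norm :: "real \<Rightarrow> ('a::euclidean_space \<Rightarrow> complex) \<Rightarrow> ennreal" where
  "Lp_norm r g = enn_powr (\<integral>\<^sup>+ x. ennreal (norm (g x) powr r) \<partial>lebesgue) (1 / r)"

definition Lp_loc :: "real \<Rightarrow> ('a::euclidean_space \<Rightarrow> complex) set" where
  "Lp_loc p = {f \<in> borel_measurable lebesgue.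
     \<forall>K. compact K \<longrightarrow> (\<integral>\<^sup>+ x\<in>K. ennreal (norm (f x) powr p) \<partial>lebesgue) < top}"

definition morrey_norm :: "real \<Rightarrow> real \<Rightarrow> ('a::euclidean_space \<Rightarrow> complex) \<Rightarrow> ennreal" where
  "morrey_norm u p f = (SUP y. SUP R\<in>{0<..}.
     ennreal (measure lborel (ball y R) powr (1 / u - 1 / p)) *
     enn_powr (\<integral>\<^sup>+ x\<in>ball y R. ennreal (norm (f x) powr p) \<partial>lebesgue) (1 / p))"

definition morrey :: "real \<Rightarrow> real \<Rightarrow> ('a::euclidean_space \<Rightarrow> complex) set" where
  "morrey u p = {f \<in> Lp_loc p. morrey_norm u p f < top}"

definition dist_in_morrey :: "real \<Rightarrow> real \<Rightarrow> 'a::euclidean_space functional \<Rightarrow> bool" where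
  "dist_in_morrey u p T \<longleftrightarrow> (\<exists>g. represented_by T g \<and> g \<in> morrey u p)"

definition sigma_p :: "nat \<Rightarrow> real \<Rightarrow> real" where
  "sigma_p d p = real d * max 0 (1 / p - 1)"

end

theory Submission imports Defs begin

text \<open>
  Let \<open>g\<close> be the smooth function representing \<open>f\<close>, and write \<open>K\<close> for the inverse Fourier
  transform of \<open>M\<close>; then \<open>h\<close> is represented by a constant multiple of the convolution \<open>g * K\<close>. For \<open>p \<ge> 1\<close> the estimate is the convexity inequality
  \<open>(|g| * |K|)\<^sup>p \<le> (\<integral>|K|)\<^bsup>p-1\<^esup> (|g|\<^sup>p * |K|)\<close> followed by Tonelli. For \<open>p < 1\<close>, the function
  \<open>F y = g y * K (x - y)\<close> is integrable with spectrum in \<open>ball 0 (m + l)\<close>, so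
  \<open>sup |F| \<le> C (m + l)\<^sup>d \<integral>|F|\<close>; inserting this in \<open>\<integral>|F| \<le> (sup |F|)\<^bsup>1-p\<^esup> \<integral>|F|\<^sup>p\<close> and cancelling
  gives \<open>(\<integral>|F|)\<^sup>p \<le> (C (m + l)\<^sup>d)\<^bsup>1-p\<^esup> (|g|\<^sup>p * |K|\<^sup>p) x\<close>, and Tonelli applies again.

  The sup bound needs neither Fourier inversion nor the Paley-Wiener-Schwartz theorem: with
  \<open>\<Theta>\<close> the transform of a cutoff function equal to \<open>1\<close> on the unit ball, the integrals
  \<open>\<integral> F y * (n\<^sup>d * \<Theta> (n (w - y))) dy\<close> do not depend on \<open>n \<ge> m + l\<close>, and for \<open>n \<rightarrow> \<infinity>\<close> they tend to
  \<open>F w * \<integral>\<Theta>\<close>, where \<open>\<integral>\<Theta> \<noteq> 0\<close>.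
\<close>

section \<open>Rapidly decreasing functions\<close>

text \<open>The cancellation for p < 1 is legitimate only if \<open>\<integral>|F|\<close> is
  finite, and beyond its finite Morrey norm all that is known of g is that it is smooth and that g *
  \<phi> is integrable for Schwartz functions \<phi>. The function |K| is in general not smooth,
  hence not an admissible \<phi>. The class \<open>slow\<close> removes this obstacle: pairing with
  Schwartz functions already forces absolute integrability against every measurable function of
  rapid decay. For this reason many estimates are phrased with \<open>rapid\<close> instead of
  \<open>schwartz\<close>. The radius m + l belongs to the product of g with K (x - _): its
  transform is a convolution of something living in ball 0 l with something living in ball 0 m. The
  power \<open>sigma_p\<close> is what remains of the factor (m + l)^(d (1 - p)) after a p-th root.
  Of the Morrey norm a single feature is used: for each radius it bounds the integral of |g|^p over
  balls uniformly in the centre. Tonelli replaces a ball by its translates, so the weight, which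
  depends on the radius only, passes through unchanged.\<close>

lemma integrable_inverse_power_norm:
  "integrable lborel (\<lambda>x::'a::euclidean_space. 1 / (1 + norm x) ^ (DIM('a) + 2))"
proof (rule integrableI_nonneg)
  let ?d = "DIM('a)"
  let ?V = "unit_ball_vol (real ?d)"
  \<comment> \<open>A majorant made of constants on balls: the shell n \<le> norm x < n + 1 lies in
    a ball of volume \<open>?V * (n + 1) ^ ?d\<close>, so the exponent d + 2 leaves the convergent
    series of 1 / (n + 1)^2.\<close>
  let ?g = "\<lambda>n x::'a. ennreal (1 / (1 + real n) ^ (?d + 2)) * indicator (ball 0 (real n + 1)) x"
  have le: "ennreal (1 / (1 + norm x) ^ (?d + 2)) \<le> (\<Sum>n. ?g n x)" for x :: 'a
  proof -
    define n where "n = nat \<lfloor>norm x\<rfloor>"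
    have n: "real n \<le> norm x" "norm x < real n + 1"
      using floor_correct[of "norm x"] norm_ge_zero[of x] unfolding n_def by (auto simp del: norm_ge_zero)
    have "1 / (1 + norm x) ^ (?d + 2) \<le> 1 / (1 + real n) ^ (?d + 2)"
      using n by (intro divide_left_mono power_mono mult_pos_pos zero_less_power) auto
    then have "ennreal (1 / (1 + norm x) ^ (?d + 2)) \<le> ?g n x"
      using n by (simp add: ennreal_leI)
    also have "\<dots> \<le> (\<Sum>n. ?g n x)"
    proof -
      have "sum (\<lambda>n. ?g n x) {n} \<le> (\<Sum>n. ?g n x)"
        by (rule sum_le_suminf[OF summableI]) auto
      then show ?thesis unfolding sum.insert_remove[OF finite.emptyI] by (simp only: sum.empty empty_Diff add_0_right)
    qed
    finally show ?thesis .
  qed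
  have meas: "?g n \<in> borel_measurable lborel" for n
    by (intro borel_measurable_times_ennreal borel_measurable_indicator borel_measurable_const) auto
  have eq: "(\<integral>\<^sup>+ x. ?g n x \<partial>lborel) = ennreal (?V * (1 / (real n + 1)\<^sup>2))" for n
  proof -
    have "(\<integral>\<^sup>+ x. ?g n x \<partial>lborel) = ennreal (1 / (1 + real n) ^ (?d + 2)) * emeasure lborel (ball (0::'a) (real n + 1))"
      by (subst nn_integral_cmult_indicator) auto
    also have "\<dots> = ennreal (1 / (1 + real n) ^ (?d + 2) * (?V * (real n + 1) ^ ?d))"
      by (subst emeasure_ball) (simp_all only: ennreal_mult[symmetric] unit_ball_vol_nonneg, auto simp: ennreal_mult[symmetric] unit_ball_vol_nonneg simp del: power_Suc power_add)
    also have "1 / (1 + real n) ^ (?d + 2) * (?V * (real n + 1) ^ ?d) = ?V * (1 / (real n + 1)\<^sup>2)"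
    proof -
      have "a > 0 \<Longrightarrow> 1 / a ^ (?d + 2) * (v * a ^ ?d) = v * (1 / a\<^sup>2)" for a v :: real
        by (simp add: power_add power2_eq_square)
      from this[of "1 + real n" ?V] show ?thesis by (simp add: add.commute)
    qed
    finally show ?thesis .
  qed
  have summ: "summable (\<lambda>n. ?V * (1 / (real n + 1)\<^sup>2))"
    using inverse_squares_sums by (intro summable_mult) (auto simp: sums_iff add.commute)
  have "(\<integral>\<^sup>+ x. ennreal (1 / (1 + norm (x::'a)) ^ (?d + 2)) \<partial>lborel) \<le> (\<integral>\<^sup>+ x. (\<Sum>n. ?g n x) \<partial>lborel)"
    by (intro nn_integral_mono le)
  also have "\<dots> = (\<Sum>n. ennreal (?V * (1 / (real n + 1)\<^sup>2)))"
    by (subst nn_integral_suminf[OF meas]) (simp only: eq)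
  also have "\<dots> < \<infinity>"
    using summ by (subst suminf_ennreal2) (auto simp: unit_ball_vol_nonneg)
  finally show "(\<integral>\<^sup>+ x. ennreal (1 / (1 + norm (x::'a)) ^ (?d + 2)) \<partial>lborel) < \<infinity>" .
qed auto

text \<open>Decay faster than any polynomial, with no condition on derivatives and for values in any
  normed space. It thus applies to norms, indicators and majorants as well.\<close>

definition rapid :: "('a::real_normed_vector \<Rightarrow> 'b::real_normed_vector) \<Rightarrow> bool" where
  "rapid u \<longleftrightarrow> (\<forall>k. \<exists>C. \<forall>x. (1 + norm x) ^ k * norm (u x) \<le> C)"

lemma rapidE:
  assumes "rapid u"
  obtains C where "C \<ge> 0" "\<And>x. (1 + norm x) ^ k * norm (u x) \<le> C"
proof -
  obtain C where C: "\<And>x. (1 + norm x) ^ k * norm (u x) \<le> C"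
    using assms by (auto simp: rapid_def)
  have "0 \<le> C"
    by (rule order_trans[OF _ C[of 0]]) simp
  then show ?thesis using C that by blast
qed

lemma rapid_bound:
  assumes "rapid u"
  obtains C where "C \<ge> 0" "\<And>x. norm (u x) \<le> C / (1 + norm x) ^ k"
proof -
  obtain C where C: "C \<ge> 0" "\<And>x. (1 + norm x) ^ k * norm (u x) \<le> C"
    using rapidE[OF assms] by blast
  have "0 < 1 + norm x" for x :: 'a
    by (smt (verit) norm_ge_zero)
  then have "norm (u x) \<le> C / (1 + norm x) ^ k" for x
    using C(2)[of x] by (simp add: pos_le_divide_eq mult.commute)
  then show ?thesis using that C by blast
qed

lemma rapid_mono:
  assumes "rapid u" "\<And>x. norm (v x) \<le> c * (1 + norm x) ^ j * norm (u x)" "c \<ge> 0"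
  shows "rapid v"
  unfolding rapid_def
proof
  fix k
  obtain C where C: "\<And>x. (1 + norm x) ^ (k + j) * norm (u x) \<le> C"
    using rapidE[OF assms(1)] by blast
  have "(1 + norm x) ^ k * norm (v x) \<le> c * C" for x
  proof -
    have "(1 + norm x) ^ k * norm (v x) \<le> (1 + norm x) ^ k * (c * (1 + norm x) ^ j * norm (u x))"
      by (intro mult_left_mono assms) auto
    also have "\<dots> = c * ((1 + norm x) ^ (k + j) * norm (u x))"
      by (simp add: power_add power2_eq_square)
    also have "\<dots> \<le> c * C"
      by (intro mult_left_mono C assms)
    finally show ?thesis .
  qed
  then show "\<exists>C. \<forall>x. (1 + norm x) ^ k * norm (v x) \<le> C" by blast
qed

lemma rapid_le: "rapid u \<Longrightarrow> (\<And>x. norm (v x) \<le> norm (u x)) \<Longrightarrow> rapid v"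
  by (rule rapid_mono[of u v 1 0]) auto


lemma rapid_mult_bounded:
  fixes u v :: "_ \<Rightarrow> complex"
  assumes "rapid u" "\<And>x. norm (v x) \<le> c"
  shows "rapid (\<lambda>x. u x * v x)"
proof (rule rapid_mono[of u _ "max 0 c" 0])
  show "norm (u x * v x) \<le> max 0 c * (1 + norm x) ^ 0 * norm (u x)" for x
    using mult_left_mono[OF order_trans[OF assms(2) max.cobounded2[of c 0]], of "norm (u x)"]
    by (simp add: norm_mult mult.commute)
qed (use assms in auto)

lemma rapid_add:
  assumes "rapid u" "rapid v"
  shows "rapid (\<lambda>x. u x + v x)"
  unfolding rapid_def
proof
  fix k
  obtain C where C: "\<And>x. (1 + norm x) ^ k * norm (u x) \<le> C"
    using rapidE[OF assms(1)] by blast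
  obtain D where D: "\<And>x. (1 + norm x) ^ k * norm (v x) \<le> D"
    using rapidE[OF assms(2)] by blast
  have "(1 + norm x) ^ k * norm (u x + v x) \<le> C + D" for x
    using mult_left_mono[OF norm_triangle_ineq[of "u x" "v x"], of "(1 + norm x) ^ k"] C[of x] D[of x]
    by (simp add: distrib_left)
  then show "\<exists>C. \<forall>x. (1 + norm x) ^ k * norm (u x + v x) \<le> C" by blast
qed

lemma rapid_zero: "rapid (\<lambda>x. 0)"
  by (auto simp: rapid_def)

lemma rapid_norm: "rapid u \<Longrightarrow> rapid (\<lambda>x. norm (u x))"
  by (rule rapid_le) auto

lemma rapid_sum: "finite A \<Longrightarrow> (\<And>i. i \<in> A \<Longrightarrow> rapid (u i)) \<Longrightarrow> rapid (\<lambda>x. \<Sum>i\<in>A. u i x)"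
  by (induction A rule: finite_induct) (auto intro: rapid_add rapid_zero)

lemma rapid_bounded:
  assumes "rapid u" obtains C where "C > 0" "\<And>x. norm (u x) \<le> C"
proof -
  obtain C where "C \<ge> 0" "\<And>x. norm (u x) \<le> C / (1 + norm x) ^ 0"
    using rapid_bound[OF assms] by metis
  then show ?thesis by (intro that[of "C + 1"]) (auto intro: add_increasing2)
qed

lemma rapid_integrable:
  fixes u :: "'a::euclidean_space \<Rightarrow> 'b::{banach, second_countable_topology}"
  assumes "rapid u" "u \<in> borel_measurable borel"
  shows "integrable lborel u"
proof -
  obtain C where C: "C \<ge> 0" "\<And>x. norm (u x) \<le> C / (1 + norm x) ^ (DIM('a) + 2)"
    using rapid_bound[OF assms(1)] by metis
  have "integrable lborel (\<lambda>x::'a. C * (1 / (1 + norm x) ^ (DIM('a) + 2)))"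
    by (intro integrable_mult_right integrable_inverse_power_norm)
  then show ?thesis
    using assms(2) C by (elim Bochner_Integration.integrable_bound) (auto intro!: AE_I2)
qed

text \<open>The least radially decreasing majorant of \<open>u\<close>, shifted outwards by \<open>r\<close>.\<close>

lemma rapid_majorant:
  fixes u :: "'a::euclidean_space \<Rightarrow> 'b::real_normed_vector"
  assumes u: "rapid u" and r: "r \<ge> 0"
  obtains v :: "'a \<Rightarrow> real" where "v \<in> borel_measurable borel" "rapid v"
    "\<And>z. v z \<ge> 0" "\<And>z x. norm (x - z) \<le> r \<Longrightarrow> norm (u x) \<le> v z"
    "\<And>z x. norm (x + z) \<le> r \<Longrightarrow> norm (u x) \<le> v z"
proof -
  \<comment> \<open>The inserted 0 makes the supremum nonnegative and the set nonempty without
    further argument.\<close>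
  define S where "S t = insert 0 ((\<lambda>x. norm (u x)) ` {x. norm x \<ge> t})" for t
  define \<Phi> where "\<Phi> t = Sup (S t)" for t
  obtain B where B: "B > 0" "\<And>x. norm (u x) \<le> B" using rapid_bounded[OF u] by metis
  have bdd: "bdd_above (S t)" for t
    unfolding S_def bdd_above_def using B by (intro exI[of _ B]) (auto intro: less_imp_le)
  have mono: "\<Phi> s \<le> \<Phi> t" if "t \<le> s" for s t
    unfolding \<Phi>_def using that by (intro cSup_subset_mono bdd) (auto simp: S_def)
  have nonneg: "\<Phi> t \<ge> 0" for t
    unfolding \<Phi>_def by (intro cSup_upper bdd) (auto simp: S_def)
  have ge: "norm (u x) \<le> \<Phi> t" if "t \<le> norm x" for x t
    unfolding \<Phi>_def using that by (intro cSup_upper bdd) (auto simp: S_def)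
  define v where "v z = \<Phi> (norm z - r)" for z :: 'a
  \<comment> \<open>\<Phi> is decreasing, so its measurability is read off from the increasing
    function - \<Phi>.\<close>
  have "(\<lambda>t. - \<Phi> t) \<in> borel_measurable borel"
    by (intro borel_measurable_mono monoI) (auto intro: mono)
  then have "(\<lambda>t. - (- \<Phi> t)) \<in> borel_measurable borel"
    by (rule borel_measurable_uminus)
  then have \<Phi>m: "\<Phi> \<in> borel_measurable borel" by simp
  have meas: "v \<in> borel_measurable borel"
    unfolding v_def using \<Phi>m by measurable
  have "rapid v"
    unfolding rapid_def
  proof
    fix k
    obtain C where C: "C \<ge> 0" "\<And>x. norm (u x) \<le> C / (1 + norm x) ^ k"
      using rapid_bound[OF u] by metis
    have "(1 + norm z) ^ k * norm (v z) \<le> C * (1 + r) ^ k" for z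
    proof -
      \<comment> \<open>For norm z < r the shifted radius is negative; truncation at 0 keeps
        \<open>norm z \<le> r + t\<close> in both cases, so the shift costs only the factor
        \<open>(1 + r) ^ k\<close>.\<close>
      define t where "t = max 0 (norm z - r)"
      have "\<Phi> (norm z - r) \<le> C / (1 + t) ^ k"
        unfolding \<Phi>_def
      proof (rule cSup_least)
        fix y assume "y \<in> S (norm z - r)"
        then consider "y = 0" | x where "y = norm (u x)" "norm z - r \<le> norm x"
          by (auto simp: S_def)
        then show "y \<le> C / (1 + t) ^ k"
        proof cases
          case 2
          have "y \<le> C / (1 + norm x) ^ k" using C 2 by simp
          also have "\<dots> \<le> C / (1 + t) ^ k"
            using 2 C by (intro divide_left_mono power_mono mult_pos_pos zero_less_power)
              (auto simp: t_def add_pos_nonneg)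
          finally show ?thesis .
        qed (use C in \<open>auto simp: t_def\<close>)
      qed (auto simp: S_def)
      moreover have "1 + norm z \<le> (1 + r) * (1 + t)"
      proof -
        have "0 \<le> r * t" "norm z \<le> r + t" using r by (auto simp: t_def)
        then show ?thesis by (simp add: distrib_left distrib_right)
      qed
      then have "(1 + norm z) ^ k \<le> (1 + r) ^ k * (1 + t) ^ k"
        using power_mono[of "1 + norm z" "(1 + r) * (1 + t)" k] by (simp add: power_mult_distrib)
      ultimately have "(1 + norm z) ^ k * \<Phi> (norm z - r) \<le> ((1 + r) ^ k * (1 + t) ^ k) * (C / (1 + t) ^ k)"
        using nonneg r by (intro mult_mono) (auto simp: t_def)
      also have "\<dots> = C * (1 + r) ^ k"
        by (simp add: t_def max_def)
      finally show ?thesis by (simp add: v_def nonneg)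
    qed
    then show "\<exists>C. \<forall>x. (1 + norm x) ^ k * norm (v x) \<le> C" by blast
  qed
  moreover have "norm (u x) \<le> v z" if "norm (x - z) \<le> r" for x z
    unfolding v_def using that norm_triangle_ineq2[of z x] by (intro ge) (auto simp: norm_minus_commute)
  moreover have "norm (u x) \<le> v z" if "norm (x + z) \<le> r" for x z
    unfolding v_def using that norm_diff_ineq[of z x] by (intro ge) (auto simp: add.commute)
  ultimately show ?thesis
    using that meas nonneg unfolding v_def by blast
qed

section \<open>Differentiation under the integral sign\<close>

text \<open>Dominated convergence for the remainders of the difference quotients. The mean value
  inequality on the unit ball around x0 bounds the increment of F by \<open>B y * norm h\<close>,
  and the linear term obeys the same bound, whence the majorant 2 * B.\<close>

lemma has_derivative_integral:
  fixes F :: "'a::euclidean_space \<Rightarrow> 'b::euclidean_space \<Rightarrow> 'c::euclidean_space"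
  assumes F: "\<And>x. integrable lborel (F x)"
    and F': "\<And>h. integrable lborel (\<lambda>y. F' x0 y h)"
    and deriv: "\<And>x y. norm (x - x0) \<le> 1 \<Longrightarrow> ((\<lambda>x. F x y) has_derivative F' x y) (at x)"
    and bound: "\<And>x y h. norm (x - x0) \<le> 1 \<Longrightarrow> norm (F' x y h) \<le> B y * norm h"
    and B: "integrable lborel B"
  shows "((\<lambda>x. LINT y|lborel. F x y) has_derivative (\<lambda>h. LINT y|lborel. F' x0 y h)) (at x0)"
proof -
  let ?L = "\<lambda>h. LINT y|lborel. F' x0 y h"
  let ?R = "\<lambda>h y. (F (x0 + h) y - F x0 y - F' x0 y h) /\<^sub>R norm h"
  have lin: "linear (F' x0 y)" for y
    using deriv[of x0 y] by (auto intro: has_derivative_linear)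
  have "linear ?L"
    by (intro linearI) (auto simp: linear_add[OF lin] linear_cmul[OF lin] F')
  then have bl: "bounded_linear ?L"
    by (simp add: linear_linear)
  have "(\<lambda>n. LINT y|lborel. ?R (h n) y) \<longlonglongrightarrow> (LINT y|(lborel::'b measure). (0::'c))"
    if h0: "\<forall>n. h n \<noteq> 0" and hl: "h \<longlonglongrightarrow> 0" and h1: "\<forall>n. norm (h n) \<le> 1" for h :: "nat \<Rightarrow> 'a"
  proof (rule integral_dominated_convergence[where w = "\<lambda>y. 2 * B y"])
    show "AE y in lborel. (\<lambda>n. ?R (h n) y) \<longlonglongrightarrow> 0"
    proof (rule AE_I2)
      fix y
      have "((\<lambda>x. F x y) has_derivative F' x0 y) (at x0)"
        by (rule deriv) auto
      then have "(\<lambda>h. norm (F (x0 + h) y - F x0 y - F' x0 y h) / norm h) \<midarrow>0\<rightarrow> 0"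
        by (simp add: has_derivative_at)
      then have "(\<lambda>n. norm (F (x0 + h n) y - F x0 y - F' x0 y (h n)) / norm (h n)) \<longlonglongrightarrow> 0"
        unfolding tendsto_at_iff_sequentially using h0 hl by (auto simp: o_def)
      then have "(\<lambda>n. norm (?R (h n) y)) \<longlonglongrightarrow> 0"
        by (simp add: divide_inverse mult.commute)
      then show "(\<lambda>n. ?R (h n) y) \<longlonglongrightarrow> 0"
        by (rule tendsto_norm_zero_cancel)
    qed
    show "AE y in lborel. norm (?R (h n) y) \<le> 2 * B y" for n
    proof (rule AE_I2)
      fix y
      have hn: "norm (h n) > 0" "norm (h n) \<le> 1" using h0 h1 by auto
      have on: "onorm (F' x y) \<le> B y" if "x \<in> cball x0 1" for x
        using bound[of x y] that by (intro onorm_bound) (auto simp: dist_norm norm_minus_commute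
          intro: order_trans[OF norm_ge_zero bound[of x y "SOME b. b \<in> Basis"], simplified])
      have "norm (F (x0 + h n) y - F x0 y) \<le> B y * norm ((x0 + h n) - x0)"
        by (rule differentiable_bound[of "cball x0 1" _ "\<lambda>x. F' x y"])
           (use hn on in \<open>auto simp: dist_norm norm_minus_commute intro!: has_derivative_at_withinI deriv\<close>)
      moreover have "norm (F' x0 y (h n)) \<le> B y * norm (h n)"
        by (rule bound) auto
      ultimately have "norm (F (x0 + h n) y - F x0 y - F' x0 y (h n)) \<le> 2 * B y * norm (h n)"
        using norm_triangle_ineq4[of "F (x0 + h n) y - F x0 y" "F' x0 y (h n)"] by simp
      moreover have "norm (?R (h n) y) = norm (F (x0 + h n) y - F x0 y - F' x0 y (h n)) / norm (h n)"
        by (simp add: divide_inverse mult.commute)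
      ultimately show "norm (?R (h n) y) \<le> 2 * B y"
        using hn by (simp add: pos_divide_le_eq)
    qed
  qed (use F F' B in \<open>auto intro!: borel_measurable_integrable\<close>)
  then have seq: "(\<lambda>n. LINT y|lborel. ?R (h n) y) \<longlonglongrightarrow> 0"
    if "\<forall>n. h n \<noteq> 0" "h \<longlonglongrightarrow> 0" "\<forall>n. norm (h n) \<le> 1" for h :: "nat \<Rightarrow> 'a"
    using that by simp
  \<comment> \<open>The domination holds only for increments in the unit ball; as this is a
    neighbourhood of 0, the restriction does not change the limit.\<close>
  have "((\<lambda>h. LINT y|lborel. ?R h y) \<longlongrightarrow> 0) (at 0 within cball 0 1)"
    unfolding tendsto_at_iff_sequentially unfolding o_def by (intro allI impI seq) auto
  then have "((\<lambda>h. LINT y|lborel. ?R h y) \<longlongrightarrow> 0) (at 0)"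
    by (simp add: at_within_interior[of _ "cball _ _"])
  moreover have "(LINT y|lborel. ?R h y) = ((LINT y|lborel. F (x0 + h) y) - (LINT y|lborel. F x0 y) - ?L h) /\<^sub>R norm h" for h
    using F F' by simp
  ultimately have "((\<lambda>h. ((LINT y|lborel. F (x0 + h) y) - (LINT y|lborel. F x0 y) - ?L h) /\<^sub>R norm h) \<longlongrightarrow> 0) (at 0)"
    by (simp only:)
  from tendsto_norm_zero[OF this] show ?thesis
    using bl by (simp add: has_derivative_at divide_inverse mult.commute)
qed

section \<open>Smooth and Schwartz functions\<close>

lemma partial_derivs_closed:
  assumes "f \<in> X" "set bs \<subseteq> Basis"
    and "\<And>f b. f \<in> X \<Longrightarrow> b \<in> Basis \<Longrightarrow> (\<lambda>x. frechet_derivative f (at x) b) \<in> X"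
  shows "partial_derivs bs f \<in> X"
  using assms(2) by (induction bs) (auto intro: assms(1,3))

lemma partial_derivs_append:
  "partial_derivs (xs @ ys) f = partial_derivs xs (partial_derivs ys f)"
  by (induction xs) auto

lemma smooth_differentiable: "smooth f \<Longrightarrow> f differentiable (at x)"
  unfolding smooth_def by (drule spec[of _ "[]"]) auto

lemma smooth_partial:
  assumes "smooth f" "b \<in> Basis"
  shows "smooth (\<lambda>x. frechet_derivative f (at x) b)"
  unfolding smooth_def
proof (intro allI impI)
  fix bs :: "'a list" and x assume "set bs \<subseteq> Basis"
  then have "partial_derivs (bs @ [b]) f differentiable (at x)"
    using assms unfolding smooth_def by (intro assms(1)[unfolded smooth_def, rule_format]) auto
  then show "partial_derivs bs (\<lambda>x. frechet_derivative f (at x) b) differentiable (at x)"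
    by (simp add: partial_derivs_append)
qed

text \<open>Iterated derivatives need no induction of their own: it suffices to place f in a class
  of differentiable functions that is closed under partial derivatives. Each later smoothness proof
  therefore consists in choosing X.\<close>

lemma smooth_coinduct:
  assumes "f \<in> X" "\<And>f x. f \<in> X \<Longrightarrow> f differentiable (at x)"
    and "\<And>f b. f \<in> X \<Longrightarrow> b \<in> Basis \<Longrightarrow> (\<lambda>x. frechet_derivative f (at x) b) \<in> X"
  shows "smooth f"
  unfolding smooth_def using partial_derivs_closed[OF assms(1) _ assms(3)] assms(2) by blast

lemma schwartz_iff:
  "\<phi> \<in> schwartz \<longleftrightarrow> smooth \<phi> \<and> (\<forall>bs. set bs \<subseteq> Basis \<longrightarrow> rapid (partial_derivs bs \<phi>))"
proof -
  have "bounded (range (\<lambda>x. (1 + norm x) ^ k *\<^sub>R partial_derivs bs \<phi> x)) \<longleftrightarrow>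
      (\<exists>C. \<forall>x. (1 + norm x) ^ k * norm (partial_derivs bs \<phi> x) \<le> C)" for k bs
    by (auto simp: bounded_iff)
  then show ?thesis
    unfolding schwartz_def rapid_def by blast
qed

lemma schwartz_coinduct:
  assumes "f \<in> X" "\<And>f x. f \<in> X \<Longrightarrow> f differentiable (at x)" "\<And>f. f \<in> X \<Longrightarrow> rapid f"
    and "\<And>f b. f \<in> X \<Longrightarrow> b \<in> Basis \<Longrightarrow> (\<lambda>x. frechet_derivative f (at x) b) \<in> X"
  shows "f \<in> schwartz"
  unfolding schwartz_iff
  using partial_derivs_closed[OF assms(1) _ assms(4)] smooth_coinduct[OF assms(1,2,4)] assms(3) by blast

lemma schwartz_smooth: "\<phi> \<in> schwartz \<Longrightarrow> smooth \<phi>"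
  by (simp add: schwartz_iff)

lemma schwartz_rapid: "\<phi> \<in> schwartz \<Longrightarrow> rapid \<phi>"
  unfolding schwartz_iff by (metis empty_subsetI list.set(1) partial_derivs.simps(1))

lemma schwartz_differentiable: "\<phi> \<in> schwartz \<Longrightarrow> \<phi> differentiable (at x)"
  by (intro smooth_differentiable schwartz_smooth)

lemma schwartz_partial:
  assumes "\<phi> \<in> schwartz" "b \<in> Basis"
  shows "(\<lambda>x. frechet_derivative \<phi> (at x) b) \<in> schwartz"
  unfolding schwartz_iff
proof (intro conjI allI impI smooth_partial schwartz_smooth assms)
  fix bs :: "'a list" assume "set bs \<subseteq> Basis"
  then have "rapid (partial_derivs (bs @ [b]) \<phi>)"
    using assms unfolding schwartz_iff by (intro conjunct2[OF assms(1)[unfolded schwartz_iff], rule_format]) auto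
  then show "rapid (partial_derivs bs (\<lambda>x. frechet_derivative \<phi> (at x) b))"
    by (simp add: partial_derivs_append)
qed

lemma smooth_continuous: "smooth f \<Longrightarrow> continuous_on A f"
  by (meson continuous_at_imp_continuous_on differentiable_imp_continuous_within smooth_differentiable)

lemma smooth_measurable: "smooth f \<Longrightarrow> f \<in> borel_measurable borel"
  by (intro borel_measurable_continuous_onI smooth_continuous)

lemmas schwartz_measurable = smooth_measurable[OF schwartz_smooth]
lemmas schwartz_continuous = smooth_continuous[OF schwartz_smooth]

lemma schwartz_integrable: "\<phi> \<in> schwartz \<Longrightarrow> integrable lborel \<phi>"
  by (intro rapid_integrable schwartz_rapid schwartz_measurable)

lemma frechet_derivative_expand:
  assumes "f differentiable (at x)"
  shows "frechet_derivative f (at x) h = (\<Sum>b\<in>Basis. (h \<bullet> b) *\<^sub>R frechet_derivative f (at x) b)"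
proof -
  interpret linear "frechet_derivative f (at x)"
    using assms by (rule linear_frechet_derivative)
  have "frechet_derivative f (at x) h = frechet_derivative f (at x) (\<Sum>b\<in>Basis. (h \<bullet> b) *\<^sub>R b)"
    by (simp add: euclidean_representation)
  then show ?thesis by (simp add: sum scale)
qed

lemma frechet_derivative_eqI: "(f has_derivative f') (at x) \<Longrightarrow> frechet_derivative f (at x) = f'"
  by (metis frechet_derivative_at)

text \<open>By the Leibniz rule a derivative of a product is a sum of two products. Products alone
  are therefore not closed under differentiation, but their finite sums are.\<close>

inductive_set sums_of_products :: "('a::euclidean_space \<Rightarrow> complex) set \<Rightarrow> ('a \<Rightarrow> complex) set \<Rightarrow> ('a \<Rightarrow> complex) set"
  for A B where
  prod: "f \<in> A \<Longrightarrow> g \<in> B \<Longrightarrow> (\<lambda>x. f x * g x) \<in> sums_of_products A B"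
| add: "f \<in> sums_of_products A B \<Longrightarrow> g \<in> sums_of_products A B \<Longrightarrow> (\<lambda>x. f x + g x) \<in> sums_of_products A B"

lemma sums_of_products_closed:
  assumes A: "\<And>f b. f \<in> A \<Longrightarrow> b \<in> Basis \<Longrightarrow> (\<lambda>x. frechet_derivative f (at x) b) \<in> A"
      "\<And>f x. f \<in> A \<Longrightarrow> f differentiable (at x)"
    and B: "\<And>f b. f \<in> B \<Longrightarrow> b \<in> Basis \<Longrightarrow> (\<lambda>x. frechet_derivative f (at x) b) \<in> B"
      "\<And>f x. f \<in> B \<Longrightarrow> f differentiable (at x)"
    and f: "f \<in> sums_of_products A B"
  shows "(\<forall>x. f differentiable (at x)) \<and> (\<forall>b\<in>Basis. (\<lambda>x. frechet_derivative f (at x) b) \<in> sums_of_products A B)"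
  using f
proof induction
  case (prod f g)
  have d: "((\<lambda>x. f x * g x) has_derivative
      (\<lambda>h. f x * frechet_derivative g (at x) h + frechet_derivative f (at x) h * g x)) (at x)" for x
    using A(2)[OF prod(1), of x] B(2)[OF prod(2), of x]
    by (intro has_derivative_mult) (auto simp: frechet_derivative_works)
  have "(\<lambda>x. f x * frechet_derivative g (at x) b + frechet_derivative f (at x) b * g x) \<in> sums_of_products A B"
    if "b \<in> Basis" for b
    using that prod A B by (intro sums_of_products.intros)
  then show ?case
    using d by (auto simp: frechet_derivative_eqI[OF d] differentiable_def)
next
  case (add f g)
  have d: "((\<lambda>x. f x + g x) has_derivative
      (\<lambda>h. frechet_derivative f (at x) h + frechet_derivative g (at x) h)) (at x)" for x
    using add by (intro has_derivative_add) (auto simp: frechet_derivative_works)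
  have "(\<lambda>x. frechet_derivative f (at x) b + frechet_derivative g (at x) b) \<in> sums_of_products A B"
    if "b \<in> Basis" for b
    using that add by (intro sums_of_products.add) auto
  then show ?case
    using d by (auto simp: frechet_derivative_eqI[OF d] differentiable_def)
qed

lemma smooth_mult:
  assumes "smooth f" "smooth g"
  shows "smooth (\<lambda>x. f x * g x)"
proof (rule smooth_coinduct)
  let ?X = "sums_of_products (Collect smooth) (Collect smooth)"
  show "(\<lambda>x. f x * g x) \<in> ?X"
    using assms by (intro sums_of_products.prod) auto
  have cl: "(\<forall>x. f differentiable (at x)) \<and> (\<forall>b\<in>Basis. (\<lambda>x. frechet_derivative f (at x) b) \<in> ?X)" if "f \<in> ?X" for f
    by (rule sums_of_products_closed[OF _ _ _ _ that]) (auto intro: smooth_partial smooth_differentiable)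
  show "f differentiable (at x)" if "f \<in> ?X" for f x using cl that by blast
  show "(\<lambda>x. frechet_derivative f (at x) b) \<in> ?X" if "f \<in> ?X" "b \<in> Basis" for f b using cl that by blast
qed

lemma smooth_const: "smooth (\<lambda>x. c)"
  by (rule smooth_coinduct[where X = "range (\<lambda>c x. c)"]) auto

lemma smooth_cmult: "smooth f \<Longrightarrow> smooth (\<lambda>x. c * f x)"
  by (intro smooth_mult smooth_const)

lemma smooth_add:
  assumes "smooth f" "smooth g"
  shows "smooth (\<lambda>x. f x + g x)"
proof (rule smooth_coinduct[where X = "{\<lambda>x. f x + g x | f g. smooth f \<and> smooth g}"], goal_cases)
  case (3 h b)
  then obtain f g where fg: "smooth f" "smooth g" "h = (\<lambda>x. f x + g x)" by auto
  have "((\<lambda>x. f x + g x) has_derivative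
      (\<lambda>h. frechet_derivative f (at x) h + frechet_derivative g (at x) h)) (at x)" for x
    using fg by (intro has_derivative_add) (auto simp: frechet_derivative_works[symmetric] smooth_differentiable)
  from frechet_derivative_eqI[OF this] show ?case
    unfolding fg(3) mem_Collect_eq
    by (intro exI[of _ "\<lambda>x. frechet_derivative f (at x) b"] exI[of _ "\<lambda>x. frechet_derivative g (at x) b"])
      (use fg(1,2) smooth_partial[OF _ 3(2)] in simp)
next
  case (2 h x)
  then show ?case by (auto intro: differentiable_add smooth_differentiable)
qed (use assms in auto)

lemma smooth_diff: "smooth f \<Longrightarrow> smooth g \<Longrightarrow> smooth (\<lambda>x. f x - g x)"
  using smooth_add[of f "\<lambda>x. (- 1) * g x"] smooth_cmult[of g "- 1"] by simp

section \<open>Affine changes of variables\<close>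

lemma lborel_integral_affine:
  fixes f :: "'a::euclidean_space \<Rightarrow> 'b::{banach, second_countable_topology}"
  assumes "f \<in> borel_measurable borel" "c \<noteq> 0"
  shows "(LINT y|lborel. f y) = \<bar>c\<bar> ^ DIM('a) *\<^sub>R (LINT y|lborel. f (t + c *\<^sub>R y))"
  using assms
  by (subst lborel_affine[of c t]) (auto simp: integral_density integral_distr)

lemma lborel_integrable_affine:
  fixes f :: "'a::euclidean_space \<Rightarrow> 'b::{banach, second_countable_topology}"
  assumes "integrable lborel f" "c \<noteq> 0"
  shows "integrable lborel (\<lambda>y. f (t + c *\<^sub>R y))"
proof -
  have f: "f \<in> borel_measurable borel" using assms(1) by auto
  have "integrable (density (distr lborel borel (\<lambda>x. t + c *\<^sub>R x)) (\<lambda>_. ennreal (\<bar>c\<bar> ^ DIM('a)))) f"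
    using assms(1) by (subst (asm) lborel_affine[OF assms(2), of t]) simp
  then have "integrable (distr lborel borel (\<lambda>x. t + c *\<^sub>R x)) (\<lambda>x. (\<bar>c\<bar> ^ DIM('a)) *\<^sub>R f x)"
    using f by (subst (asm) integrable_density) auto
  then have "integrable lborel (\<lambda>y. (\<bar>c\<bar> ^ DIM('a)) *\<^sub>R f (t + c *\<^sub>R y))"
    using f by (subst (asm) integrable_distr_eq) auto
  then have "integrable lborel (\<lambda>y. inverse (\<bar>c\<bar> ^ DIM('a)) *\<^sub>R (\<bar>c\<bar> ^ DIM('a)) *\<^sub>R f (t + c *\<^sub>R y))"
    by (rule integrable_scaleR_right)
  then show ?thesis
    using assms(2) by simp
qed

lemma lborel_integral_reflect:
  fixes f :: "'a::euclidean_space \<Rightarrow> 'b::{banach, second_countable_topology}"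
  assumes "f \<in> borel_measurable borel"
  shows "(LINT y|lborel. f (x - y)) = (LINT y|lborel. f y)"
  using lborel_integral_affine[OF assms, of "- 1" x] by simp

lemma lborel_nn_integral_reflect:
  fixes f :: "'a::euclidean_space \<Rightarrow> ennreal"
  assumes "f \<in> borel_measurable borel"
  shows "(\<integral>\<^sup>+ y. f (x - y) \<partial>lborel) = (\<integral>\<^sup>+ y. f y \<partial>lborel)"
proof -
  have "(\<integral>\<^sup>+ y. f y \<partial>lborel) = (\<integral>\<^sup>+ y. f y \<partial>density (distr lborel borel (\<lambda>y. x + (- 1) *\<^sub>R y)) (\<lambda>_. ennreal (\<bar>- 1\<bar> ^ DIM('a))))"
    by (subst lborel_affine[of "- 1" x]) auto
  also have "\<dots> = (\<integral>\<^sup>+ y. f (x - y) \<partial>lborel)"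
    using assms by (simp add: density_1 nn_integral_distr)
  finally show ?thesis ..
qed

section \<open>Convolution with Schwartz functions\<close>

text \<open>The functions with which every Schwartz function can be convolved.\<close>

definition slow :: "('a::euclidean_space \<Rightarrow> complex) \<Rightarrow> bool" where
  "slow g \<longleftrightarrow> g \<in> borel_measurable borel \<and>
    (\<forall>v::'a \<Rightarrow> real. v \<in> borel_measurable borel \<longrightarrow> rapid v \<longrightarrow> integrable lborel (\<lambda>x. v x *\<^sub>R g x))"

definition conv :: "('a::euclidean_space \<Rightarrow> complex) \<Rightarrow> ('a \<Rightarrow> complex) \<Rightarrow> 'a \<Rightarrow> complex" where
  "conv g \<phi> x = (LINT y|lborel. g y * \<phi> (x - y))"

lemma slow_measurable: "slow g \<Longrightarrow> g \<in> borel_measurable borel"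
  by (simp add: slow_def)

lemma slow_integrable_norm:
  assumes "slow g" "rapid v" "v \<in> borel_measurable borel"
  shows "integrable lborel (\<lambda>x. norm (g x) * norm (v x :: 'b::{banach, second_countable_topology}))"
proof -
  have "integrable lborel (\<lambda>x. norm (v x) *\<^sub>R g x)"
    using assms rapid_norm[OF assms(2)] unfolding slow_def by auto
  from integrable_norm[OF this] show ?thesis by (simp add: mult.commute)
qed

lemma slow_integrable:
  assumes "slow g" "rapid u" "u \<in> borel_measurable borel"
  shows "integrable lborel (\<lambda>x. g x * u x)"
  using slow_integrable_norm[OF assms] assms(3) slow_measurable[OF assms(1)]
  by (elim Bochner_Integration.integrable_bound) (auto simp: norm_mult)

lemma slowI_bounded:
  assumes "g \<in> borel_measurable borel" "\<And>x. norm (g x) \<le> C"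
  shows "slow g"
  unfolding slow_def
proof (intro conjI allI impI assms)
  fix v :: "'a \<Rightarrow> real" assume v: "v \<in> borel_measurable borel" "rapid v"
  have "0 \<le> C" using assms(2) norm_ge_zero order_trans by blast
  then have "rapid (\<lambda>x. v x *\<^sub>R g x)"
    using assms(2) by (intro rapid_mono[OF v(2), of _ C 0]) (auto simp: mult.commute[of C] intro!: mult_left_mono)
  then show "integrable lborel (\<lambda>x. v x *\<^sub>R g x)"
    using v assms by (intro rapid_integrable) auto
qed

lemma slow_one: "slow (\<lambda>x. 1)"
  by (rule slowI_bounded[of _ 1]) auto

lemma rapid_slow:
  assumes "rapid u" "u \<in> borel_measurable borel" shows "slow u"
  using rapid_bounded[OF assms(1)] slowI_bounded[OF assms(2)] by metis

text \<open>The majorant shifted outwards by \<open>norm x\<close> does it: the sum of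
  \<open>x - y\<close> and y has length exactly \<open>norm x\<close>.\<close>

lemma rapid_reflect:
  fixes u :: "'a::euclidean_space \<Rightarrow> 'b::real_normed_vector"
  assumes "rapid u"
  shows "rapid (\<lambda>y. u (x - y))"
proof -
  obtain v :: "'a \<Rightarrow> real" where v: "rapid v" "\<And>z. v z \<ge> 0" "\<And>z y. norm (y + z) \<le> norm x \<Longrightarrow> norm (u y) \<le> v z"
    using rapid_majorant[OF assms norm_ge_zero[of x]] by metis
  show ?thesis
    by (rule rapid_le[OF v(1)]) (use v(2,3) in auto)
qed

lemma slow_conv_integrable:
  assumes "slow g" "rapid u" "u \<in> borel_measurable borel"
  shows "integrable lborel (\<lambda>y. g y * u (x - y))"
  using assms by (intro slow_integrable rapid_reflect) auto

text \<open>All derivatives fall on \<phi>, so no regularity of g enters. Domination for all x' in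
  the unit ball around x comes from one majorant of the partial derivatives, shifted by
  \<open>norm x + 1\<close>.\<close>

lemma conv_has_derivative:
  assumes g: "slow g" and \<phi>: "\<phi> \<in> schwartz"
  shows "(conv g \<phi> has_derivative (\<lambda>h. conv g (\<lambda>z. frechet_derivative \<phi> (at z) h) x)) (at x)"
proof -
  let ?d = "\<lambda>z h. frechet_derivative \<phi> (at z) h"
  define w where "w z = (\<Sum>b\<in>Basis. norm (?d z b))" for z
  have "rapid w"
    unfolding w_def by (intro rapid_sum rapid_norm schwartz_rapid schwartz_partial \<phi>) auto
  then obtain v :: "'a \<Rightarrow> real" where v: "v \<in> borel_measurable borel" "rapid v" "\<And>z. v z \<ge> 0"
      "\<And>z y. norm (y + z) \<le> norm x + 1 \<Longrightarrow> norm (w y) \<le> v z"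
    using rapid_majorant[of w "norm x + 1"] by (metis add_nonneg_nonneg norm_ge_zero zero_le_one)
  have exp: "?d z h = (\<Sum>b\<in>Basis. (h \<bullet> b) *\<^sub>R ?d z b)" for z h
    by (intro frechet_derivative_expand schwartz_differentiable \<phi>)
  have le: "norm (?d z h) \<le> w z * norm h" for z h
  proof -
    have "norm (?d z h) \<le> (\<Sum>b\<in>Basis. norm ((h \<bullet> b) *\<^sub>R ?d z b))"
      by (subst exp) (rule norm_sum)
    also have "\<dots> \<le> (\<Sum>b\<in>Basis. norm h * norm (?d z b))"
      using Basis_le_norm by (intro sum_mono) (auto intro!: mult_right_mono)
    finally show ?thesis by (simp add: w_def sum_distrib_left mult.commute)
  qed
  have int: "integrable lborel (\<lambda>y. g y * ?d (x - y) h)" for h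
  proof -
    have "integrable lborel (\<lambda>y. \<Sum>b\<in>Basis. (h \<bullet> b) *\<^sub>R (g y * ?d (x - y) b))"
      by (intro Bochner_Integration.integrable_sum integrable_scaleR_right slow_conv_integrable
          schwartz_rapid schwartz_measurable schwartz_partial g \<phi>)
    moreover have "g y * ?d (x - y) h = (\<Sum>b\<in>Basis. (h \<bullet> b) *\<^sub>R (g y * ?d (x - y) b))" for y
      by (subst exp) (simp add: sum_distrib_left)
    ultimately show ?thesis by simp
  qed
  have "((\<lambda>x. LINT y|lborel. g y * \<phi> (x - y)) has_derivative (\<lambda>h. LINT y|lborel. g y * ?d (x - y) h)) (at x)"
  proof (rule has_derivative_integral[where F' = "\<lambda>x y h. g y * ?d (x - y) h" and B = "\<lambda>y. norm (g y) * norm (v y)"])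
    show "integrable lborel (\<lambda>y. g y * \<phi> (x - y))" for x
      by (intro slow_conv_integrable schwartz_rapid schwartz_measurable g \<phi>)
    show "integrable lborel (\<lambda>y. norm (g y) * norm (v y))"
      by (intro slow_integrable_norm g v)
    show "((\<lambda>x. g y * \<phi> (x - y)) has_derivative (\<lambda>h. g y * ?d (x' - y) h)) (at x')" for x' y
    proof -
      have "(\<phi> has_derivative ?d (x' - y)) (at (x' - y))"
        using schwartz_differentiable[OF \<phi>] frechet_derivative_works by blast
      moreover have "((\<lambda>x. x - y) has_derivative (\<lambda>h. h)) (at x')"
        by (auto intro!: derivative_eq_intros)
      ultimately have "((\<lambda>x. \<phi> (x - y)) has_derivative ?d (x' - y)) (at x')"
        using has_derivative_compose[of "\<lambda>x. x - y" "\<lambda>h. h" x' UNIV \<phi>] by simp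
      then show ?thesis by (rule has_derivative_mult_right)
    qed
    show "norm (g y * ?d (x' - y) h) \<le> norm (g y) * norm (v y) * norm h" if "norm (x' - x) \<le> 1" for x' y h
    proof -
      have "norm (w (x' - y)) \<le> v y"
        using that norm_triangle_ineq2[of x' x] by (intro v) auto
      then have "w (x' - y) \<le> norm (v y)" by auto
      then have "norm (?d (x' - y) h) \<le> norm (v y) * norm h"
        by (intro order_trans[OF le] mult_right_mono) auto
      then show ?thesis
        by (simp add: norm_mult mult.assoc mult_left_mono)
    qed
  qed (use int in auto)
  then show ?thesis by (simp add: conv_def[abs_def])
qed

lemma conv_smooth:
  assumes "slow g" "\<phi> \<in> schwartz"
  shows "smooth (conv g \<phi>)"
proof (rule smooth_coinduct)
  show "conv g \<phi> \<in> conv g ` schwartz" using assms by auto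
  fix f assume f: "f \<in> conv g ` schwartz"
  show "f differentiable (at x)" for x
    using f conv_has_derivative[OF assms(1)] by (auto simp: differentiable_def)
  show "(\<lambda>x. frechet_derivative f (at x) b) \<in> conv g ` schwartz" if "b \<in> Basis" for b
    using f schwartz_partial[OF _ that] by (auto simp: frechet_derivative_eqI[OF conv_has_derivative[OF assms(1)]])
qed

text \<open>The weight is submultiplicative,
  \<open>1 + norm x \<le> (1 + norm y) * (1 + norm (x - y))\<close>. Its k-th power splits
  accordingly: one factor is absorbed by the decay of w, the other is integrated against u.\<close>

lemma conv_rapid:
  assumes u: "rapid u" "u \<in> borel_measurable borel" and w: "rapid w" "w \<in> borel_measurable borel"
  shows "rapid (conv u w)"
  unfolding rapid_def
proof
  fix k
  obtain C where C: "C \<ge> 0" "\<And>x. (1 + norm x) ^ k * norm (w x) \<le> C"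
    using rapidE[OF w(1)] by blast
  let ?U = "\<lambda>y. (1 + norm y) ^ k * norm (u y)"
  have "rapid ?U"
    by (rule rapid_mono[OF u(1), of _ 1 k]) auto
  then have U: "integrable lborel ?U"
    using u by (intro rapid_integrable) auto
  have "(1 + norm x) ^ k * norm (conv u w x) \<le> (LINT y|lborel. C * ?U y)" for x
  proof -
    have "norm ((1 + norm x) ^ k *\<^sub>R (LINT y|lborel. u y * w (x - y))) =
        norm (LINT y|lborel. (1 + norm x) ^ k *\<^sub>R (u y * w (x - y)))"
      by simp
    also have "\<dots> \<le> (LINT y|lborel. C * ?U y)"
    proof (rule Bochner_Integration.integral_norm_bound_integral)
      show "integrable lborel (\<lambda>y. (1 + norm x) ^ k *\<^sub>R (u y * w (x - y)))"
        by (intro integrable_scaleR_right slow_conv_integrable rapid_slow u w)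
      show "integrable lborel (\<lambda>y. C * ?U y)" using U by simp
      fix y
      have "1 + norm x \<le> (1 + norm y) * (1 + norm (x - y))"
      proof -
        have "norm x \<le> norm y + norm (x - y)" "0 \<le> norm y * norm (x - y)"
          using norm_triangle_ineq[of y "x - y"] by auto
        then show ?thesis unfolding distrib_left distrib_right mult_1_left mult_1_right by linarith
      qed
      then have "(1 + norm x) ^ k \<le> (1 + norm y) ^ k * (1 + norm (x - y)) ^ k"
        using power_mono[of "1 + norm x" "(1 + norm y) * (1 + norm (x - y))" k] by (simp add: power_mult_distrib)
      then have "norm ((1 + norm x) ^ k *\<^sub>R (u y * w (x - y))) \<le> ((1 + norm y) ^ k * (1 + norm (x - y)) ^ k) * (norm (u y) * norm (w (x - y)))"
        by (simp add: norm_mult mult_right_mono)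
      also have "\<dots> = ((1 + norm (x - y)) ^ k * norm (w (x - y))) * ?U y" by simp
      also have "\<dots> \<le> C * ?U y" by (intro mult_right_mono C) auto
      finally show "norm ((1 + norm x) ^ k *\<^sub>R (u y * w (x - y))) \<le> C * ?U y" .
    qed
    finally show ?thesis by (simp add: conv_def)
  qed
  then show "\<exists>C. \<forall>x. (1 + norm x) ^ k * norm (conv u w x) \<le> C" by blast
qed

lemma conv_schwartz:
  assumes "rapid u" "u \<in> borel_measurable borel" "\<phi> \<in> schwartz"
  shows "conv u \<phi> \<in> schwartz"
proof (rule schwartz_coinduct)
  note slow = rapid_slow[OF assms(1,2)]
  show "conv u \<phi> \<in> conv u ` schwartz" using assms by auto
  fix f assume f: "f \<in> conv u ` schwartz"
  show "f differentiable (at x)" for x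
    using f conv_has_derivative[OF slow] by (auto simp: differentiable_def)
  show "rapid f"
    using f assms conv_rapid schwartz_rapid schwartz_measurable by blast
  show "(\<lambda>x. frechet_derivative f (at x) b) \<in> conv u ` schwartz" if "b \<in> Basis" for b
    using f schwartz_partial[OF _ that] by (auto simp: frechet_derivative_eqI[OF conv_has_derivative[OF slow]])
qed

text \<open>By translation invariance the convolution of \<phi> with the constant 1 is constant. Its
  derivative, the convolution of 1 with the derivative of \<phi>, is therefore 0. This replaces
  boundary terms in the integration by parts below.\<close>

lemma integral_partial_eq_0:
  assumes "\<phi> \<in> schwartz" "b \<in> Basis"
  shows "(LINT y|lborel. frechet_derivative \<phi> (at y) b) = 0"
proof -
  have c: "conv (\<lambda>_. 1) \<psi> x = (LINT y|lborel. \<psi> y)" if "\<psi> \<in> schwartz" for \<psi> x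
    using lborel_integral_reflect[OF schwartz_measurable[OF that]] by (simp add: conv_def)
  have "conv (\<lambda>_. 1) \<phi> = (\<lambda>_. LINT y|lborel. \<phi> y)"
    using c[OF assms(1)] by auto
  then have "((\<lambda>_. LINT y|lborel. \<phi> y) has_derivative (\<lambda>h. conv (\<lambda>_. 1) (\<lambda>z. frechet_derivative \<phi> (at z) h) 0)) (at 0)"
    using conv_has_derivative[OF slow_one assms(1)] by metis
  moreover have "((\<lambda>_. LINT y|lborel. \<phi> y) has_derivative (\<lambda>h. 0)) (at 0)"
    by (rule has_derivative_const)
  ultimately have "(\<lambda>h. conv (\<lambda>_. 1) (\<lambda>z. frechet_derivative \<phi> (at z) h) 0) = (\<lambda>h. 0)"
    by (rule has_derivative_unique)
  then show ?thesis
    using c[OF schwartz_partial[OF assms]] by metis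
qed

section \<open>The Fourier transform on Schwartz functions\<close>

text \<open>B is a class of multipliers of polynomial growth that is closed under differentiation.
  The two instances are the affine functions and the multiples of one exponential.\<close>

lemma schwartz_mult_closed:
  fixes B :: "('a::euclidean_space \<Rightarrow> complex) set"
  assumes f: "f \<in> schwartz" and g: "g \<in> B"
    and B: "\<And>g b. g \<in> B \<Longrightarrow> b \<in> Basis \<Longrightarrow> (\<lambda>x. frechet_derivative g (at x) b) \<in> B"
      "\<And>g x. g \<in> B \<Longrightarrow> g differentiable (at x)"
    and poly: "\<And>g. g \<in> B \<Longrightarrow> \<exists>C\<ge>0. \<exists>k. \<forall>x. norm (g x) \<le> C * (1 + norm x) ^ k"
  shows "(\<lambda>x. f x * g x) \<in> schwartz"
proof (rule schwartz_coinduct)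
  let ?X = "sums_of_products schwartz B"
  show "(\<lambda>x. f x * g x) \<in> ?X"
    using f g by (rule sums_of_products.prod)
  have cl: "(\<forall>x. h differentiable (at x)) \<and> (\<forall>b\<in>Basis. (\<lambda>x. frechet_derivative h (at x) b) \<in> ?X)" if "h \<in> ?X" for h
    by (rule sums_of_products_closed[OF _ _ _ _ that]) (auto intro: schwartz_partial schwartz_differentiable B)
  show "h differentiable (at x)" if "h \<in> ?X" for h x using cl that by blast
  show "(\<lambda>x. frechet_derivative h (at x) b) \<in> ?X" if "h \<in> ?X" "b \<in> Basis" for h b using cl that by blast
  show "rapid h" if "h \<in> ?X" for h
    using that
  proof induction
    case (prod f g)
    from poly[OF prod(2)] obtain C k where C: "C \<ge> 0" "\<And>x. norm (g x) \<le> C * (1 + norm x) ^ k" by metis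
    show ?case
      by (rule rapid_mono[OF schwartz_rapid[OF prod(1)], of _ C k])
        (use C in \<open>auto simp: norm_mult mult.commute[of "norm (f _)"] intro!: mult_right_mono\<close>)
  qed (rule rapid_add)
qed

lemma affine_has_derivative:
  "((\<lambda>x::'a::euclidean_space. c + d * complex_of_real (x \<bullet> a)) has_derivative (\<lambda>h. d * complex_of_real (h \<bullet> a))) (at x)"
  by (auto intro!: derivative_eq_intros has_derivative_of_real)

lemma schwartz_mult_affine:
  fixes f :: "'a::euclidean_space \<Rightarrow> complex"
  assumes "f \<in> schwartz"
  shows "(\<lambda>x. f x * (c + d * complex_of_real (x \<bullet> a))) \<in> schwartz"
proof (rule schwartz_mult_closed[OF assms, of _ "{\<lambda>x. c + d * complex_of_real (x \<bullet> a) | c d. True}"], goal_cases)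
  case (2 g b)
  then obtain c d where g: "g = (\<lambda>x. c + d * complex_of_real (x \<bullet> a))" by auto
  show ?case
    unfolding g frechet_derivative_eqI[OF affine_has_derivative]
    by (simp, intro exI[of _ "d * complex_of_real (b \<bullet> a)"] exI[of _ "0::complex"]) auto
next
  case (3 g x)
  then obtain c d where g: "g = (\<lambda>x. c + d * complex_of_real (x \<bullet> a))" by auto
  show ?case unfolding g differentiable_def by (rule exI, rule affine_has_derivative)
next
  case (4 g)
  then obtain c d where g: "g = (\<lambda>x. c + d * complex_of_real (x \<bullet> a))" by auto
  have "norm (g x) \<le> (norm c + norm d * norm a) * (1 + norm x) ^ 1" for x
  proof -
    have "norm (g x) \<le> norm c + norm d * \<bar>x \<bullet> a\<bar>"
      unfolding g by (rule order_trans[OF norm_triangle_ineq]) (simp add: norm_mult)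
    also have "\<dots> \<le> norm c * (1 + norm x) + norm d * ((1 + norm x) * norm a)"
    proof (intro add_mono mult_left_mono)
      show "norm c \<le> norm c * (1 + norm x)" by (simp add: distrib_left)
      show "\<bar>x \<bullet> a\<bar> \<le> (1 + norm x) * norm a"
        by (rule order_trans[OF Cauchy_Schwarz_ineq2]) (simp add: mult_right_mono)
    qed auto
    finally show ?thesis by (simp add: algebra_simps)
  qed
  then show ?case
    by (intro exI[of _ "norm c + norm d * norm a"] conjI exI[of _ 1]) auto
qed auto

lemma cis_has_derivative:
  "((\<lambda>x::'a::euclidean_space. c * cis (s * (x \<bullet> \<xi>))) has_derivative (\<lambda>h. c * (of_real (s * (h \<bullet> \<xi>)) * (\<i> * cis (s * (x \<bullet> \<xi>)))))) (at x)"
proof -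
  have "((\<lambda>x. cis (s * (x \<bullet> \<xi>))) has_derivative (\<lambda>h. (s * (h \<bullet> \<xi>)) *\<^sub>R (\<i> * cis (s * (x \<bullet> \<xi>))))) (at x)"
    by (rule has_derivative_cis) (auto intro!: derivative_eq_intros)
  then have "((\<lambda>x. c * cis (s * (x \<bullet> \<xi>))) has_derivative (\<lambda>h. c * ((s * (h \<bullet> \<xi>)) *\<^sub>R (\<i> * cis (s * (x \<bullet> \<xi>)))))) (at x)"
    by (rule has_derivative_mult_right)
  then show ?thesis by (simp add: scaleR_conv_of_real)
qed

lemma smooth_cis: "smooth (\<lambda>x::'a::euclidean_space. cis (s * (x \<bullet> \<xi>)))"
  and schwartz_mult_cis: "f \<in> schwartz \<Longrightarrow> (\<lambda>x::'a. f x * cis (s * (x \<bullet> \<xi>))) \<in> schwartz"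
proof -
  let ?X = "range (\<lambda>c x::'a. c * cis (s * (x \<bullet> \<xi>)))"
  have 0: "(\<lambda>x. cis (s * (x \<bullet> \<xi>))) \<in> ?X"
    by (intro image_eqI[of _ _ 1]) auto
  have 1: "g differentiable (at x)" if "g \<in> ?X" for g x
    proof -
    from that obtain c where g: "g = (\<lambda>x. c * cis (s * (x \<bullet> \<xi>)))" by auto
    show ?thesis unfolding g differentiable_def by (rule exI, rule cis_has_derivative)
  qed
  have 2: "(\<lambda>x. frechet_derivative g (at x) b) \<in> ?X" if "g \<in> ?X" for g b
  proof -
    from that obtain c where g: "g = (\<lambda>x. c * cis (s * (x \<bullet> \<xi>)))" by auto
    show ?thesis
      unfolding g frechet_derivative_eqI[OF cis_has_derivative]
      by (intro image_eqI[of _ _ "c * (of_real (s * (b \<bullet> \<xi>)) * \<i>)"]) (auto simp: mult.assoc)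
  qed
  show "smooth (\<lambda>x::'a. cis (s * (x \<bullet> \<xi>)))"
    by (rule smooth_coinduct[OF 0 1 2])
  show "(\<lambda>x::'a. f x * cis (s * (x \<bullet> \<xi>))) \<in> schwartz" if "f \<in> schwartz"
  proof (rule schwartz_mult_closed[OF that 0 2 1])
    fix g assume "g \<in> ?X"
    then obtain c where g: "g = (\<lambda>x. c * cis (s * (x \<bullet> \<xi>)))" by auto
    show "\<exists>C\<ge>0. \<exists>k. \<forall>x. norm (g x) \<le> C * (1 + norm x) ^ k"
      by (intro exI[of _ "norm c"] conjI exI[of _ 0]) (auto simp: g norm_mult)
  qed
qed

text \<open>The Fourier integral without normalization. The values s = - 1 and s = 1 give
  \<open>fourier\<close> and \<open>inv_fourier\<close> up to a common factor, so both are treated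
  at once.\<close>

definition osc :: "real \<Rightarrow> ('a::euclidean_space \<Rightarrow> complex) \<Rightarrow> 'a \<Rightarrow> complex" where
  "osc s \<phi> \<xi> = (LINT x|lborel. cis (s * (x \<bullet> \<xi>)) * \<phi> x)"

lemma cis_measurable [measurable]: "cis \<in> borel_measurable borel"
  by (intro borel_measurable_continuous_onI continuous_on_cis continuous_on_id)

lemma osc_integrable:
  assumes "integrable lborel \<phi>"
  shows "integrable lborel (\<lambda>x. cis (s * (x \<bullet> \<xi>)) * \<phi> x)"
  by (rule Bochner_Integration.integrable_bound[OF assms])
    (use assms in \<open>auto simp: norm_mult intro!: borel_measurable_times borel_measurable_integrable\<close>)

lemma norm_osc_le: "norm (osc s \<phi> \<xi>) \<le> (LINT x|lborel. norm (\<phi> x))"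
  unfolding osc_def by (rule order_trans[OF integral_norm_bound]) (simp add: norm_mult)

text \<open>The exponential brings down a linear factor in x, written with a leading 0 to have the
  shape of \<open>schwartz_mult_affine\<close>. The derivative is thus \<open>osc s\<close> of
  another Schwartz function, which is the closure property behind
  \<open>osc_schwartz\<close>.\<close>

lemma osc_has_derivative:
  assumes \<phi>: "\<phi> \<in> schwartz"
  shows "(osc s \<phi> has_derivative (\<lambda>h. osc s (\<lambda>x. \<phi> x * (0 + (\<i> * of_real s) * of_real (x \<bullet> h))) \<xi>)) (at \<xi>)"
proof -
  have eq: "cis (s * (x \<bullet> \<xi>)) * (\<phi> x * (0 + (\<i> * of_real s) * of_real (x \<bullet> h))) =
      \<phi> x * (of_real (s * (h \<bullet> x)) * (\<i> * cis (s * (\<xi> \<bullet> x))))" for x h \<xi>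
    by (simp add: inner_commute)
  have eq2: "cis (s * (x \<bullet> \<xi>)) * \<phi> x = \<phi> x * cis (s * (\<xi> \<bullet> x))" for x \<xi>
    by (simp add: inner_commute)
  have "((\<lambda>\<xi>. LINT x|lborel. cis (s * (x \<bullet> \<xi>)) * \<phi> x) has_derivative
      (\<lambda>h. LINT x|lborel. cis (s * (x \<bullet> \<xi>)) * (\<phi> x * (0 + (\<i> * of_real s) * of_real (x \<bullet> h))))) (at \<xi>)"
  proof (rule has_derivative_integral[where B = "\<lambda>x. \<bar>s\<bar> * (norm x * norm (\<phi> x))" and
        F' = "\<lambda>\<xi> x h. cis (s * (x \<bullet> \<xi>)) * (\<phi> x * (0 + (\<i> * of_real s) * of_real (x \<bullet> h)))"])
    show "integrable lborel (\<lambda>x. cis (s * (x \<bullet> \<xi>)) * \<phi> x)" for \<xi>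
      by (intro osc_integrable schwartz_integrable \<phi>)
    show "integrable lborel (\<lambda>x. cis (s * (x \<bullet> \<xi>)) * (\<phi> x * (0 + (\<i> * of_real s) * of_real (x \<bullet> h))))" for h
      by (intro osc_integrable schwartz_integrable schwartz_mult_affine \<phi>)
    show "((\<lambda>\<xi>. cis (s * (x \<bullet> \<xi>)) * \<phi> x) has_derivative
        (\<lambda>h. cis (s * (x \<bullet> \<xi>)) * (\<phi> x * (0 + (\<i> * of_real s) * of_real (x \<bullet> h))))) (at \<xi>)" for x \<xi>
      unfolding eq eq2 by (rule cis_has_derivative)
    show "norm (cis (s * (x \<bullet> \<xi>)) * (\<phi> x * (0 + (\<i> * of_real s) * of_real (x \<bullet> h)))) \<le> \<bar>s\<bar> * (norm x * norm (\<phi> x)) * norm h" for x \<xi> h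
      using mult_left_mono[OF Cauchy_Schwarz_ineq2[of x h], of "\<bar>s\<bar> * norm (\<phi> x)"]
      by (simp add: norm_mult algebra_simps)
    have "rapid (\<lambda>x. norm x * norm (\<phi> x))"
      by (rule rapid_mono[OF schwartz_rapid[OF \<phi>], of _ 1 1]) (auto intro!: mult_right_mono)
    then show "integrable lborel (\<lambda>x. \<bar>s\<bar> * (norm x * norm (\<phi> x)))"
      using schwartz_measurable[OF \<phi>] by (intro integrable_mult_right rapid_integrable) auto
  qed
  then show ?thesis by (simp add: osc_def[abs_def])
qed

text \<open>Integration by parts: the derivative of \<phi> times the exponential has integral 0. A
  power of \<xi> is traded for a derivative of \<phi>, which is the source of decay in
  \<open>osc_rapid\<close>.\<close>

lemma osc_partial:
  assumes "\<phi> \<in> schwartz" "b \<in> Basis" and s: "s \<noteq> 0"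
  shows "of_real (\<xi> \<bullet> b) * osc s \<phi> \<xi> = (\<i> / of_real s) * osc s (\<lambda>x. frechet_derivative \<phi> (at x) b) \<xi>"
proof -
  let ?e = "\<lambda>x. cis (s * (x \<bullet> \<xi>))"
  let ?d = "\<lambda>x. frechet_derivative \<phi> (at x) b"
  have d: "((\<lambda>x. \<phi> x * ?e x) has_derivative
      (\<lambda>h. \<phi> x * (1 * (of_real (s * (h \<bullet> \<xi>)) * (\<i> * ?e x))) + frechet_derivative \<phi> (at x) h * ?e x)) (at x)" for x
    using has_derivative_mult[OF schwartz_differentiable[OF assms(1), of x, unfolded frechet_derivative_works] cis_has_derivative[of 1 s \<xi> x]] by simp
  have "(LINT x|lborel. \<phi> x * (1 * (of_real (s * (b \<bullet> \<xi>)) * (\<i> * ?e x))) + ?d x * ?e x) = 0"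
    using integral_partial_eq_0[OF schwartz_mult_cis[OF assms(1), of s \<xi>] assms(2)]
    unfolding frechet_derivative_eqI[OF d] .
  also have "(LINT x|lborel. \<phi> x * (1 * (of_real (s * (b \<bullet> \<xi>)) * (\<i> * ?e x))) + ?d x * ?e x) =
      (LINT x|lborel. of_real (s * (b \<bullet> \<xi>)) * \<i> * (?e x * \<phi> x) + ?e x * ?d x)"
    by (intro Bochner_Integration.integral_cong) (auto simp: algebra_simps)
  also have "\<dots> = of_real (s * (b \<bullet> \<xi>)) * \<i> * osc s \<phi> \<xi> + osc s ?d \<xi>"
    unfolding osc_def
    by (subst Bochner_Integration.integral_add)
      (simp_all add: osc_integrable schwartz_integrable schwartz_partial assms)
  finally have "of_real (s * (b \<bullet> \<xi>)) * \<i> * osc s \<phi> \<xi> = - osc s ?d \<xi>"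
    by (simp add: eq_neg_iff_add_eq_0)
  then have "(- \<i>) * (of_real (s * (b \<bullet> \<xi>)) * \<i> * osc s \<phi> \<xi>) = (- \<i>) * (- osc s ?d \<xi>)"
    by (rule arg_cong)
  moreover have "(- \<i>) * (A * \<i> * z) = - (\<i> * \<i>) * (A * z)" for A z
    by algebra
  ultimately have "of_real s * of_real (b \<bullet> \<xi>) * osc s \<phi> \<xi> = \<i> * osc s ?d \<xi>"
    by simp
  then show ?thesis using s by (simp add: field_simps inner_commute)
qed

lemma osc_rapid:
  assumes "\<phi> \<in> schwartz" "s \<noteq> 0"
  shows "rapid (osc s \<phi>)"
proof -
  \<comment> \<open>The induction hypothesis ranges over all Schwartz functions because the step
    passes from \<phi> to its partial derivatives.\<close>
  have "\<forall>\<phi>\<in>schwartz. \<exists>C. \<forall>\<xi>::'a. (1 + norm \<xi>) ^ k * norm (osc s \<phi> \<xi>) \<le> C" for k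
  proof (induction k)
    case 0
    then show ?case using norm_osc_le by auto
  next
    case (Suc k)
    then obtain C where C: "\<And>\<phi> \<xi>::'a. \<phi> \<in> schwartz \<Longrightarrow> (1 + norm \<xi>) ^ k * norm (osc s \<phi> \<xi>) \<le> C \<phi>"
      by metis
    show ?case
    proof
      fix \<phi> :: "'a \<Rightarrow> complex" assume \<phi>: "\<phi> \<in> schwartz"
      let ?d = "\<lambda>b x. frechet_derivative \<phi> (at x) b"
      have "(1 + norm \<xi>) ^ Suc k * norm (osc s \<phi> \<xi>) \<le> C \<phi> + (\<Sum>b\<in>Basis. C (?d b) / \<bar>s\<bar>)" for \<xi>
      proof -
        have "(1 + norm \<xi>) ^ Suc k * norm (osc s \<phi> \<xi>) \<le> (1 + (\<Sum>b\<in>Basis. \<bar>\<xi> \<bullet> b\<bar>)) * ((1 + norm \<xi>) ^ k * norm (osc s \<phi> \<xi>))"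
          using norm_le_l1[of \<xi>] by (simp add: mult_right_mono mult.assoc)
        also have "\<dots> = (1 + norm \<xi>) ^ k * norm (osc s \<phi> \<xi>) + (\<Sum>b\<in>Basis. (1 + norm \<xi>) ^ k * norm (of_real (\<xi> \<bullet> b) * osc s \<phi> \<xi>))"
          unfolding distrib_right sum_distrib_right mult_1_left norm_mult norm_of_real
          by (intro arg_cong2[of _ _ _ _ "(+)"] refl sum.cong) (simp_all add: mult.left_commute)
        also have "\<dots> = (1 + norm \<xi>) ^ k * norm (osc s \<phi> \<xi>) + (\<Sum>b\<in>Basis. ((1 + norm \<xi>) ^ k * norm (osc s (?d b) \<xi>)) / \<bar>s\<bar>)"
          using \<phi> assms(2) by (intro arg_cong2[of _ _ _ _ "(+)"] refl sum.cong) (simp_all add: osc_partial norm_mult norm_divide)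
        also have "\<dots> \<le> C \<phi> + (\<Sum>b\<in>Basis. C (?d b) / \<bar>s\<bar>)"
          by (intro add_mono sum_mono divide_right_mono C \<phi> schwartz_partial) auto
        finally show ?thesis .
      qed
      then show "\<exists>C. \<forall>\<xi>. (1 + norm \<xi>) ^ Suc k * norm (osc s \<phi> \<xi>) \<le> C" by blast
    qed
  qed
  then show ?thesis using assms unfolding rapid_def by blast
qed

lemma osc_schwartz:
  assumes "\<phi> \<in> schwartz" "s \<noteq> 0"
  shows "osc s \<phi> \<in> schwartz"
proof (rule schwartz_coinduct)
  show "osc s \<phi> \<in> osc s ` schwartz" using assms by auto
  fix f assume f: "f \<in> osc s ` (schwartz :: ('a \<Rightarrow> complex) set)"
  show "f differentiable (at x)" for x
    using f osc_has_derivative by (auto simp: differentiable_def)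
  show "rapid f" using f osc_rapid assms by auto
  show "(\<lambda>x. frechet_derivative f (at x) b) \<in> osc s ` schwartz" for b
  proof -
    obtain \<psi> where \<psi>: "f = osc s \<psi>" "\<psi> \<in> schwartz" using f by auto
    show ?thesis
      unfolding \<psi>(1) frechet_derivative_eqI[OF osc_has_derivative[OF \<psi>(2)]]
      by (rule image_eqI[OF refl schwartz_mult_affine[OF \<psi>(2)]])
  qed
qed

lemma fourier_eq_osc: "fourier \<phi> = (\<lambda>\<xi>::'a::euclidean_space. of_real ((2 * pi) powr (- real DIM('a) / 2)) * osc (- 1) \<phi> \<xi>)"
  by (simp add: fourier_def osc_def fun_eq_iff)

lemma inv_fourier_eq_osc: "inv_fourier \<phi> = (\<lambda>\<xi>::'a::euclidean_space. of_real ((2 * pi) powr (- real DIM('a) / 2)) * osc 1 \<phi> \<xi>)"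
  by (simp add: inv_fourier_def osc_def fun_eq_iff inner_commute)

lemma schwartz_cmult: "\<phi> \<in> schwartz \<Longrightarrow> (\<lambda>x. c * \<phi> x) \<in> schwartz"
  using schwartz_mult_affine[of \<phi> c 0] by (simp add: mult.commute)

lemma fourier_schwartz: "\<phi> \<in> schwartz \<Longrightarrow> fourier \<phi> \<in> schwartz"
  unfolding fourier_eq_osc by (intro schwartz_cmult osc_schwartz) auto

lemma inv_fourier_schwartz: "\<phi> \<in> schwartz \<Longrightarrow> inv_fourier \<phi> \<in> schwartz"
  unfolding inv_fourier_eq_osc by (intro schwartz_cmult osc_schwartz) auto

text \<open>Fubini and the splitting of the exponential at \<xi> = y + (\<xi> - y). Without
  normalization no constant appears in the product.\<close>

lemma osc_conv:
  assumes u: "integrable lborel u" "u \<in> borel_measurable borel"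
    and w: "integrable lborel w" "w \<in> borel_measurable borel"
  shows "osc s (conv u w) \<zeta> = osc s u \<zeta> * osc s w \<zeta>"
proof -
  let ?f = "\<lambda>(y, \<xi>). cis (s * (\<xi> \<bullet> \<zeta>)) * (u y * w (\<xi> - y))"
  have shift: "(LINT \<xi>|lborel. f (\<xi> - y)) = (LINT \<xi>|lborel. f \<xi>)" if "f \<in> borel_measurable borel" for f :: "'a \<Rightarrow> 'c::{banach,second_countable_topology}" and y
    using lborel_integral_affine[OF that, of 1 "- y"] by simp
  have shiftn: "integrable lborel (\<lambda>\<xi>. w (\<xi> - y))" for y
    using lborel_integrable_affine[OF w(1), of 1 "- y"] by simp
  have int: "integrable (lborel \<Otimes>\<^sub>M lborel) ?f"
  proof (rule lborel_pair.Fubini_integrable)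
    show "?f \<in> borel_measurable (lborel \<Otimes>\<^sub>M lborel)" using u(2) w(2) by measurable
    have "(LINT \<xi>|lborel. norm (?f (y, \<xi>))) = norm (u y) * (LINT \<xi>|lborel. norm (w \<xi>))" for y
      using shift[of "\<lambda>\<xi>. norm (w \<xi>)" y] w(2) by (simp add: norm_mult)
    then show "integrable lborel (\<lambda>y. LINT \<xi>|lborel. norm (?f (y, \<xi>)))"
      using u by simp
    show "AE y in lborel. integrable lborel (\<lambda>\<xi>. ?f (y, \<xi>))"
      by (auto intro!: osc_integrable integrable_mult_right shiftn)
  qed
  have "osc s (conv u w) \<zeta> = (LINT \<xi>|lborel. LINT y|lborel. ?f (y, \<xi>))"
    by (simp add: osc_def conv_def)
  also have "\<dots> = (LINT y|lborel. LINT \<xi>|lborel. ?f (y, \<xi>))"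
    using lborel_pair.Fubini_integral[of "\<lambda>y \<xi>. ?f (y, \<xi>)"] int by simp
  also have "(\<lambda>y. LINT \<xi>|lborel. ?f (y, \<xi>)) = (\<lambda>y. cis (s * (y \<bullet> \<zeta>)) * u y * osc s w \<zeta>)"
  proof
    fix y
    have "(LINT \<xi>|lborel. ?f (y, \<xi>)) = (LINT \<xi>|lborel. cis (s * (y \<bullet> \<zeta>)) * u y * (cis (s * ((\<xi> - y) \<bullet> \<zeta>)) * w (\<xi> - y)))"
    proof (intro Bochner_Integration.integral_cong refl)
      fix \<xi>
      have "cis (s * (\<xi> \<bullet> \<zeta>)) = cis (s * (y \<bullet> \<zeta>)) * cis (s * ((\<xi> - y) \<bullet> \<zeta>))"
        by (simp add: cis_mult inner_diff_left algebra_simps)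
      then show "?f (y, \<xi>) = cis (s * (y \<bullet> \<zeta>)) * u y * (cis (s * ((\<xi> - y) \<bullet> \<zeta>)) * w (\<xi> - y))"
        by simp
    qed
    also have "\<dots> = cis (s * (y \<bullet> \<zeta>)) * u y * osc s w \<zeta>"
      unfolding osc_def using shift[of "\<lambda>\<xi>. cis (s * (\<xi> \<bullet> \<zeta>)) * w \<xi>" y] w(2) by simp
    finally show "(LINT \<xi>|lborel. ?f (y, \<xi>)) = cis (s * (y \<bullet> \<zeta>)) * u y * osc s w \<zeta>" .
  qed
  also have "(LINT y|lborel. cis (s * (y \<bullet> \<zeta>)) * u y * osc s w \<zeta>) = osc s u \<zeta> * osc s w \<zeta>"
    by (simp add: osc_def)
  finally show ?thesis .
qed

section \<open>Cutoff functions and supports\<close>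

lemma integral_pos:
  fixes f :: "'a::euclidean_space \<Rightarrow> real"
  assumes f: "continuous_on UNIV f" "integrable lborel f" "\<And>x. f x \<ge> 0" and x0: "f x0 > 0"
  shows "(LINT x|lborel. f x) > 0"
proof -
  have "isCont f x0" using f(1) by (simp add: continuous_on_eq_continuous_at)
  then obtain d where d: "d > 0" "\<And>x. dist x x0 < d \<Longrightarrow> dist (f x) (f x0) < f x0 / 2"
    unfolding continuous_at_eps_delta using x0 half_gt_zero by blast
  have le: "f x0 / 2 * indicator (ball x0 d) x \<le> f x" for x
    using d(2)[of x] f(3)[of x] by (auto simp: indicator_def dist_commute dist_real_def abs_if split: if_splits)
  have "0 < f x0 / 2 * measure lborel (ball x0 d)"
    using x0 d(1) content_ball_pos by simp
  also have "\<dots> = (LINT x|lborel. f x0 / 2 * indicator (ball x0 d) x)"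
    by simp
  also have "\<dots> \<le> (LINT x|lborel. f x)"
    using f(2) by (intro integral_mono le integrable_mult_right integrable_real_indicator) (auto simp: less_top[symmetric] emeasure_ball d(1) less_imp_le)
  finally show ?thesis .
qed

text \<open>The classical flat function exp (- 1 / t), with a polynomial factor in 1 / t that makes
  the family closed under differentiation.\<close>

definition exp_inv_poly :: "real poly \<Rightarrow> real \<Rightarrow> real" where
  "exp_inv_poly p t = (if t > 0 then poly p (1 / t) * exp (- (1 / t)) else 0)"

lemma poly_times_exp_minus_tendsto_0: "((\<lambda>s. poly p s * exp (- s)) \<longlongrightarrow> 0) at_top" for p :: "real poly"
proof -
  have "((\<lambda>s. \<Sum>i\<le>degree p. coeff p i * (s ^ i / exp s)) \<longlongrightarrow> (\<Sum>i\<le>degree p. coeff p i * 0)) at_top"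
    by (intro tendsto_sum tendsto_mult tendsto_const tendsto_power_div_exp_0)
  then show ?thesis
    by (simp add: poly_altdef sum_distrib_right exp_minus field_simps sum_divide_distrib)
qed

lemma exp_inv_poly_tendsto_0: "(exp_inv_poly p \<longlongrightarrow> 0) (at 0)"
proof -
  have "((\<lambda>t. poly p (inverse t) * exp (- inverse t)) \<longlongrightarrow> 0) (at_right 0)"
    by (rule filterlim_compose[OF poly_times_exp_minus_tendsto_0 filterlim_inverse_at_top_right])
  then have "(exp_inv_poly p \<longlongrightarrow> 0) (at_right 0)"
    by (rule Lim_transform_eventually)
      (auto simp: exp_inv_poly_def eventually_at_filter inverse_eq_divide)
  moreover have "(exp_inv_poly p \<longlongrightarrow> 0) (at_left 0)"
    by (rule Lim_transform_eventually[OF tendsto_const]) (auto simp: exp_inv_poly_def eventually_at_filter)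
  ultimately show ?thesis by (simp add: filterlim_at_split)
qed

text \<open>With s = 1 / t one has ds/dt = - s^2, and the derivative of p(s) exp(- s) in s is (p' -
  p)(s) exp(- s). Hence the polynomial X^2 (p - p').\<close>

lemma exp_inv_poly_deriv:
  "(exp_inv_poly p has_real_derivative exp_inv_poly ([:0, 0, 1:] * (p - pderiv p)) t) (at t)"
proof -
  consider "t > 0" | "t < 0" | "t = 0" by linarith
  then show ?thesis
  proof cases
    case 1
    have "((\<lambda>t. poly p (1 / t) * exp (- (1 / t))) has_real_derivative exp_inv_poly ([:0, 0, 1:] * (p - pderiv p)) t) (at t)"
      using 1 by (auto intro!: derivative_eq_intros DERIV_chain'[of "\<lambda>t. 1 / t" _ t UNIV "poly p"] poly_DERIV
          simp: exp_inv_poly_def algebra_simps power2_eq_square)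
    then show ?thesis
      by (rule has_field_derivative_transform_within_open[of _ _ _ "{0<..}"]) (use 1 in \<open>auto simp: exp_inv_poly_def\<close>)
  next
    case 2
    have "((\<lambda>t. 0) has_real_derivative exp_inv_poly ([:0, 0, 1:] * (p - pderiv p)) t) (at t)"
      using 2 by (simp add: exp_inv_poly_def)
    then show ?thesis
      by (rule has_field_derivative_transform_within_open[of _ _ _ "{..<0}"]) (use 2 in \<open>auto simp: exp_inv_poly_def\<close>)
  next
    case 3
    \<comment> \<open>At 0 the difference quotient belongs to the same family, with X p in place of
      p, so its limit is already known.\<close>
    have "exp_inv_poly p h / h = exp_inv_poly ([:0, 1:] * p) h" for h
      by (simp add: exp_inv_poly_def)
    then have "(\<lambda>h. exp_inv_poly p h / h) \<midarrow>0\<rightarrow> 0"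
      using exp_inv_poly_tendsto_0 by simp
    then show ?thesis
      using 3 by (simp add: DERIV_def exp_inv_poly_def)
  qed
qed

text \<open>The chain rule applied to \<open>1 / 4 - x \<bullet> x\<close> yields linear factors,
  and differentiating these yields constants; affine factors cover both.\<close>

inductive_set bump_derivs :: "('a::euclidean_space \<Rightarrow> complex) set" where
  base: "(\<lambda>x. of_real (exp_inv_poly p (1 / 4 - x \<bullet> x))) \<in> bump_derivs"
| mult: "f \<in> bump_derivs \<Longrightarrow> (\<lambda>x. (c + d * of_real (x \<bullet> a)) * f x) \<in> bump_derivs"
| add: "f \<in> bump_derivs \<Longrightarrow> g \<in> bump_derivs \<Longrightarrow> (\<lambda>x. f x + g x) \<in> bump_derivs"

lemma bump_derivs_closed:
  "f \<in> bump_derivs \<Longrightarrow> (\<forall>x. f differentiable (at x)) \<and> (\<forall>b. (\<lambda>x. frechet_derivative f (at x) b) \<in> bump_derivs)"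
proof (induction rule: bump_derivs.induct)
  case (base p)
  let ?p' = "[:0, 0, 1:] * (p - pderiv p)"
  have d: "((\<lambda>x. complex_of_real (exp_inv_poly p (1 / 4 - x \<bullet> x))) has_derivative
      (\<lambda>h. (0 + (- 2) * of_real (x \<bullet> h)) * of_real (exp_inv_poly ?p' (1 / 4 - x \<bullet> x)))) (at x)" for x :: 'a
  proof -
    have "((\<lambda>x. 1 / 4 - x \<bullet> x) has_derivative (\<lambda>h. - (2 * (x \<bullet> h)))) (at x)"
      by (auto intro!: derivative_eq_intros simp: inner_commute)
    then have "((\<lambda>x. exp_inv_poly p (1 / 4 - x \<bullet> x)) has_derivative
        (\<lambda>h. exp_inv_poly ?p' (1 / 4 - x \<bullet> x) * (- (2 * (x \<bullet> h))))) (at x)"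
      by (rule has_derivative_compose[where g = "exp_inv_poly p"])
        (use exp_inv_poly_deriv[of p "1 / 4 - x \<bullet> x"] in \<open>simp add: has_field_derivative_def\<close>)
    from has_derivative_of_real[OF this, where 'a = complex] show ?thesis
      by (simp add: mult_ac)
  qed
  have "(\<lambda>x. (0 + (- 2) * of_real (x \<bullet> b)) * of_real (exp_inv_poly ?p' (1 / 4 - x \<bullet> x))) \<in> bump_derivs" for b :: 'a
    by (intro bump_derivs.intros)
  then show ?case
    unfolding frechet_derivative_eqI[OF d] using d by (auto simp only: differentiable_def)
next
  case (mult f c d a)
  have D: "((\<lambda>x. (c + d * of_real (x \<bullet> a)) * f x) has_derivative
      (\<lambda>h. (c + d * of_real (x \<bullet> a)) * frechet_derivative f (at x) h + (d * of_real (h \<bullet> a)) * f x)) (at x)" for x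
    using mult by (intro has_derivative_mult affine_has_derivative) (auto simp: frechet_derivative_works)
  have "(\<lambda>x. (c + d * of_real (x \<bullet> a)) * frechet_derivative f (at x) b + (d * of_real (b \<bullet> a) + 0 * of_real (x \<bullet> a)) * f x) \<in> bump_derivs" for b
    using mult by (intro bump_derivs.intros) auto
  then show ?case
    unfolding frechet_derivative_eqI[OF D] using D by (auto simp: differentiable_def)
next
  case (add f g)
  have d: "((\<lambda>x. f x + g x) has_derivative
      (\<lambda>h. frechet_derivative f (at x) h + frechet_derivative g (at x) h)) (at x)" for x
    using add by (intro has_derivative_add) (auto simp: frechet_derivative_works)
  have "(\<lambda>x. frechet_derivative f (at x) b + frechet_derivative g (at x) b) \<in> bump_derivs" for b
    using add by (intro bump_derivs.intros) auto
  then show ?case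
    unfolding frechet_derivative_eqI[OF d] using d by (auto simp: differentiable_def)
qed

lemma smooth_compact_schwartz:
  assumes "smooth f" "\<And>x. norm x > R \<Longrightarrow> f x = 0"
  shows "f \<in> schwartz"
proof (rule schwartz_coinduct)
  let ?X = "{f. smooth f \<and> (\<forall>x. norm x > R \<longrightarrow> f x = 0)}"
  show "f \<in> ?X" using assms by auto
  fix f assume "f \<in> ?X"
  then have f: "smooth f" "\<And>x. norm x > R \<Longrightarrow> f x = 0" by auto
  show "f differentiable (at x)" for x by (rule smooth_differentiable[OF f(1)])
  have "frechet_derivative f (at x) b = 0" if "norm x > R" for x b
  proof -
    have "open {y. R < norm y}"
      by (intro open_Collect_less continuous_intros)
    then have "(f has_derivative (\<lambda>h. 0)) (at x)"
      by (rule has_derivative_transform_within_open[OF has_derivative_const[of 0]]) (simp_all add: that f(2))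
    then show ?thesis by (simp add: frechet_derivative_eqI)
  qed
  then show "(\<lambda>x. frechet_derivative f (at x) b) \<in> ?X" if "b \<in> Basis" for b
    using f smooth_partial[OF _ that] by auto
  show "rapid f"
    unfolding rapid_def
  proof
    fix k
    have "bounded (f ` cball 0 R)"
      by (intro compact_imp_bounded compact_continuous_image smooth_continuous f) auto
    then obtain C where "\<forall>y\<in>f ` cball 0 R. norm y \<le> C"
      unfolding bounded_iff by blast
    then have C: "\<And>x. norm x \<le> R \<Longrightarrow> norm (f x) \<le> C"
      by simp
    have "(1 + norm x) ^ k * norm (f x) \<le> (1 + \<bar>R\<bar>) ^ k * \<bar>C\<bar>" for x
    proof (cases "norm x \<le> R")
      case True
      then show ?thesis
        using C[OF True] by (intro mult_mono power_mono) auto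
    qed (use f in auto)
    then show "\<exists>C. \<forall>x. (1 + norm x) ^ k * norm (f x) \<le> C" by blast
  qed
qed

definition bump :: "'a::euclidean_space \<Rightarrow> real" where
  "bump x = exp_inv_poly 1 (1 / 4 - x \<bullet> x)"

lemma bump_nonneg: "bump x \<ge> 0"
  by (simp add: bump_def exp_inv_poly_def)

lemma bump_0_pos: "bump 0 > 0"
  by (simp add: bump_def exp_inv_poly_def)

lemma bump_minus: "bump (- x) = bump x"
  by (simp add: bump_def)

lemma bump_eq_0: "norm x \<ge> 1 / 2 \<Longrightarrow> bump x = 0"
proof -
  assume "norm x \<ge> 1 / 2"
  then have "(1 / 2)\<^sup>2 \<le> (norm x)\<^sup>2" by (intro power_mono) auto
  then have "1 / 4 \<le> x \<bullet> x" by (simp add: dot_square_norm power_divide)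
  then show ?thesis by (simp add: bump_def exp_inv_poly_def)
qed

lemma bump_schwartz: "(\<lambda>x::'a::euclidean_space. complex_of_real (bump x)) \<in> schwartz"
proof (rule smooth_compact_schwartz[where R = "1 / 2"])
  show "smooth (\<lambda>x::'a. complex_of_real (bump x))"
    by (rule smooth_coinduct[of _ bump_derivs])
      (use bump_derivs_closed in \<open>auto simp: bump_def intro: bump_derivs.base\<close>)
qed (auto simp: bump_eq_0)

lemma bump_integrable: "integrable lborel (bump :: 'a::euclidean_space \<Rightarrow> real)"
  and bump_continuous: "continuous_on UNIV (bump :: 'a \<Rightarrow> real)"
  and bump_measurable: "bump \<in> borel_measurable (borel :: 'a measure)"
proof -
  have eq: "bump = (\<lambda>x::'a. Re (complex_of_real (bump x)))" by simp
  show "integrable lborel (bump :: 'a \<Rightarrow> real)"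
    by (subst eq) (intro integrable_Re schwartz_integrable bump_schwartz)
  show c: "continuous_on UNIV (bump :: 'a \<Rightarrow> real)"
    by (subst eq) (intro continuous_on_Re schwartz_continuous bump_schwartz)
  show "bump \<in> borel_measurable (borel :: 'a measure)"
    by (intro borel_measurable_continuous_onI c)
qed

lemma bump_integral_pos: "(LINT x|lborel. bump (x::'a::euclidean_space)) > 0"
  by (rule integral_pos[OF bump_continuous bump_integrable bump_nonneg bump_0_pos])

text \<open>A mollified indicator. Since \<open>bump\<close> lives in the ball of radius 1/2, the
  radius 3/2 gives the value 1 up to radius 1 and the value 0 from radius 2 on.\<close>

definition cutoff :: "'a::euclidean_space \<Rightarrow> complex" where
  "cutoff x = (1 / of_real (LINT x|lborel. bump (x::'a))) *
     conv (indicator (cball 0 (3 / 2))) (\<lambda>x. of_real (bump x)) x"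

lemma cutoff_schwartz: "(cutoff :: 'a::euclidean_space \<Rightarrow> complex) \<in> schwartz"
proof -
  have "rapid (indicator (cball 0 (3 / 2)) :: 'a \<Rightarrow> complex)"
    unfolding rapid_def
  proof
    fix k
    have "(1 + norm x) ^ k * norm (indicator (cball 0 (3 / 2)) x :: complex) \<le> (5 / 2) ^ k" for x :: 'a
      by (auto simp: indicator_def intro!: power_mono)
    then show "\<exists>C. \<forall>x::'a. (1 + norm x) ^ k * norm (indicator (cball 0 (3 / 2)) x :: complex) \<le> C" by blast
  qed
  then show ?thesis
    unfolding cutoff_def[abs_def] by (intro schwartz_cmult conv_schwartz bump_schwartz borel_measurable_indicator) auto
qed

lemma cutoff_eq_1:
  fixes x :: "'a::euclidean_space"
  assumes "norm x \<le> 1"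
  shows "cutoff x = 1"
proof -
  have "indicator (cball 0 (3 / 2)) y * complex_of_real (bump (x - y)) = of_real (bump (x - y))" for y :: 'a
    using bump_eq_0[of "x - y"] norm_triangle_ineq2[of y x] assms by (auto simp: indicator_def norm_minus_commute)
  then have "conv (indicator (cball 0 (3 / 2))) (\<lambda>x. of_real (bump x)) x = complex_of_real (LINT y|lborel. bump (x - y))"
    by (simp only: conv_def integral_complex_of_real)
  also have "\<dots> = of_real (LINT y|lborel. bump (y::'a))"
    by (subst lborel_integral_reflect) (auto simp: bump_measurable)
  finally show ?thesis
    using bump_integral_pos[where 'a = 'a] by (simp add: cutoff_def)
qed

lemma cutoff_eq_0:
  fixes x :: "'a::euclidean_space"
  assumes "norm x \<ge> 2"
  shows "cutoff x = 0"
proof -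
  have "indicator (cball 0 (3 / 2)) y * complex_of_real (bump (x - y)) = 0" for y :: 'a
    using bump_eq_0[of "x - y"] norm_triangle_ineq2[of x y] assms by (auto simp: indicator_def)
  then show ?thesis by (simp only: cutoff_def conv_def) simp
qed

section \<open>Localization of distributions and their supports\<close>

lemma smooth_affine:
  assumes "smooth f"
  shows "smooth (\<lambda>x. f (t + c *\<^sub>R x))"
proof (rule smooth_coinduct)
  \<comment> \<open>The factor k collects the powers of c produced by the chain rule.\<close>
  let ?X = "{\<lambda>x. k * f (t + c *\<^sub>R x) | k f. smooth f}"
  show "(\<lambda>x. f (t + c *\<^sub>R x)) \<in> ?X"
    using assms by (auto intro!: exI[of _ 1] exI[of _ f])
  fix g assume "g \<in> ?X"
  then obtain k f where g: "g = (\<lambda>x. k * f (t + c *\<^sub>R x))" "smooth f" by auto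
  have d: "(g has_derivative (\<lambda>h. k * (c *\<^sub>R frechet_derivative f (at (t + c *\<^sub>R x)) h))) (at x)" for x
  proof -
    have "((\<lambda>x. t + c *\<^sub>R x) has_derivative (\<lambda>h. c *\<^sub>R h)) (at x)"
      by (auto intro!: derivative_eq_intros)
    moreover have *: "(f has_derivative frechet_derivative f (at (t + c *\<^sub>R x))) (at (t + c *\<^sub>R x))"
      using smooth_differentiable[OF g(2)] frechet_derivative_works by blast
    ultimately have "((\<lambda>x. f (t + c *\<^sub>R x)) has_derivative (\<lambda>h. frechet_derivative f (at (t + c *\<^sub>R x)) (c *\<^sub>R h))) (at x)"
      by (rule has_derivative_compose)
    from has_derivative_mult_right[OF this, of k] show ?thesis
      using linear_cmul[OF has_derivative_linear[OF *]] by (simp add: g)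
  qed
  then show "g differentiable (at x)" for x by (auto simp: differentiable_def)
  show "(\<lambda>x. frechet_derivative g (at x) b) \<in> ?X" if "b \<in> Basis" for b
    unfolding frechet_derivative_eqI[OF d] mem_Collect_eq
    by (intro exI[of _ "k * of_real c"] exI[of _ "\<lambda>x. frechet_derivative f (at x) b"])
      (auto simp: scaleR_conv_of_real mult.assoc smooth_partial[OF g(2) that])
qed

lemma compact_fun_suppI: "(\<And>x. norm x > R \<Longrightarrow> f x = 0) \<Longrightarrow> compact (fun_supp f)"
proof -
  assume *: "\<And>x. norm x > R \<Longrightarrow> f x = 0"
  have "{x. f x \<noteq> 0} \<subseteq> cball 0 R"
    using * by (force simp: not_less)
  then have "bounded {x. f x \<noteq> 0}" using bounded_cball bounded_subset by blast
  then show ?thesis unfolding fun_supp_def by (rule compact_closure[THEN iffD2])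
qed

lemma compact_fun_suppE:
  assumes "compact (fun_supp f)" obtains R where "\<And>x. norm x > R \<Longrightarrow> f x = 0"
proof -
  have "bounded {x. f x \<noteq> 0}"
    using assms unfolding fun_supp_def by (simp add: compact_closure)
  then obtain R where "\<And>x. f x \<noteq> 0 \<Longrightarrow> norm x \<le> R" by (auto simp: bounded_iff)
  then show ?thesis using that by (metis linorder_not_le)
qed


lemma compact_fun_supp_mono:
  assumes "\<And>x. f x = 0 \<Longrightarrow> g x = 0" "compact (fun_supp f)" shows "compact (fun_supp g)"
  using assms by (metis compact_fun_suppE compact_fun_suppI)

text \<open>The complement of the support is a union of open sets on which T vanishes, but a test
  function may spread over many of them. A partition of unity handles this: compactness leaves
  finitely many balls whose doubles are null, and the balls are peeled off one at a time.\<close>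

lemma dist_supp_vanish:
  fixes T :: "('a::euclidean_space \<Rightarrow> complex) \<Rightarrow> complex"
  assumes T: "\<And>\<phi> \<psi>. smooth \<phi> \<Longrightarrow> compact (fun_supp \<phi>) \<Longrightarrow> smooth \<psi> \<Longrightarrow> compact (fun_supp \<psi>) \<Longrightarrow>
      T (\<lambda>x. \<phi> x + \<psi> x) = T \<phi> + T \<psi>"
    and \<phi>: "smooth \<phi>" "compact (fun_supp \<phi>)" and disj: "fun_supp \<phi> \<inter> dist_supp T = {}"
  shows "T \<phi> = 0"
proof -
  define null where "null U \<longleftrightarrow> (\<forall>\<phi>. smooth \<phi> \<and> compact (fun_supp \<phi>) \<and> fun_supp \<phi> \<subseteq> U \<longrightarrow> T \<phi> = 0)" for U
  have "\<exists>r>0. null (cball x (2 * r))" if x: "x \<in> fun_supp \<phi>" for x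
  proof -
    obtain U where U: "x \<in> U" "open U" "null U"
      using x disj unfolding dist_supp_def null_def by blast
    then obtain e where "e > 0" "cball x e \<subseteq> U" using open_contains_cball by blast
    then show ?thesis using U unfolding null_def by (intro exI[of _ "e / 2"]) (auto dest: order_trans)
  qed
  then obtain r where r: "\<And>x. x \<in> fun_supp \<phi> \<Longrightarrow> r x > 0 \<and> null (cball x (2 * r x))" by metis
  have "fun_supp \<phi> \<subseteq> (\<Union>x\<in>fun_supp \<phi>. ball x (r x))" using r by auto
  then obtain D where D: "D \<subseteq> fun_supp \<phi>" "finite D" "fun_supp \<phi> \<subseteq> (\<Union>x\<in>D. ball x (r x))"
    using compactE_image[OF \<phi>(2), of "fun_supp \<phi>" "\<lambda>x. ball x (r x)"] by (metis open_ball)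
  have "\<forall>\<psi>. smooth \<psi> \<longrightarrow> compact (fun_supp \<psi>) \<longrightarrow> (\<forall>x. \<psi> x \<noteq> 0 \<longrightarrow> x \<in> (\<Union>x\<in>E. ball x (r x))) \<longrightarrow> T \<psi> = 0"
    if "finite E" "E \<subseteq> fun_supp \<phi>" for E
    using that
  proof (induction E rule: finite_induct)
    case empty
    have "compact (fun_supp (\<lambda>x::'a. 0::complex))" by (rule compact_fun_suppI) auto
    from T[OF smooth_const this smooth_const this] have "T (\<lambda>x. 0) = 0" by simp
    show ?case
    proof (intro allI impI)
      fix \<psi> :: "'a \<Rightarrow> complex"
      assume "\<forall>x. \<psi> x \<noteq> 0 \<longrightarrow> x \<in> (\<Union>x\<in>{}. ball x (r x))"
      then have "\<psi> = (\<lambda>x. 0)" by (simp add: fun_eq_iff)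
      then show "T \<psi> = 0" using \<open>T (\<lambda>x. 0) = 0\<close> by simp
    qed
  next
    case (insert a E)
    show ?case
    proof (intro allI impI)
      fix \<psi> :: "'a \<Rightarrow> complex"
      assume \<psi>: "smooth \<psi>" "compact (fun_supp \<psi>)" "\<forall>x. \<psi> x \<noteq> 0 \<longrightarrow> x \<in> (\<Union>x\<in>insert a E. ball x (r x))"
      \<comment> \<open>The cutoff rescaled about a is 1 on \<open>ball a (r a)\<close> and 0 off
        \<open>cball a (2 * r a)\<close>; hence the doubled radius in the choice of r. Then \<psi> *
        \<beta> is supported in a null set, and \<psi> * (1 - \<beta>) vanishes off the remaining
        balls.\<close>
      define \<beta> where "\<beta> x = cutoff ((- (1 / r a)) *\<^sub>R a + (1 / r a) *\<^sub>R x)" for x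
      have ra: "r a > 0" "null (cball a (2 * r a))" using r insert by auto
      have \<beta>: "smooth \<beta>"
        unfolding \<beta>_def by (intro smooth_affine schwartz_smooth cutoff_schwartz)
      have n: "norm ((- (1 / r a)) *\<^sub>R a + (1 / r a) *\<^sub>R x) = dist a x / r a" for x
      proof -
        have "(- (1 / r a)) *\<^sub>R a + (1 / r a) *\<^sub>R x = (1 / r a) *\<^sub>R (x - a)"
          by (simp add: scaleR_diff_right)
        then show ?thesis using ra by (simp add: dist_norm norm_minus_commute)
      qed
      have 1: "\<beta> x = 1" if "x \<in> ball a (r a)" for x
        unfolding \<beta>_def using that ra by (intro cutoff_eq_1) (simp add: n del: scaleR_minus_left)
      have 2: "\<beta> x = 0" if "x \<notin> cball a (2 * r a)" for x
        unfolding \<beta>_def using that ra by (intro cutoff_eq_0) (simp add: n pos_le_divide_eq del: scaleR_minus_left)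
      have s: "smooth (\<lambda>x. \<psi> x * \<beta> x)" "smooth (\<lambda>x. \<psi> x * (1 - \<beta> x))"
        by (intro smooth_mult smooth_diff smooth_const \<psi> \<beta>)+
      have c: "compact (fun_supp (\<lambda>x. \<psi> x * \<beta> x))" "compact (fun_supp (\<lambda>x. \<psi> x * (1 - \<beta> x)))"
        by (rule compact_fun_supp_mono[OF _ \<psi>(2)]; simp)+
      have "fun_supp (\<lambda>x. \<psi> x * \<beta> x) \<subseteq> cball a (2 * r a)"
        unfolding fun_supp_def
      proof (intro closure_minimal subsetI closed_cball)
        fix x assume "x \<in> {x. \<psi> x * \<beta> x \<noteq> 0}"
        then show "x \<in> cball a (2 * r a)" using 2[of x] by (cases "x \<in> cball a (2 * r a)") auto
      qed
      then have "T (\<lambda>x. \<psi> x * \<beta> x) = 0"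
        using ra(2) s c unfolding null_def by blast
      moreover have "T (\<lambda>x. \<psi> x * (1 - \<beta> x)) = 0"
      proof -
        have "x \<in> (\<Union>x\<in>E. ball x (r x))" if "\<psi> x * (1 - \<beta> x) \<noteq> 0" for x
          using \<psi>(3) 1[of x] that by auto
        then show ?thesis using insert s c by blast
      qed
      moreover have "\<psi> = (\<lambda>x. \<psi> x * \<beta> x + \<psi> x * (1 - \<beta> x))" by (simp add: algebra_simps)
      ultimately show "T \<psi> = 0" using T[OF s(1) c(1) s(2) c(2)] by simp
    qed
  qed
  note vanish = this
  have "\<forall>x. \<phi> x \<noteq> 0 \<longrightarrow> x \<in> (\<Union>x\<in>D. ball x (r x))"
  proof (intro allI impI)
    fix x assume "\<phi> x \<noteq> 0"
    then have "x \<in> fun_supp \<phi>" unfolding fun_supp_def by (intro subsetD[OF closure_subset]) simp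
    then show "x \<in> (\<Union>x\<in>D. ball x (r x))" by (rule subsetD[OF D(3)])
  qed
  with vanish[OF D(2,1)] \<phi> show ?thesis by simp
qed

section \<open>A reproducing formula for band-limited functions\<close>

text \<open>F need not be bounded, so it is split at the unit ball around w. On the ball, F is
  bounded by compactness, and the substitution y = w - z / n moves the scale from the kernel to F,
  where dominated convergence applies. Off the ball the kernel itself tends to 0 uniformly and F is
  integrable.\<close>

lemma approximate_identity:
  fixes F \<psi> :: "'a::euclidean_space \<Rightarrow> complex"
  assumes F: "integrable lborel F" "continuous_on UNIV F"
    and \<psi>: "rapid \<psi>" "\<psi> \<in> borel_measurable borel"
  shows "(\<lambda>n. LINT y|lborel. F y * (of_real (real (Suc n) ^ DIM('a)) * \<psi> (real (Suc n) *\<^sub>R (w - y))))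
    \<longlonglongrightarrow> F w * (LINT z|lborel. \<psi> z)"
proof -
  define K where "K n y = of_real (real (Suc n) ^ DIM('a)) * \<psi> (real (Suc n) *\<^sub>R (w - y))" for n y
  define H where "H y = indicator (ball w 1) y * F y" for y
  define G where "G y = indicator (- ball w 1) y * F y" for y
  have Fm: "F \<in> borel_measurable borel" using F(2) by (rule borel_measurable_continuous_onI)
  have Hm: "H \<in> borel_measurable borel" and Gm: "G \<in> borel_measurable borel"
    unfolding H_def[abs_def] G_def[abs_def] using Fm by (auto intro!: borel_measurable_times borel_measurable_indicator)
  have Km: "K n \<in> borel_measurable borel" for n
    unfolding K_def[abs_def] using \<psi>(2) by measurable
  obtain C0 where C0: "C0 > 0" "\<And>x. norm (\<psi> x) \<le> C0" using rapid_bounded[OF \<psi>(1)] by metis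
  have Kb: "norm (K n y) \<le> real (Suc n) ^ DIM('a) * C0" for n y
    unfolding K_def norm_mult norm_of_real using C0 by (intro mult_mono) auto
  have intK: "integrable lborel (\<lambda>y. f y * K n y)" if f: "f \<in> borel_measurable borel" "\<And>y. norm (f y) \<le> norm (F y)" for f n
  proof (rule Bochner_Integration.integrable_bound)
    show "integrable lborel (\<lambda>y. (real (Suc n) ^ DIM('a) * C0) * norm (F y))"
      using F(1) by simp
    show "AE y in lborel. norm (f y * K n y) \<le> norm (real (Suc n) ^ DIM('a) * C0 * norm (F y))"
      using C0 mult_mono[OF f(2) Kb] by (auto simp: norm_mult abs_mult mult_ac simp del: of_nat_Suc)
  qed (use f(1) Km in auto)
  have split: "(LINT y|lborel. F y * K n y) = (LINT y|lborel. H y * K n y) + (LINT y|lborel. G y * K n y)" for n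
  proof -
    have "F y * K n y = H y * K n y + G y * K n y" for y
      by (auto simp: H_def G_def indicator_def)
    moreover have "norm (H y) \<le> norm (F y)" "norm (G y) \<le> norm (F y)" for y
      by (auto simp: H_def G_def indicator_def)
    ultimately show ?thesis
      using intK[OF Hm] intK[OF Gm] by (simp add: Bochner_Integration.integral_add)
  qed
  have 1: "(\<lambda>n. LINT y|lborel. H y * K n y) \<longlonglongrightarrow> (LINT z|lborel. F w * \<psi> z)"
  proof -
    have eq: "(LINT y|lborel. H y * K n y) = (LINT z|lborel. H (w + (- 1 / real (Suc n)) *\<^sub>R z) * \<psi> z)" for n
    proof -
      have "(LINT y|lborel. H y * K n y) = \<bar>- 1 / real (Suc n)\<bar> ^ DIM('a) *\<^sub>R
          (LINT z|lborel. H (w + (- 1 / real (Suc n)) *\<^sub>R z) * K n (w + (- 1 / real (Suc n)) *\<^sub>R z))"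
        using Hm Km by (intro lborel_integral_affine) auto
      also have "(\<lambda>z. H (w + (- 1 / real (Suc n)) *\<^sub>R z) * K n (w + (- 1 / real (Suc n)) *\<^sub>R z)) =
          (\<lambda>z. of_real (real (Suc n) ^ DIM('a)) * (H (w + (- 1 / real (Suc n)) *\<^sub>R z) * \<psi> z))"
        by (simp add: K_def fun_eq_iff del: of_nat_Suc)
      finally show ?thesis
        by (simp add: scaleR_conv_of_real power_divide flip: of_real_power del: of_nat_Suc)
    qed
    have "bounded (F ` cball w 1)"
      by (intro compact_imp_bounded compact_continuous_image continuous_on_subset[OF F(2)]) auto
    then obtain B where "\<forall>y\<in>F ` cball w 1. norm y \<le> B" unfolding bounded_iff by blast
    then have B: "norm (H y) \<le> \<bar>B\<bar>" for y
      by (auto simp: H_def indicator_def intro: order_trans[OF _ abs_ge_self])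
    show ?thesis
      unfolding eq
    proof (rule integral_dominated_convergence[where w = "\<lambda>z. \<bar>B\<bar> * norm (\<psi> z)"])
      show "integrable lborel (\<lambda>z. \<bar>B\<bar> * norm (\<psi> z))"
        using rapid_integrable[OF \<psi>] by simp
      show "AE z in lborel. (\<lambda>n. H (w + (- 1 / real (Suc n)) *\<^sub>R z) * \<psi> z) \<longlonglongrightarrow> F w * \<psi> z"
      proof (intro AE_I2 tendsto_mult tendsto_const)
        fix z
        have "(\<lambda>n. - inverse (real (Suc n))) \<longlonglongrightarrow> - 0"
          by (intro tendsto_minus LIMSEQ_inverse_real_of_nat)
        then have "(\<lambda>n. w + (- inverse (real (Suc n))) *\<^sub>R z) \<longlonglongrightarrow> w + (- 0) *\<^sub>R z"
          by (rule tendsto_add[OF tendsto_const tendsto_scaleR[OF _ tendsto_const]])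
        then have *: "(\<lambda>n. w + (- 1 / real (Suc n)) *\<^sub>R z) \<longlonglongrightarrow> w"
          by (simp add: divide_inverse)
        have "isCont F w" using F(2) by (simp add: continuous_on_eq_continuous_at)
        then have "(\<lambda>n. F (w + (- 1 / real (Suc n)) *\<^sub>R z)) \<longlonglongrightarrow> F w"
          using * by (rule isCont_tendsto_compose)
        moreover have "eventually (\<lambda>n. w + (- 1 / real (Suc n)) *\<^sub>R z \<in> ball w 1) sequentially"
          using * by (rule topological_tendstoD) auto
        then have "eventually (\<lambda>n. F (w + (- 1 / real (Suc n)) *\<^sub>R z) = H (w + (- 1 / real (Suc n)) *\<^sub>R z)) sequentially"
          by eventually_elim (simp add: H_def)
        ultimately show "(\<lambda>n. H (w + (- 1 / real (Suc n)) *\<^sub>R z)) \<longlonglongrightarrow> F w"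
          by (rule Lim_transform_eventually)
      qed
      show "AE z in lborel. norm (H (w + (- 1 / real (Suc n)) *\<^sub>R z) * \<psi> z) \<le> \<bar>B\<bar> * norm (\<psi> z)" for n
        by (intro AE_I2) (simp add: norm_mult mult_right_mono B del: of_nat_Suc)
    qed (use Hm \<psi>(2) in auto)
  qed
  have 2: "(\<lambda>n. LINT y|lborel. G y * K n y) \<longlonglongrightarrow> 0"
  proof -
    \<comment> \<open>Decay of order d + 1 beats the factor n^d by one power, because the argument
      of \<psi> has norm at least n off the unit ball.\<close>
    obtain C where C: "C \<ge> 0" "\<And>x. norm (\<psi> x) \<le> C / (1 + norm x) ^ (DIM('a) + 1)"
      using rapid_bound[OF \<psi>(1)] by metis
    have le: "norm (G y * K n y) \<le> (C / real (Suc n)) * norm (F y)" for n y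
    proof (cases "y \<in> ball w 1")
      case False
      let ?n = "real (Suc n)"
      have n: "?n > 0" by simp
      have "?n * 1 \<le> ?n * norm (w - y)"
        using False by (intro mult_left_mono) (auto simp: dist_norm)
      moreover have "norm (?n *\<^sub>R (w - y)) = ?n * norm (w - y)" by (simp del: of_nat_Suc)
      ultimately have "?n \<le> norm (?n *\<^sub>R (w - y))" by (simp only: mult_1_right)
      then have "?n \<le> 1 + norm (?n *\<^sub>R (w - y))" by (rule order_trans) simp
      then have "C / (1 + norm (?n *\<^sub>R (w - y))) ^ (DIM('a) + 1) \<le> C / ?n ^ (DIM('a) + 1)"
        using C(1) n by (intro divide_left_mono power_mono mult_pos_pos zero_less_power) (auto intro: add_pos_nonneg)
      then have "norm (\<psi> (?n *\<^sub>R (w - y))) \<le> C / ?n ^ (DIM('a) + 1)"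
        by (rule order_trans[OF C(2)])
      then have "?n ^ DIM('a) * norm (\<psi> (?n *\<^sub>R (w - y))) \<le> ?n ^ DIM('a) * (C / ?n ^ (DIM('a) + 1))"
        by (rule mult_left_mono) simp
      moreover have "?n ^ DIM('a) * (C / ?n ^ (DIM('a) + 1)) = C / ?n"
        using n by (simp del: of_nat_Suc)
      moreover have "norm (K n y) = ?n ^ DIM('a) * norm (\<psi> (?n *\<^sub>R (w - y)))"
        unfolding K_def norm_mult norm_of_real by simp
      ultimately have "norm (K n y) \<le> C / ?n" by (simp only:)
      then have "norm (K n y) * norm (F y) \<le> C / ?n * norm (F y)"
        by (rule mult_right_mono) simp
      then show ?thesis
        using False by (simp add: G_def norm_mult mult.commute del: of_nat_Suc)
    qed (use C(1) in \<open>simp add: G_def\<close>)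
    have "norm (LINT y|lborel. G y * K n y) \<le> C * (LINT y|lborel. norm (F y)) * inverse (real (Suc n))" for n
    proof -
      have "norm (LINT y|lborel. G y * K n y) \<le> (LINT y|lborel. (C / real (Suc n)) * norm (F y))"
      proof (rule Bochner_Integration.integral_norm_bound_integral)
        show "integrable lborel (\<lambda>y. G y * K n y)"
          by (rule intK[OF Gm]) (simp add: G_def indicator_def)
        show "integrable lborel (\<lambda>y. (C / real (Suc n)) * norm (F y))"
          using F(1) by (intro integrable_mult_right integrable_norm)
      qed (rule le)
      then show ?thesis by (simp add: divide_inverse mult_ac del: of_nat_Suc)
    qed
    note bound = this
    have "(\<lambda>n. C * (LINT y|lborel. norm (F y)) * inverse (real (Suc n))) \<longlonglongrightarrow> 0"
      by (rule tendsto_mult_right_zero[OF LIMSEQ_inverse_real_of_nat])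
    then show ?thesis
      by (rule Lim_null_comparison[OF always_eventually[OF allI[OF bound]]])
  qed
  have "(\<lambda>n. LINT y|lborel. F y * K n y) \<longlonglongrightarrow> (LINT z|lborel. F w * \<psi> z) + 0"
    unfolding split by (intro tendsto_add 1 2)
  then show ?thesis by (simp add: K_def[abs_def] del: of_nat_Suc)
qed

section \<open>Multiplication formula, dilations and the mean of the kernel\<close>

lemma osc_duality:
  fixes u v :: "'a::euclidean_space \<Rightarrow> complex"
  assumes u: "integrable lborel u" and v: "integrable lborel v"
  shows "(LINT \<xi>|lborel. v \<xi> * osc s u \<xi>) = (LINT x|lborel. u x * osc s v x)"
proof -
  let ?f = "\<lambda>x \<xi>. cis (s * (x \<bullet> \<xi>)) * (u x * v \<xi>)"
  have m: "u \<in> borel_measurable borel" "v \<in> borel_measurable borel" using u v by auto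
  have "integrable (lborel \<Otimes>\<^sub>M lborel) (\<lambda>(x, \<xi>). ?f x \<xi>)"
  proof (rule lborel_pair.Fubini_integrable)
    show "(\<lambda>(x, \<xi>). ?f x \<xi>) \<in> borel_measurable (lborel \<Otimes>\<^sub>M lborel)" using m by measurable
    show "integrable lborel (\<lambda>x. LINT \<xi>|lborel. norm (case (x, \<xi>) of (x, \<xi>) \<Rightarrow> ?f x \<xi>))"
      using u by (simp add: norm_mult)
    show "AE x in lborel. integrable lborel (\<lambda>\<xi>. case (x, \<xi>) of (x, \<xi>) \<Rightarrow> ?f x \<xi>)"
    proof (intro AE_I2)
      fix x
      have "integrable lborel (\<lambda>\<xi>. cis (s * (\<xi> \<bullet> x)) * (u x * v \<xi>))"
        by (intro osc_integrable integrable_mult_right v)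
      then show "integrable lborel (\<lambda>\<xi>. case (x, \<xi>) of (x, \<xi>) \<Rightarrow> ?f x \<xi>)" by (simp add: inner_commute)
    qed
  qed
  then have "(LINT \<xi>|lborel. LINT x|lborel. ?f x \<xi>) = (LINT x|lborel. LINT \<xi>|lborel. ?f x \<xi>)"
    by (rule lborel_pair.Fubini_integral)
  moreover have "(LINT x|lborel. ?f x \<xi>) = v \<xi> * osc s u \<xi>" for \<xi>
    unfolding osc_def by (simp add: mult_ac flip: integral_mult_right_zero)
  moreover have "(LINT \<xi>|lborel. ?f x \<xi>) = u x * osc s v x" for x
    unfolding osc_def by (simp add: mult_ac inner_commute flip: integral_mult_right_zero)
  ultimately show ?thesis by simp
qed

lemma osc_dilation:
  fixes \<theta> :: "'a::euclidean_space \<Rightarrow> complex"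
  assumes "\<theta> \<in> borel_measurable borel" "n > 0"
  shows "osc s (\<lambda>\<eta>. \<theta> ((1 / n) *\<^sub>R \<eta>)) z = of_real (n ^ DIM('a)) * osc s \<theta> (n *\<^sub>R z)"
proof -
  have "osc s (\<lambda>\<eta>. \<theta> ((1 / n) *\<^sub>R \<eta>)) z = \<bar>n\<bar> ^ DIM('a) *\<^sub>R
      (LINT \<eta>|lborel. cis (s * ((0 + n *\<^sub>R \<eta>) \<bullet> z)) * \<theta> ((1 / n) *\<^sub>R (0 + n *\<^sub>R \<eta>)))"
    unfolding osc_def using assms by (intro lborel_integral_affine) auto
  also have "\<dots> = of_real (n ^ DIM('a)) * osc s \<theta> (n *\<^sub>R z)"
    using assms(2) by (simp add: osc_def scaleR_conv_of_real)
  finally show ?thesis .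
qed

text \<open>\<open>bump\<close> is real and even, so complex conjugation amounts to the reflection
  of x.\<close>

lemma osc_bump_real: "osc s (\<lambda>x. complex_of_real (bump x)) \<xi> = of_real (Re (osc s (\<lambda>x. complex_of_real (bump x)) \<xi>))"
proof -
  have "cnj (osc s (\<lambda>x. complex_of_real (bump x)) \<xi>) = (LINT x|lborel. cnj (cis (s * (x \<bullet> \<xi>)) * of_real (bump x)))"
    unfolding osc_def by (rule Bochner_Integration.integral_cnj[symmetric])
  also have "\<dots> = (LINT x|lborel. cis (s * ((0 - x) \<bullet> \<xi>)) * of_real (bump (0 - x)))"
    by (intro Bochner_Integration.integral_cong) (auto simp: cis_cnj bump_minus)
  also have "\<dots> = osc s (\<lambda>x. complex_of_real (bump x)) \<xi>"
    unfolding osc_def using bump_measurable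
    by (intro lborel_integral_reflect[where f = "\<lambda>x. cis (s * (x \<bullet> \<xi>)) * of_real (bump x)"]) measurable
  finally show ?thesis
    by (metis Reals_cnj_iff of_real_Re)
qed

text \<open>By duality, \<open>\<integral> osc 1 \<phi> = \<phi> 0 * \<integral> osc 1 cutoff\<close> for every Schwartz function \<open>\<phi>\<close>; for
  \<open>\<phi> = bump * bump\<close> the left-hand side is the integral of a square.\<close>

lemma integral_osc_cutoff_nonzero: "(LINT z|lborel. osc 1 (cutoff :: 'a::euclidean_space \<Rightarrow> complex) z) \<noteq> 0"
proof
  assume 0: "(LINT z|lborel. osc 1 (cutoff :: 'a \<Rightarrow> complex) z) = 0"
  let ?b = "\<lambda>x::'a. complex_of_real (bump x)"
  let ?\<phi> = "conv ?b ?b"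
  note b = bump_schwartz[where 'a = 'a]
  note \<theta> = cutoff_schwartz[where 'a = 'a]
  have \<phi>: "?\<phi> \<in> schwartz"
    by (intro conv_schwartz b schwartz_rapid schwartz_measurable)
  let ?\<Theta> = "osc 1 (cutoff :: 'a \<Rightarrow> complex)"
  have \<Theta>: "?\<Theta> \<in> schwartz" by (intro osc_schwartz \<theta>) auto
  have \<Theta>': "(\<lambda>z. ?\<Theta> (0 - z)) \<in> borel_measurable borel"
    using schwartz_measurable[OF \<Theta>] by measurable
  \<comment> \<open>With the reflected kernel and w = 0 the argument of \<open>?\<Theta>\<close>
    becomes \<open>real (Suc n) *\<^sub>R y\<close>, the form that \<open>osc_dilation\<close>
    produces.\<close>
  have "(\<lambda>n. LINT y|lborel. ?\<phi> y * (of_real (real (Suc n) ^ DIM('a)) * ?\<Theta> (0 - real (Suc n) *\<^sub>R (0 - y)))) \<longlonglongrightarrow> ?\<phi> 0 * (LINT z|lborel. ?\<Theta> (0 - z))"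
    by (rule approximate_identity[OF schwartz_integrable[OF \<phi>] schwartz_continuous[OF \<phi>] rapid_reflect[OF schwartz_rapid[OF \<Theta>]] \<Theta>'])
  moreover have "(LINT z|lborel. ?\<Theta> (0 - z)) = 0"
    using lborel_integral_reflect[OF schwartz_measurable[OF \<Theta>], of 0] 0 by simp
  moreover have "(LINT y|lborel. ?\<phi> y * (of_real (real (Suc n) ^ DIM('a)) * ?\<Theta> (0 - real (Suc n) *\<^sub>R (0 - y)))) =
      (LINT \<xi>|lborel. cutoff ((1 / real (Suc n)) *\<^sub>R \<xi>) * osc 1 ?\<phi> \<xi>)" for n
    using lborel_integrable_affine[OF schwartz_integrable[OF \<theta>], of "1 / real (Suc n)" 0]
    by (subst osc_duality)
      (simp_all add: schwartz_integrable[OF \<phi>] osc_dilation schwartz_measurable[OF \<theta>] del: of_nat_Suc)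
  ultimately have lim0: "(\<lambda>n. LINT \<xi>|lborel. cutoff ((1 / real (Suc n)) *\<^sub>R \<xi>) * osc 1 ?\<phi> \<xi>) \<longlonglongrightarrow> 0" by simp
  \<comment> \<open>The dilated cutoffs tend to \<open>cutoff 0 = 1\<close>, so the same sequence
    also converges to the full integral, which the assumption to be refuted forces to be 0.\<close>
  have "(\<lambda>n. LINT \<xi>|lborel. cutoff ((1 / real (Suc n)) *\<^sub>R \<xi>) * osc 1 ?\<phi> \<xi>) \<longlonglongrightarrow> (LINT \<xi>|lborel. osc 1 ?\<phi> \<xi>)"
  proof -
    obtain C where C: "C > 0" "\<And>x::'a. norm (cutoff x) \<le> C" using rapid_bounded[OF schwartz_rapid[OF \<theta>]] by metis
    have o: "osc 1 ?\<phi> \<in> schwartz" using \<phi> by (rule osc_schwartz) simp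
    show ?thesis
    proof (rule integral_dominated_convergence[where w = "\<lambda>\<xi>. C * norm (osc 1 ?\<phi> \<xi>)"])
      show "integrable lborel (\<lambda>\<xi>. C * norm (osc 1 ?\<phi> \<xi>))"
        using schwartz_integrable[OF o] by simp
      show "AE \<xi> in lborel. norm (cutoff ((1 / real (Suc n)) *\<^sub>R \<xi>) * osc 1 ?\<phi> \<xi>) \<le> C * norm (osc 1 ?\<phi> \<xi>)" for n
        using C by (auto simp: norm_mult intro!: mult_right_mono simp del: of_nat_Suc)
      show "AE \<xi> in lborel. (\<lambda>n. cutoff ((1 / real (Suc n)) *\<^sub>R \<xi>) * osc 1 ?\<phi> \<xi>) \<longlonglongrightarrow> osc 1 ?\<phi> \<xi>"
      proof (intro AE_I2)
        fix \<xi> :: 'a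
        have "(\<lambda>n. inverse (real (Suc n)) *\<^sub>R \<xi>) \<longlonglongrightarrow> 0 *\<^sub>R \<xi>"
          by (intro tendsto_intros LIMSEQ_inverse_real_of_nat)
        then have "(\<lambda>n. inverse (real (Suc n)) *\<^sub>R \<xi>) \<longlonglongrightarrow> 0" by simp
        moreover have "isCont cutoff (0::'a)"
          using schwartz_continuous[OF \<theta>, of UNIV] by (simp add: continuous_on_eq_continuous_at)
        ultimately have "(\<lambda>n. cutoff (inverse (real (Suc n)) *\<^sub>R \<xi>)) \<longlonglongrightarrow> cutoff (0::'a)"
          by (intro isCont_tendsto_compose[where g = cutoff])
        then have "(\<lambda>n. cutoff ((1 / real (Suc n)) *\<^sub>R \<xi>) * osc 1 ?\<phi> \<xi>) \<longlonglongrightarrow> cutoff (0::'a) * osc 1 ?\<phi> \<xi>"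
          by (intro tendsto_mult tendsto_const) (simp add: inverse_eq_divide)
        then show "(\<lambda>n. cutoff ((1 / real (Suc n)) *\<^sub>R \<xi>) * osc 1 ?\<phi> \<xi>) \<longlonglongrightarrow> osc 1 ?\<phi> \<xi>"
          by (simp add: cutoff_eq_1)
      qed
      have "(\<lambda>\<xi>::'a. cutoff ((1 / real (Suc n)) *\<^sub>R \<xi>)) \<in> borel_measurable borel" for n
        by (rule measurable_compose[OF _ schwartz_measurable[OF \<theta>]]) simp
      then show "(\<lambda>\<xi>. cutoff ((1 / real (Suc n)) *\<^sub>R \<xi>) * osc 1 ?\<phi> \<xi>) \<in> borel_measurable lborel" for n
        using schwartz_measurable[OF o] by simp
    qed (use schwartz_measurable[OF o] in simp)
  qed
  then have int0: "(LINT \<xi>|lborel. osc 1 ?\<phi> \<xi>) = 0" by (rule LIMSEQ_unique[OF _ lim0])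
  define q where "q \<xi> = Re (osc 1 ?b \<xi>)" for \<xi>
  have eq: "osc 1 ?\<phi> \<xi> = of_real (q \<xi> * q \<xi>)" for \<xi>
    using osc_bump_real[of 1 \<xi>] schwartz_integrable[OF b] schwartz_measurable[OF b]
    by (simp add: osc_conv q_def)
  from int0 have "(LINT \<xi>|lborel. q \<xi> * q \<xi>) = 0"
    by (simp only: eq integral_complex_of_real of_real_eq_0_iff)
  moreover have "(LINT \<xi>|lborel. q \<xi> * q \<xi>) > 0"
  proof (rule integral_pos)
    have o: "osc 1 ?b \<in> schwartz" by (intro osc_schwartz b) auto
    show "continuous_on UNIV (\<lambda>\<xi>. q \<xi> * q \<xi>)"
      unfolding q_def by (intro continuous_intros schwartz_continuous o)
    have "integrable lborel (osc 1 ?\<phi>)" by (intro schwartz_integrable osc_schwartz \<phi>) auto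
    then show "integrable lborel (\<lambda>\<xi>. q \<xi> * q \<xi>)"
      using integrable_Re[of lborel "osc 1 ?\<phi>"] by (simp add: eq)
    have "osc 1 ?b 0 = of_real (LINT x|lborel. bump (x::'a))"
      by (simp add: osc_def)
    then have "q 0 > 0" using bump_integral_pos[where 'a = 'a] by (simp add: q_def)
    then show "q 0 * q 0 > 0" by simp
  qed simp
  ultimately show False by simp
qed

text \<open>A rapidly decreasing v need not be smooth, but a mollified majorant of it is a Schwartz
  function. With w dominating |v x| throughout the ball of radius 1/2 around x, where the translated
  bump lives, the mollification of w is at least \<open>I * \<bar>v x\<bar>\<close>, and g is
  integrable against it.\<close>

lemma slowI_schwartz:
  fixes g :: "'a::euclidean_space \<Rightarrow> complex"
  assumes g: "g \<in> borel_measurable borel" "\<And>\<phi>. \<phi> \<in> schwartz \<Longrightarrow> integrable lborel (\<lambda>x. g x * \<phi> x)"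
  shows "slow g"
  unfolding slow_def
proof (intro conjI allI impI g(1))
  fix v :: "'a \<Rightarrow> real" assume v: "v \<in> borel_measurable borel" "rapid v"
  obtain w :: "'a \<Rightarrow> real" where w: "w \<in> borel_measurable borel" "rapid w" "\<And>z. w z \<ge> 0"
      "\<And>z x. norm (x - z) \<le> 1 / 2 \<Longrightarrow> norm (v x) \<le> w z"
    by (rule rapid_majorant[OF v(2), of "1 / 2"]) (simp, rule that)
  let ?W = "\<lambda>x. complex_of_real (w x)" and ?b = "\<lambda>x::'a. complex_of_real (bump x)"
  define I where "I = (LINT x|lborel. bump (x::'a))"
  have I: "I > 0" unfolding I_def by (rule bump_integral_pos)
  have W: "rapid ?W" by (rule rapid_le[OF w(2)]) simp
  have "conv ?W ?b \<in> schwartz"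
    using W w(1) by (intro conv_schwartz bump_schwartz) auto
  from g(2)[OF this] have int: "integrable lborel (\<lambda>x. g x * conv ?W ?b x)" .
  have le: "\<bar>v x\<bar> * I \<le> norm (conv ?W ?b x)" for x
  proof -
    have cint: "integrable lborel (\<lambda>y. ?W y * ?b (x - y))"
      using w(1) by (intro slow_conv_integrable rapid_slow[OF W] schwartz_rapid[OF bump_schwartz] schwartz_measurable[OF bump_schwartz]) auto
    have rint: "integrable lborel (\<lambda>y. w y * bump (x - y))"
      using integrable_Re[OF cint] by simp
    have bint: "integrable lborel (\<lambda>y. bump (x - y))"
      using lborel_integrable_affine[OF bump_integrable, of "- 1" x] by simp
    have "\<bar>v x\<bar> * I = (LINT y|lborel. \<bar>v x\<bar> * bump (x - y))"
      unfolding I_def using lborel_integral_reflect[OF bump_measurable, of x] by simp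
    also have "\<dots> \<le> (LINT y|lborel. w y * bump (x - y))"
    proof (rule integral_mono)
      show "\<bar>v x\<bar> * bump (x - y) \<le> w y * bump (x - y)" for y
      proof (cases "norm (x - y) \<le> 1 / 2")
        case True
        then show ?thesis using w(4)[OF True] mult_right_mono[OF _ bump_nonneg[of "x - y"]] by simp
      next
        case False
        then show ?thesis using bump_eq_0[of "x - y"] by simp
      qed
    qed (use bint rint in auto)
    also have "\<dots> \<le> norm (complex_of_real (LINT y|lborel. w y * bump (x - y)))" by simp
    also have "complex_of_real (LINT y|lborel. w y * bump (x - y)) = conv ?W ?b x"
      unfolding conv_def by (simp flip: integral_complex_of_real)
    finally show ?thesis .
  qed
  have "integrable lborel (\<lambda>x. (1 / I) *\<^sub>R (g x * conv ?W ?b x))"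
    using int by (rule integrable_scaleR_right)
  then show "integrable lborel (\<lambda>x. v x *\<^sub>R g x)"
  proof (rule Bochner_Integration.integrable_bound)
    show "AE x in lborel. norm (v x *\<^sub>R g x) \<le> norm ((1 / I) *\<^sub>R (g x * conv ?W ?b x))"
    proof (rule AE_I2)
      fix x
      have "\<bar>v x\<bar> \<le> norm (conv ?W ?b x) / I" using le[of x] I by (simp add: field_simps)
      then have "\<bar>v x\<bar> * norm (g x) \<le> norm (conv ?W ?b x) / I * norm (g x)"
        by (rule mult_right_mono) simp
      then show "norm (v x *\<^sub>R g x) \<le> norm ((1 / I) *\<^sub>R (g x * conv ?W ?b x))"
        using I by (simp add: norm_mult mult_ac)
    qed
  qed (use v(1) g(1) in auto)
qed

section \<open>The smooth function that represents a distribution\<close>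

lemma represented_slow:
  assumes "represented_by T g" shows "slow g"
  using assms by (intro slowI_schwartz) (auto simp: represented_by_def smooth_measurable)

lemma represented_smooth: "represented_by T g \<Longrightarrow> smooth g"
  by (simp add: represented_by_def)

text \<open>The difference of the two functions annihilates all Schwartz functions, in particular
  bumps shrinking to x0, and these recover its value at x0.\<close>

lemma represented_unique:
  fixes g1 g2 :: "'a::euclidean_space \<Rightarrow> complex"
  assumes "represented_by T g1" "represented_by T g2"
  shows "g1 = g2"
proof (rule ext, rule ccontr)
  fix x0 assume ne: "g1 x0 \<noteq> g2 x0"
  let ?b = "\<lambda>x::'a. complex_of_real (bump x)"
  have b: "smooth ?b" by (intro schwartz_smooth bump_schwartz)
  define d where "d x = g1 x - g2 x" for x
  have d: "smooth d" unfolding d_def by (intro smooth_diff represented_smooth[OF assms(1)] represented_smooth[OF assms(2)])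
  have d0: "(LINT x|lborel. d x * \<phi> x) = 0" if "\<phi> \<in> schwartz" for \<phi>
  proof -
    have "(LINT x|lborel. d x * \<phi> x) = (LINT x|lborel. g1 x * \<phi> x - g2 x * \<phi> x)"
      by (simp add: d_def left_diff_distrib)
    also have "\<dots> = T \<phi> - T \<phi>"
      using assms that by (subst Bochner_Integration.integral_diff) (auto simp: represented_by_def)
    finally show ?thesis by simp
  qed
  \<comment> \<open>A window at x0: the difference d need be neither integrable nor decreasing,
    whereas F = d * B is Schwartz. The factor 1 only fits the shape of
    \<open>smooth_affine\<close>.\<close>
  define B where "B y = ?b (- x0 + 1 *\<^sub>R y)" for y
  have B: "smooth B" unfolding B_def by (intro smooth_affine b)
  have B0: "B y = 0" if "norm y > norm x0 + 1 / 2" for y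
    using bump_eq_0[of "y - x0"] norm_triangle_ineq2[of y x0] that by (simp add: B_def)
  define F where "F y = d y * B y" for y
  have F: "F \<in> schwartz"
    unfolding F_def by (rule smooth_compact_schwartz[OF smooth_mult[OF d B], of "norm x0 + 1 / 2"]) (simp add: B0)
  have "(\<lambda>n. LINT y|lborel. F y * (of_real (real (Suc n) ^ DIM('a)) * ?b (real (Suc n) *\<^sub>R (x0 - y))))
      \<longlonglongrightarrow> F x0 * (LINT z|lborel. ?b z)"
    by (intro approximate_identity schwartz_integrable schwartz_continuous schwartz_rapid schwartz_measurable F bump_schwartz)
  moreover have "(LINT y|lborel. F y * (of_real (real (Suc n) ^ DIM('a)) * ?b (real (Suc n) *\<^sub>R (x0 - y)))) = 0" for n
  proof -
    have "smooth (\<lambda>y. B y * (of_real (real (Suc n) ^ DIM('a)) * ?b (real (Suc n) *\<^sub>R x0 + (- real (Suc n)) *\<^sub>R y)))"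
      by (intro smooth_mult smooth_const B smooth_affine b)
    then have "(\<lambda>y. B y * (of_real (real (Suc n) ^ DIM('a)) * ?b (real (Suc n) *\<^sub>R x0 + (- real (Suc n)) *\<^sub>R y))) \<in> schwartz"
      by (rule smooth_compact_schwartz[of _ "norm x0 + 1 / 2"]) (simp add: B0)
    from d0[OF this] show ?thesis
      by (simp add: F_def mult.assoc scaleR_diff_right del: of_nat_Suc)
  qed
  ultimately have "(\<lambda>n. 0) \<longlonglongrightarrow> F x0 * (LINT z|lborel. ?b z)" by simp
  then have "F x0 * (LINT z|lborel. ?b z) = 0"
    using LIMSEQ_unique tendsto_const by metis
  moreover have "F x0 \<noteq> 0"
    using ne bump_0_pos[where 'a = 'a] by (simp add: F_def B_def d_def)
  moreover have "(LINT z|lborel. ?b z) \<noteq> 0"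
    using bump_integral_pos[where 'a = 'a] by simp
  ultimately show False by simp
qed

lemma dist_fun_eq: "represented_by T g \<Longrightarrow> dist_fun T = g"
  unfolding dist_fun_def using represented_unique by blast

lemma conv_measurable:
  assumes "u \<in> borel_measurable borel" "w \<in> borel_measurable borel"
  shows "conv u w \<in> borel_measurable borel"
  unfolding conv_def[abs_def] using assms by measurable

text \<open>Unfolding leaves f tested against the transform of M times \<open>inv_fourier\<close> of
  \<phi>. By the multiplication formula, and without inverting a transform, this is c times the
  convolution of \<phi> with \<open>fourier M\<close>. The latter is the reflection of
  \<open>inv_fourier M\<close>, so Fubini moves the convolution from \<phi> to g.\<close>

lemma represented_multiplier:
  fixes g M :: "'a::euclidean_space \<Rightarrow> complex"
  assumes f: "represented_by f g" and M: "M \<in> schwartz"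
  shows "represented_by (dist_inv_fourier (dist_mult M (dist_fourier f)))
    (\<lambda>x. of_real ((2 * pi) powr (- real DIM('a) / 2)) * conv g (inv_fourier M) x)"
proof -
  define c :: complex where "c = of_real ((2 * pi) powr (- real DIM('a) / 2))"
  note g = represented_slow[OF f]
  let ?K = "inv_fourier M" and ?K' = "fourier M"
  have K: "?K \<in> schwartz" "?K' \<in> schwartz" by (intro inv_fourier_schwartz fourier_schwartz M)+
  have K': "?K' (x - y) = ?K (y - x)" for x y
    by (simp add: fourier_eq_osc inv_fourier_eq_osc osc_def inner_diff_right)
  show ?thesis
    unfolding represented_by_def c_def[symmetric]
  proof (intro conjI ballI)
    show "smooth (\<lambda>x. c * conv g ?K x)"
      by (intro smooth_cmult conv_smooth g K)
    fix \<phi> :: "'a \<Rightarrow> complex" assume \<phi>: "\<phi> \<in> schwartz"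
    have conv\<phi>: "conv \<phi> ?K' \<in> schwartz"
      by (intro conv_schwartz schwartz_rapid schwartz_measurable \<phi> K)
    have "fourier (\<lambda>\<xi>. M \<xi> * inv_fourier \<phi> \<xi>) x = c * conv \<phi> ?K' x" for x
    proof -
      have m: "integrable lborel (\<lambda>\<xi>. M \<xi> * cis (- 1 * (\<xi> \<bullet> x)))"
        by (intro schwartz_integrable schwartz_mult_cis M)
      have "fourier (\<lambda>\<xi>. M \<xi> * inv_fourier \<phi> \<xi>) x = c * (LINT \<xi>|lborel. c * ((M \<xi> * cis (- 1 * (\<xi> \<bullet> x))) * osc 1 \<phi> \<xi>))"
        unfolding fourier_eq_osc inv_fourier_eq_osc osc_def[of "- 1"] c_def
        by (rule arg_cong[where f = "\<lambda>z. _ * z"], rule Bochner_Integration.integral_cong[OF refl]) (simp only: mult_ac mult_minus1)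
      also have "(LINT \<xi>|lborel. c * ((M \<xi> * cis (- 1 * (\<xi> \<bullet> x))) * osc 1 \<phi> \<xi>)) =
          c * (LINT y|lborel. \<phi> y * osc 1 (\<lambda>\<xi>. M \<xi> * cis (- 1 * (\<xi> \<bullet> x))) y)"
        by (simp only: integral_mult_right_zero osc_duality[OF schwartz_integrable[OF \<phi>] m])
      also have "\<dots> = (LINT y|lborel. \<phi> y * ?K' (x - y))"
      proof -
        have "osc 1 (\<lambda>\<xi>. M \<xi> * cis (- 1 * (\<xi> \<bullet> x))) y = osc (- 1) M (x - y)" for y
          unfolding osc_def
          by (intro Bochner_Integration.integral_cong) (auto simp: inner_diff_right cis_mult mult_ac simp flip: mult.assoc)
        then show ?thesis
          by (simp only: fourier_eq_osc c_def[symmetric] mult.left_commute[of _ c] integral_mult_right_zero)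
      qed
      finally show ?thesis by (simp add: conv_def)
    qed
    then have eq: "dist_inv_fourier (dist_mult M (dist_fourier f)) \<phi> = f (\<lambda>x. c * conv \<phi> ?K' x)"
      unfolding dist_inv_fourier_def dist_mult_def dist_fourier_def by presburger
    let ?F = "\<lambda>x y. g x * (\<phi> y * ?K' (x - y))"
    note meas = slow_measurable[OF g] schwartz_measurable[OF \<phi>] schwartz_measurable[OF K(2)]
    \<comment> \<open>The norms are embedded in the complex numbers to fit \<open>conv\<close>.
      Their convolution is of rapid decay, which against the slow g gives the absolute integrability
      for Fubini.\<close>
    let ?n\<phi> = "\<lambda>y. complex_of_real (norm (\<phi> y))" and ?nK = "\<lambda>y. complex_of_real (norm (?K' y))"
    have r: "rapid ?n\<phi>" "rapid ?nK"
      using rapid_le[OF schwartz_rapid[OF \<phi>], of ?n\<phi>] rapid_le[OF schwartz_rapid[OF K(2)], of ?nK] by auto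
    have m: "?n\<phi> \<in> borel_measurable borel" "?nK \<in> borel_measurable borel"
      using meas by auto
    have prod: "integrable (lborel \<Otimes>\<^sub>M lborel) (\<lambda>(x, y). ?F x y)"
    proof (rule lborel_pair.Fubini_integrable)
      show "(\<lambda>(x, y). ?F x y) \<in> borel_measurable (lborel \<Otimes>\<^sub>M lborel)" using meas by measurable
      have "(LINT y|lborel. norm (?F x y)) = norm (g x) * norm (conv ?n\<phi> ?nK x)" for x
      proof -
        have "conv ?n\<phi> ?nK x = of_real (LINT y|lborel. norm (\<phi> y) * norm (?K' (x - y)))"
          unfolding conv_def by (simp flip: integral_complex_of_real)
        moreover have "(LINT y|lborel. norm (\<phi> y) * norm (?K' (x - y))) \<ge> 0"
          by (rule Bochner_Integration.integral_nonneg) simp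
        ultimately show ?thesis by (simp add: norm_mult)
      qed
      then show "integrable lborel (\<lambda>x. LINT y|lborel. norm (case (x, y) of (x, y) \<Rightarrow> ?F x y))"
        using slow_integrable_norm[OF g conv_rapid[OF r(1) m(1) r(2) m(2)] conv_measurable[OF m]] by simp
      show "AE x in lborel. integrable lborel (\<lambda>y. case (x, y) of (x, y) \<Rightarrow> ?F x y)"
        using \<phi> K by (intro AE_I2) (auto intro!: integrable_mult_right slow_conv_integrable rapid_slow schwartz_rapid schwartz_measurable)
    qed
    have inner_x: "(LINT x|lborel. ?F x y) = \<phi> y * conv g ?K y" for y
    proof -
      have "(LINT x|lborel. ?F x y) = (LINT x|lborel. \<phi> y * (g x * ?K (y - x)))"
        by (simp add: K' mult_ac)
      then show ?thesis by (simp add: conv_def)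
    qed
    have inner_y: "(LINT y|lborel. ?F x y) = g x * conv \<phi> ?K' x" for x
      by (simp add: conv_def)
    have "integrable lborel (\<lambda>y. LINT x|lborel. ?F x y)"
      using lborel_pair.integrable_snd[OF prod] by simp
    then have "integrable lborel (\<lambda>y. c * (\<phi> y * conv g ?K y))"
      unfolding inner_x by (rule integrable_mult_right)
    then show "integrable lborel (\<lambda>x. c * conv g ?K x * \<phi> x)"
      by (simp add: mult_ac)
    have "f (\<lambda>x. c * conv \<phi> ?K' x) = (LINT x|lborel. g x * (c * conv \<phi> ?K' x))"
      using f schwartz_cmult[OF conv\<phi>, of c] by (auto simp: represented_by_def)
    also have "\<dots> = c * (LINT x|lborel. LINT y|lborel. ?F x y)"
      unfolding inner_y by (simp add: mult.left_commute)
    also have "(LINT x|lborel. LINT y|lborel. ?F x y) = (LINT y|lborel. LINT x|lborel. ?F x y)"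
      by (rule lborel_pair.Fubini_integral[OF prod, symmetric])
    also have "c * (LINT y|lborel. LINT x|lborel. ?F x y) = (LINT x|lborel. c * conv g ?K x * \<phi> x)"
      unfolding inner_x by (simp add: mult_ac flip: integral_mult_right_zero)
    finally show "dist_inv_fourier (dist_mult M (dist_fourier f)) \<phi> = (LINT x|lborel. c * conv g ?K x * \<phi> x)"
      by (simp add: eq)
  qed
qed

section \<open>Consequences of a spectrum contained in a ball\<close>

lemma fourier_add:
  assumes "integrable lborel \<phi>" "integrable lborel \<psi>"
  shows "fourier (\<lambda>x. \<phi> x + \<psi> x) = (\<lambda>\<xi>. fourier \<phi> \<xi> + fourier \<psi> \<xi>)"
proof
  fix \<xi>
  have "osc (- 1) (\<lambda>x. \<phi> x + \<psi> x) \<xi> = osc (- 1) \<phi> \<xi> + osc (- 1) \<psi> \<xi>"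
    using osc_integrable[OF assms(1), of "- 1" \<xi>] osc_integrable[OF assms(2), of "- 1" \<xi>]
    by (simp add: osc_def distrib_left Bochner_Integration.integral_add)
  then show "fourier (\<lambda>x. \<phi> x + \<psi> x) \<xi> = fourier \<phi> \<xi> + fourier \<psi> \<xi>"
    by (simp add: fourier_eq_osc distrib_left)
qed

lemma dist_fourier_vanish:
  fixes g D :: "'a::euclidean_space \<Rightarrow> complex"
  assumes f: "represented_by f g" and D: "smooth D" "compact (fun_supp D)"
    and disj: "fun_supp D \<inter> dist_supp (dist_fourier f) = {}"
  shows "(LINT y|lborel. g y * fourier D y) = 0"
proof -
  have S: "\<phi> \<in> schwartz" if "smooth \<phi>" "compact (fun_supp \<phi>)" for \<phi> :: "'a \<Rightarrow> complex"
    using compact_fun_suppE[OF that(2)] smooth_compact_schwartz[OF that(1)] by metis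
  have T: "dist_fourier f \<phi> = (LINT y|lborel. g y * fourier \<phi> y)" "integrable lborel (\<lambda>y. g y * fourier \<phi> y)"
    if "\<phi> \<in> schwartz" for \<phi>
    using f fourier_schwartz[OF that] by (auto simp: represented_by_def dist_fourier_def)
  have "dist_fourier f D = 0"
  proof (rule dist_supp_vanish[OF _ D disj])
    fix \<phi> \<psi> :: "'a \<Rightarrow> complex"
    assume "smooth \<phi>" "compact (fun_supp \<phi>)" "smooth \<psi>" "compact (fun_supp \<psi>)"
    then have s: "\<phi> \<in> schwartz" "\<psi> \<in> schwartz" by (auto intro: S)
    then have "(\<lambda>x. \<phi> x + \<psi> x) \<in> schwartz"
    proof -
      obtain R1 R2 where R: "\<And>x. norm x > R1 \<Longrightarrow> \<phi> x = 0" "\<And>x. norm x > R2 \<Longrightarrow> \<psi> x = 0"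
        using compact_fun_suppE \<open>compact (fun_supp \<phi>)\<close> \<open>compact (fun_supp \<psi>)\<close> by metis
      show ?thesis
        by (rule smooth_compact_schwartz[of _ "max R1 R2"]) (use R \<open>smooth \<phi>\<close> \<open>smooth \<psi>\<close> in \<open>auto intro: smooth_add\<close>)
    qed
    then show "dist_fourier f (\<lambda>x. \<phi> x + \<psi> x) = dist_fourier f \<phi> + dist_fourier f \<psi>"
      using s T by (simp add: fourier_add schwartz_integrable distrib_left Bochner_Integration.integral_add)
  qed
  then show ?thesis using T(1)[OF S[OF D]] by simp
qed

text \<open>The kernels at scales \<open>n \<ge> m + l\<close> all reproduce the same value, since the difference of two of
  them is orthogonal to \<open>g * osc 1 M (x - _)\<close> by the support condition; as \<open>n\<close> tends to infinity
  they concentrate at \<open>w\<close>.\<close>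

lemma reproducing_formula:
  fixes g M :: "'a::euclidean_space \<Rightarrow> complex"
  assumes f: "represented_by f g" and supp: "dist_supp (dist_fourier f) \<subseteq> ball 0 l"
    and M: "M \<in> schwartz" "\<And>\<xi>. norm \<xi> \<ge> m \<Longrightarrow> M \<xi> = 0" and ml: "m > 0" "l > 0"
  shows "g w * osc 1 M (x - w) * (LINT z|lborel. osc 1 (cutoff :: 'a \<Rightarrow> complex) z) =
    (LINT y|lborel. g y * osc 1 M (x - y) * (of_real ((m + l) ^ DIM('a)) * osc 1 cutoff ((m + l) *\<^sub>R (w - y))))"
proof -
  let ?\<Theta> = "osc 1 (cutoff :: 'a \<Rightarrow> complex)"
  define k where "k y = osc 1 M (x - y)" for y
  define R where "R = m + l"
  have R: "R > 0" using ml by (simp add: R_def)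
  note g = represented_slow[OF f] and gs = represented_smooth[OF f]
  have oM: "osc 1 M \<in> schwartz" by (intro osc_schwartz M) auto
  have k: "rapid k" "k \<in> borel_measurable borel" "continuous_on UNIV k"
    unfolding k_def using schwartz_rapid[OF oM] schwartz_measurable[OF oM]
    by (auto intro!: rapid_reflect continuous_on_compose2[OF schwartz_continuous[OF oM, of UNIV]] continuous_intros)
  note \<theta> = cutoff_schwartz[where 'a = 'a]
  have \<Theta>: "?\<Theta> \<in> schwartz" by (intro osc_schwartz \<theta>) auto
  define A where "A n = (LINT y|lborel. g y * k y * (of_real (n ^ DIM('a)) * ?\<Theta> (n *\<^sub>R (w - y))))" for n
  have intA: "integrable lborel (\<lambda>y. g y * k y * (of_real (n ^ DIM('a)) * ?\<Theta> (n *\<^sub>R (w - y))))" for n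
  proof -
    obtain C where C: "\<And>z. norm (?\<Theta> z) \<le> C" using rapid_bounded[OF schwartz_rapid[OF \<Theta>]] by metis
    have "rapid (\<lambda>y. k y * (of_real (n ^ DIM('a)) * ?\<Theta> (n *\<^sub>R (w - y))))"
      by (rule rapid_mult_bounded[OF k(1), of _ "\<bar>n\<bar> ^ DIM('a) * C"])
        (auto simp: norm_mult norm_power intro!: mult_left_mono C)
    then have "integrable lborel (\<lambda>y. g y * (k y * (of_real (n ^ DIM('a)) * ?\<Theta> (n *\<^sub>R (w - y)))))"
      using k(2) schwartz_measurable[OF \<Theta>] by (intro slow_integrable[OF g]) auto
    then show ?thesis by (simp add: mult.assoc)
  qed
  have const: "A n = A R" if n: "n \<ge> R" for n
  proof -
    have n0: "n > 0" using n R by simp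
    \<comment> \<open>v vanishes for norm \<eta> < R = m + l, where both dilated cutoffs equal 1,
      and N vanishes outside the ball of radius m. So their convolution D vanishes for norm \<zeta>
      < l.\<close>
    define v where "v \<eta> = cis (1 * (\<eta> \<bullet> w)) * (cutoff ((1 / n) *\<^sub>R \<eta>) - cutoff ((1 / R) *\<^sub>R \<eta>))" for \<eta>
    define N where "N \<xi> = M \<xi> * cis (1 * (\<xi> \<bullet> x))" for \<xi>
    have N: "N \<in> schwartz" unfolding N_def by (intro schwartz_mult_cis M)
    have v_out: "v \<eta> = 0" if "norm \<eta> > 2 * n" for \<eta>
    proof -
      have "norm ((1 / n) *\<^sub>R \<eta>) \<ge> 2" "norm ((1 / R) *\<^sub>R \<eta>) \<ge> 2"
        using that n n0 R by (auto simp: field_simps)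
      then show ?thesis by (simp only: v_def cutoff_eq_0) simp
    qed
    have v_in: "v \<eta> = 0" if "norm \<eta> < R" for \<eta>
    proof -
      have "norm ((1 / n) *\<^sub>R \<eta>) \<le> 1" "norm ((1 / R) *\<^sub>R \<eta>) \<le> 1"
        using that n n0 R by (auto simp: field_simps)
      then show ?thesis by (simp only: v_def cutoff_eq_1) simp
    qed
    have sv: "smooth v"
    proof -
      have "smooth (\<lambda>\<eta>::'a. cutoff (0 + c *\<^sub>R \<eta>))" for c
        by (intro smooth_affine schwartz_smooth \<theta>)
      then have "smooth (\<lambda>\<eta>::'a. cutoff (c *\<^sub>R \<eta>))" for c by simp
      then show ?thesis unfolding v_def[abs_def] by (intro smooth_mult smooth_cis smooth_diff)
    qed
    have v: "v \<in> schwartz" by (rule smooth_compact_schwartz[OF sv v_out])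
    define D where "D = conv v N"
    have D: "D \<in> schwartz"
      unfolding D_def by (intro conv_schwartz schwartz_rapid schwartz_measurable v N)
    have D0: "D \<zeta> = 0" if "norm \<zeta> < l \<or> norm \<zeta> > 2 * n + m" for \<zeta>
    proof -
      have "v \<eta> * N (\<zeta> - \<eta>) = 0" for \<eta>
      proof (cases "norm \<eta> < R \<or> norm \<eta> > 2 * n")
        case True
        then show ?thesis using v_in v_out by auto
      next
        case False
        then have "norm (\<zeta> - \<eta>) \<ge> m"
          using that norm_triangle_ineq2[of \<eta> \<zeta>] norm_triangle_ineq2[of \<zeta> \<eta>]
          by (auto simp: R_def norm_minus_commute)
        then show ?thesis using M(2) by (simp add: N_def)
      qed
      then show ?thesis by (simp only: D_def conv_def) simp
    qed
    \<comment> \<open>The complement of the open ball is closed, so it contains the closure in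
      \<open>fun_supp D\<close>, which is therefore disjoint from the spectrum of g.\<close>
    have "fun_supp D \<subseteq> - ball 0 l"
      unfolding fun_supp_def using D0 by (intro closure_minimal) (auto simp: not_less[symmetric])
    moreover have "compact (fun_supp D)"
      using D0 by (intro compact_fun_suppI[of "2 * n + m"]) auto
    ultimately have "(LINT y|lborel. g y * fourier D y) = 0"
      using supp by (intro dist_fourier_vanish[OF f schwartz_smooth[OF D]]) auto
    \<comment> \<open>The transform of a convolution is a product: N contributes k, while the
      dilated cutoffs, modulated by w, contribute the kernels at the scales n and R.\<close>
    moreover have "fourier D y = of_real ((2 * pi) powr (- real DIM('a) / 2)) *
        (k y * (of_real (n ^ DIM('a)) * ?\<Theta> (n *\<^sub>R (w - y))) - k y * (of_real (R ^ DIM('a)) * ?\<Theta> (R *\<^sub>R (w - y))))" for y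
    proof -
      have "osc (- 1) N y = k y"
        unfolding osc_def N_def k_def
        by (intro Bochner_Integration.integral_cong) (auto simp: inner_diff_right cis_mult mult_ac simp flip: mult.assoc)
      moreover have "osc (- 1) v y = of_real (n ^ DIM('a)) * ?\<Theta> (n *\<^sub>R (w - y)) - of_real (R ^ DIM('a)) * ?\<Theta> (R *\<^sub>R (w - y))"
      proof -
        have int: "integrable lborel (\<lambda>\<eta>::'a. cis (1 * (\<eta> \<bullet> (w - y))) * cutoff ((1 / n) *\<^sub>R \<eta>))" if "n > 0" for n
          using lborel_integrable_affine[OF schwartz_integrable[OF \<theta>], of "1 / n" 0] that by (intro osc_integrable) simp
        have "osc (- 1) v y = (LINT \<eta>|lborel. cis (1 * (\<eta> \<bullet> (w - y))) * cutoff ((1 / n) *\<^sub>R \<eta>) - cis (1 * (\<eta> \<bullet> (w - y))) * cutoff ((1 / R) *\<^sub>R \<eta>))"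
          unfolding osc_def
        proof (intro Bochner_Integration.integral_cong refl)
          fix \<eta> :: 'a
          have "cis (1 * (\<eta> \<bullet> (w - y))) = cis (- 1 * (\<eta> \<bullet> y)) * cis (1 * (\<eta> \<bullet> w))"
            by (simp add: cis_mult inner_diff_right)
          then show "cis (- 1 * (\<eta> \<bullet> y)) * v \<eta> = cis (1 * (\<eta> \<bullet> (w - y))) * cutoff ((1 / n) *\<^sub>R \<eta>) - cis (1 * (\<eta> \<bullet> (w - y))) * cutoff ((1 / R) *\<^sub>R \<eta>)"
            by (simp add: v_def right_diff_distrib mult.assoc)
        qed
        also have "\<dots> = osc 1 (\<lambda>\<eta>. cutoff ((1 / n) *\<^sub>R \<eta>)) (w - y) - osc 1 (\<lambda>\<eta>. cutoff ((1 / R) *\<^sub>R \<eta>)) (w - y)"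
          unfolding osc_def by (rule Bochner_Integration.integral_diff[OF int[OF n0] int[OF R]])
        finally show ?thesis
          by (simp add: osc_dilation n0 R schwartz_measurable[OF \<theta>])
      qed
      moreover have "osc (- 1) D y = osc (- 1) v y * osc (- 1) N y"
        unfolding D_def by (intro osc_conv schwartz_integrable schwartz_measurable v N)
      ultimately show ?thesis
        by (simp only: fourier_eq_osc right_diff_distrib left_diff_distrib mult_ac)
    qed
    ultimately have "of_real ((2 * pi) powr (- real DIM('a) / 2)) * (A n - A R) = (0::complex)"
      unfolding A_def
      by (subst Bochner_Integration.integral_diff[OF intA intA, symmetric])
        (simp add: algebra_simps flip: integral_mult_right_zero)
    then show ?thesis by simp
  qed
  have "(\<lambda>n. A (real (Suc n))) \<longlonglongrightarrow> g w * k w * (LINT z|lborel. ?\<Theta> z)"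
    unfolding A_def
    by (rule approximate_identity)
      (use slow_integrable[OF g k(1,2)] k(3) smooth_continuous[OF gs] schwartz_rapid[OF \<Theta>] schwartz_measurable[OF \<Theta>]
       in \<open>auto intro!: continuous_intros\<close>)
  \<comment> \<open>R is real, so the constancy of A is used at the integers beyond some n0 \<ge> R
    only.\<close>
  moreover have "(\<lambda>n. A (real (Suc n))) \<longlonglongrightarrow> A R"
  proof (rule tendsto_eventually)
    obtain n0 where "real n0 \<ge> R" using real_arch_simple by blast
    then show "eventually (\<lambda>n. A (real (Suc n)) = A R) sequentially"
      by (intro eventually_sequentiallyI[of n0] const) simp
  qed
  ultimately show ?thesis
    unfolding A_def k_def R_def by (rule LIMSEQ_unique)
qed

section \<open>Estimates in Morrey spaces\<close>

text \<open>Jensen's inequality for z^p and the measure with density k, which has total mass L. It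
  is obtained by integrating a tangent inequality for z^p, namely Young's.\<close>

lemma integral_mult_power_le:
  fixes a k :: "'a \<Rightarrow> real"
  assumes p: "p \<ge> 1" and a: "a \<in> borel_measurable M" "\<And>y. a y \<ge> 0"
    and k: "integrable M k" "\<And>y. k y \<ge> 0" and ak: "integrable M (\<lambda>y. a y * k y)"
  shows "ennreal ((LINT y|M. a y * k y) powr p) \<le>
    ennreal ((LINT y|M. k y) powr (p - 1)) * (\<integral>\<^sup>+ y. ennreal (a y powr p * k y) \<partial>M)"
proof -
  define I L where "I = (LINT y|M. a y * k y)" and "L = (LINT y|M. k y)"
  define J where "J = (\<integral>\<^sup>+ y. ennreal (a y powr p * k y) \<partial>M)"
  have I0: "I \<ge> 0" and L0: "L \<ge> 0"
    unfolding I_def L_def using a k by (auto intro!: Bochner_Integration.integral_nonneg)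
  have km: "k \<in> borel_measurable M" using k by auto
  show ?thesis
  proof (cases "I = 0")
    case False
    then have Ipos: "I > 0" using I0 by simp
    \<comment> \<open>Positivity allows the division in t below and makes the right-hand side
      infinite if J is. It also excludes the value \<open>0 powr 0 = 0\<close> of the factor for p =
      1.\<close>
    have Lpos: "L > 0"
    proof (rule ccontr)
      assume "\<not> L > 0"
      then have "L = 0" using L0 by simp
      then have "AE y in M. k y = 0"
        using integral_nonneg_eq_0_iff_AE[OF k(1)] k(2) by (simp add: L_def)
      then have "AE y in M. a y * k y = 0" by eventually_elim simp
      then have "I = 0" unfolding I_def by (rule integral_eq_zero_AE)
      with False show False ..
    qed
    show ?thesis
    proof (cases "J = \<infinity>")
      case True
      then show ?thesis using Lpos by (simp add: J_def[symmetric] L_def[symmetric] ennreal_mult_top)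
    next
      case False
      have int: "integrable M (\<lambda>y. a y powr p * k y)"
        using False a km k(2) by (intro integrableI_nonneg) (auto simp: J_def less_top)
      \<comment> \<open>The mean of a with respect to k, at which Young's inequality is sharp: then
        t^p L = t^(p-1) I, and this term is absorbed on the left.\<close>
      define t where "t = I / L"
      have t: "t > 0" using Ipos Lpos by (simp add: t_def)
      have young: "z * t powr (p - 1) \<le> z powr p / p + (1 - 1 / p) * t powr p" if "z \<ge> 0" for z
      proof (cases "z = 0")
        case True
        then show ?thesis using p by simp
      next
        case False
        then have "(z powr p) powr (1 / p) * (t powr p) powr (1 - 1 / p) \<le> (1 / p) * z powr p + (1 - 1 / p) * t powr p"
          using p t that by (intro Youngs_inequality_0) auto
        moreover have "p * (1 - 1 / p) = p - 1" using p by (simp add: field_simps)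
        ultimately show ?thesis using p that by (simp add: powr_powr)
      qed
      have "t powr (p - 1) * I = (LINT y|M. t powr (p - 1) * (a y * k y))"
        by (simp add: I_def)
      also have "\<dots> \<le> (LINT y|M. (1 / p) * (a y powr p * k y) + ((1 - 1 / p) * t powr p) * k y)"
      proof (rule integral_mono)
        show "t powr (p - 1) * (a y * k y) \<le> (1 / p) * (a y powr p * k y) + ((1 - 1 / p) * t powr p) * k y" for y
          using mult_right_mono[OF young[OF a(2)[of y]] k(2)[of y]] by (simp add: algebra_simps)
      qed (use ak int k in auto)
      also have "\<dots> = (1 / p) * (LINT y|M. a y powr p * k y) + ((1 - 1 / p) * t powr p) * L"
        using int k by (simp add: L_def Bochner_Integration.integral_add)
      also have "t powr p = t powr (p - 1) * t"
        using t powr_add[of t "p - 1" 1] by simp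
      also have "((1 - 1 / p) * (t powr (p - 1) * t)) * L = (1 - 1 / p) * (t powr (p - 1) * I)"
        using Lpos by (simp add: t_def)
      finally have "t powr (p - 1) * I \<le> (LINT y|M. a y powr p * k y)"
        using p by (simp add: field_simps)
      then have "L powr (p - 1) * (t powr (p - 1) * I) \<le> L powr (p - 1) * (LINT y|M. a y powr p * k y)"
        by (rule mult_left_mono) simp
      moreover have "L powr (p - 1) * (t powr (p - 1) * I) = I powr p"
      proof -
        have "L powr (p - 1) * t powr (p - 1) = I powr (p - 1)"
          using Lpos Ipos by (simp add: t_def powr_divide)
        then show ?thesis using Ipos powr_add[of I "p - 1" 1] by (simp flip: mult.assoc)
      qed
      ultimately have "ennreal (I powr p) \<le> ennreal (L powr (p - 1) * (LINT y|M. a y powr p * k y))"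
        by (simp add: ennreal_leI)
      also have "\<dots> = ennreal (L powr (p - 1)) * J"
        unfolding J_def using int k(2)
        by (subst nn_integral_eq_integral) (auto simp: ennreal_mult Bochner_Integration.integral_nonneg)
      finally show ?thesis by (simp add: I_def L_def J_def)
    qed
  qed (simp add: I_def)
qed

lemma integral_power_le_of_sup_bound:
  fixes b :: "'a \<Rightarrow> real"
  assumes p: "0 < p" "p < 1" and b: "integrable M b" "\<And>y. b y \<ge> 0"
    and B: "B > 0" "\<And>y. b y \<le> B * (LINT y|M. b y)"
  shows "ennreal ((LINT y|M. b y) powr p) \<le> ennreal (B powr (1 - p)) * (\<integral>\<^sup>+ y. ennreal (b y powr p) \<partial>M)"
proof -
  define I where "I = (LINT y|M. b y)"
  define J where "J = (\<integral>\<^sup>+ y. ennreal (b y powr p) \<partial>M)"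
  have I0: "I \<ge> 0"
    unfolding I_def using b by (auto intro!: Bochner_Integration.integral_nonneg)
  have bm: "b \<in> borel_measurable M" using b by auto
  show ?thesis
  proof (cases "I = 0")
    case False
    then have I: "I > 0" using I0 by simp
    have le: "b y \<le> (B * I) powr (1 - p) * b y powr p" for y
    proof (cases "b y = 0")
      case False
      then have pos: "b y > 0" using b(2)[of y] by simp
      then have "b y = b y powr (1 - p) * b y powr p" by (simp flip: powr_add)
      also have "\<dots> \<le> (B * I) powr (1 - p) * b y powr p"
        using pos p B(2)[of y] by (intro mult_right_mono powr_mono2) (auto simp: I_def)
      finally show ?thesis .
    qed simp
    have "ennreal I = (\<integral>\<^sup>+ y. ennreal (b y) \<partial>M)"
      unfolding I_def using b by (subst nn_integral_eq_integral) auto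
    also have "\<dots> \<le> (\<integral>\<^sup>+ y. ennreal ((B * I) powr (1 - p)) * ennreal (b y powr p) \<partial>M)"
      by (intro nn_integral_mono) (simp add: ennreal_leI le flip: ennreal_mult)
    also have "\<dots> = ennreal ((B * I) powr (1 - p)) * J"
      unfolding J_def using bm by (intro nn_integral_cmult) auto
    \<comment> \<open>Multiplying by a negative power of I is the cancellation; it relies on 0 < I <
      \<infinity>, the finiteness being the integrability of b.\<close>
    finally have "ennreal (I powr (p - 1)) * ennreal I \<le> ennreal (I powr (p - 1)) * (ennreal ((B * I) powr (1 - p)) * J)"
      by (intro mult_left_mono) auto
    moreover have "ennreal (I powr (p - 1)) * ennreal I = ennreal (I powr p)"
      using I powr_add[of I "p - 1" 1] by (simp flip: ennreal_mult)
    moreover have "I powr (p - 1) * (B * I) powr (1 - p) = B powr (1 - p)"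
    proof -
      have "I powr (p - 1) * I powr (1 - p) = 1" using I by (simp flip: powr_add)
      then show ?thesis using I B(1) by (simp add: powr_mult mult.left_commute)
    qed
    then have "ennreal (I powr (p - 1)) * (ennreal ((B * I) powr (1 - p)) * J) = ennreal (B powr (1 - p)) * J"
      by (simp flip: mult.assoc ennreal_mult)
    ultimately show ?thesis by (simp add: I_def J_def)
  qed (simp add: I_def)
qed

lemma rapid_powr:
  assumes u: "rapid u" and q: "q > 0"
  shows "rapid (\<lambda>x. norm (u x) powr q)"
  unfolding rapid_def
proof
  fix k
  \<comment> \<open>Raising to the power q turns decay of order j into decay of order j q, so j is
    taken at least k / q.\<close>
  define j where "j = nat \<lceil>real k / q\<rceil>"
  have "real k / q \<le> real j" unfolding j_def by linarith
  then have j: "real k \<le> real j * q" using q by (simp add: pos_divide_le_eq)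
  obtain C where C: "C \<ge> 0" "\<And>x. (1 + norm x) ^ j * norm (u x) \<le> C"
    using rapidE[OF u] by metis
  have "(1 + norm x) ^ k * norm (norm (u x) powr q) \<le> C powr q" for x
  proof -
    have pos: "1 + norm x > 0" by (simp add: add_pos_nonneg)
    have "(1 + norm x) ^ k = (1 + norm x) powr real k" using pos by (simp add: powr_realpow)
    also have "\<dots> \<le> (1 + norm x) powr (real j * q)" using j by (intro powr_mono) auto
    also have "\<dots> = ((1 + norm x) ^ j) powr q" using pos by (simp add: powr_powr flip: powr_realpow)
    finally have "(1 + norm x) ^ k * norm (u x) powr q \<le> ((1 + norm x) ^ j) powr q * norm (u x) powr q"
      by (rule mult_right_mono) simp
    also have "\<dots> = ((1 + norm x) ^ j * norm (u x)) powr q" using pos by (simp add: powr_mult)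
    also have "\<dots> \<le> C powr q" using C q pos by (intro powr_mono2) auto
    finally show ?thesis by simp
  qed
  then show "\<exists>C. \<forall>x. (1 + norm x) ^ k * norm (norm (u x) powr q) \<le> C" by blast
qed

section \<open>From the Morrey norm to integrals over balls and back\<close>

lemma enn_powr_ennreal: "b \<ge> 0 \<Longrightarrow> enn_powr (ennreal b) s = ennreal (b powr s)"
  by (simp add: enn_powr_def)

lemma enn_powr_le:
  assumes "a \<le> ennreal b" "b \<ge> 0" "s \<ge> 0"
  shows "enn_powr a s \<le> ennreal (b powr s)"
proof -
  have "a < top" using assms(1) by (metis ennreal_less_top order_le_less_trans)
  moreover from this have "enn2real a \<le> b" using assms by (metis enn2real_leI)
  ultimately show ?thesis
    using assms by (auto simp: enn_powr_def intro!: ennreal_leI powr_mono2)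
qed

lemma measure_ball_eq: "measure lborel (ball (z::'a::euclidean_space) r) = measure lborel (ball (0::'a) r)" if "r > 0"
  using that by (simp add: content_ball)

text \<open>Together with \<open>morrey_norm_leI\<close> this exchanges the weighted norm for a
  bound on plain integrals over balls of one radius, uniform in the centre, the form to which
  Tonelli applies.\<close>

lemma morrey_norm_local:
  fixes g :: "'a::euclidean_space \<Rightarrow> complex"
  assumes p: "p > 0" and N: "morrey_norm u p g \<le> ennreal N" "N \<ge> 0" and r: "r > 0"
  shows "(\<integral>\<^sup>+ x\<in>ball y r. ennreal (norm (g x) powr p) \<partial>lborel) \<le>
    ennreal ((N * measure lborel (ball (0::'a) r) powr (1 / p - 1 / u)) powr p)"
proof -
  define V where "V = measure lborel (ball (0::'a) r)"
  have V: "V > 0" unfolding V_def using r by (rule content_ball_pos)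
  define J where "J = (\<integral>\<^sup>+ x\<in>ball y r. ennreal (norm (g x) powr p) \<partial>lborel)"
  have "ennreal (measure lborel (ball y r) powr (1 / u - 1 / p)) *
     enn_powr (\<integral>\<^sup>+ x\<in>ball y r. ennreal (norm (g x) powr p) \<partial>lebesgue) (1 / p) \<le> morrey_norm u p g"
    unfolding morrey_norm_def using r
    by (intro SUP_upper2[of y] SUP_upper2[of r]) auto
  then have le: "ennreal (V powr (1 / u - 1 / p)) * enn_powr J (1 / p) \<le> ennreal N"
    using N(1) by (simp add: V_def J_def measure_ball_eq[OF r, of y] nn_integral_completion)
  have Jfin: "J \<noteq> top"
  proof
    assume "J = top"
    then have "ennreal (V powr (1 / u - 1 / p)) * enn_powr J (1 / p) = top"
      using V by (simp add: enn_powr_def ennreal_mult_top)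
    with le show False by (simp add: top_unique)
  qed
  define j where "j = enn2real J"
  have j: "J = ennreal j" "j \<ge> 0" using Jfin by (simp_all add: j_def ennreal_enn2real_if)
  have "V powr (1 / u - 1 / p) * j powr (1 / p) \<le> N"
    using le j N(2) V by (simp add: enn_powr_ennreal flip: ennreal_mult)
  then have "V powr (1 / p - 1 / u) * (V powr (1 / u - 1 / p) * j powr (1 / p)) \<le> V powr (1 / p - 1 / u) * N"
    by (rule mult_left_mono) simp
  moreover have "V powr (1 / p - 1 / u) * V powr (1 / u - 1 / p) = 1"
    using V by (simp flip: powr_add)
  ultimately have "j powr (1 / p) \<le> N * V powr (1 / p - 1 / u)"
    by (simp only: mult.assoc[symmetric] mult_1_left mult.commute[of N])
  then have "(j powr (1 / p)) powr p \<le> (N * V powr (1 / p - 1 / u)) powr p"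
    using p by (intro powr_mono2) auto
  then have "j \<le> (N * V powr (1 / p - 1 / u)) powr p"
    using p j by (simp add: powr_powr)
  then have "J \<le> ennreal ((N * V powr (1 / p - 1 / u)) powr p)"
    unfolding j(1) by (rule ennreal_leI)
  then show ?thesis unfolding J_def V_def .
qed

lemma morrey_norm_leI:
  fixes G :: "'a::euclidean_space \<Rightarrow> complex"
  assumes p: "p > 0" and B: "B \<ge> 0"
    and le: "\<And>y r. r > 0 \<Longrightarrow> (\<integral>\<^sup>+ x\<in>ball y r. ennreal (norm (G x) powr p) \<partial>lborel) \<le>
      ennreal ((B * measure lborel (ball (0::'a) r) powr (1 / p - 1 / u)) powr p)"
  shows "morrey_norm u p G \<le> ennreal B"
  unfolding morrey_norm_def
proof (intro SUP_least)
  fix y :: 'a and r :: real assume "r \<in> {0<..}"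
  then have r: "r > 0" by simp
  define V where "V = measure lborel (ball (0::'a) r)"
  have V: "V > 0" unfolding V_def using r by (rule content_ball_pos)
  let ?J = "\<integral>\<^sup>+ x\<in>ball y r. ennreal (norm (G x) powr p) \<partial>lebesgue"
  have "enn_powr ?J (1 / p) \<le> ennreal (((B * V powr (1 / p - 1 / u)) powr p) powr (1 / p))"
    using le[OF r, of y] p by (intro enn_powr_le) (auto simp: V_def nn_integral_completion)
  also have "((B * V powr (1 / p - 1 / u)) powr p) powr (1 / p) = B * V powr (1 / p - 1 / u)"
    using p B by (simp add: powr_powr)
  finally have "ennreal (V powr (1 / u - 1 / p)) * enn_powr ?J (1 / p) \<le>
      ennreal (V powr (1 / u - 1 / p)) * ennreal (B * V powr (1 / p - 1 / u))"
    by (intro mult_left_mono) auto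
  also have "\<dots> = ennreal B"
  proof -
    have "V powr (1 / u - 1 / p) * V powr (1 / p - 1 / u) = 1"
      using V by (simp flip: powr_add)
    then have "V powr (1 / u - 1 / p) * (B * V powr (1 / p - 1 / u)) = B"
      by (simp add: mult.left_commute)
    then show ?thesis using B by (simp flip: ennreal_mult)
  qed
  finally show "ennreal (measure lborel (ball y r) powr (1 / u - 1 / p)) * enn_powr ?J (1 / p) \<le> ennreal B"
    by (simp add: V_def measure_ball_eq[OF r, of y])
qed

text \<open>A translation is a composition of two reflections, and invariance under reflections is
  at hand.\<close>

lemma nn_integral_ball_translate:
  fixes h :: "'a::euclidean_space \<Rightarrow> ennreal"
  assumes "h \<in> borel_measurable borel"
  shows "(\<integral>\<^sup>+ x. indicator (ball z r) x * h (x - t) \<partial>lborel) = (\<integral>\<^sup>+ x\<in>ball (z - t) r. h x \<partial>lborel)"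
proof -
  have "(\<integral>\<^sup>+ x. indicator (ball z r) x * h (x - t) \<partial>lborel) = (\<integral>\<^sup>+ x. indicator (ball z r) (0 - x) * h (0 - x - t) \<partial>lborel)"
    by (rule lborel_nn_integral_reflect[symmetric]) (use assms in \<open>auto intro!: borel_measurable_times_ennreal borel_measurable_indicator\<close>)
  also have "\<dots> = (\<integral>\<^sup>+ x. (\<lambda>y. indicator (ball (z - t) r) y * h y) (- t - x) \<partial>lborel)"
  proof (intro nn_integral_cong)
    fix x
    have "dist z (0 - x) = dist (z - t) (- t - x)" by (simp add: dist_norm)
    moreover have "0 - x - t = - t - x" by simp
    ultimately show "indicator (ball z r) (0 - x) * h (0 - x - t) = (\<lambda>y. indicator (ball (z - t) r) y * h y) (- t - x)"
      by (simp only: indicator_def mem_ball)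
  qed
  also have "\<dots> = (\<integral>\<^sup>+ y. indicator (ball (z - t) r) y * h y \<partial>lborel)"
    by (rule lborel_nn_integral_reflect) (use assms in \<open>auto intro!: borel_measurable_times_ennreal borel_measurable_indicator\<close>)
  finally show ?thesis by (simp add: mult.commute)
qed

text \<open>After t = x - y and an exchange of the integrals, the inner one is that of |g|^p over
  the ball shifted by - t. The bound E is uniform in the centre, so only the integral of |K|^q
  remains.\<close>

lemma nn_integral_conv_power_le:
  fixes g K :: "'a::euclidean_space \<Rightarrow> complex" and H :: "'a \<Rightarrow> ennreal"
  assumes g: "g \<in> borel_measurable borel" and K: "K \<in> borel_measurable borel"
    and H: "\<And>x. H x \<le> A * (\<integral>\<^sup>+ y. ennreal (norm (g y) powr p * norm (K (x - y)) powr q) \<partial>lborel)"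
    and loc: "\<And>t. (\<integral>\<^sup>+ x\<in>ball t r. ennreal (norm (g x) powr p) \<partial>lborel) \<le> E"
  shows "(\<integral>\<^sup>+ x\<in>ball z r. H x \<partial>lborel) \<le> A * (\<integral>\<^sup>+ t. ennreal (norm (K t) powr q) \<partial>lborel) * E"
proof -
  note g [measurable] and K [measurable]
  let ?k = "\<lambda>t. ennreal (norm (K t) powr q)" and ?h = "\<lambda>x. ennreal (norm (g x) powr p)"
  have meas: "?k \<in> borel_measurable borel" "?h \<in> borel_measurable borel"
    using g K by auto
  have ind: "(indicator (ball z r) :: 'a \<Rightarrow> ennreal) \<in> borel_measurable borel"
    by (intro borel_measurable_indicator) simp
  note ind [measurable]
  have sub: "(\<integral>\<^sup>+ y. ennreal (norm (g y) powr p * norm (K (x - y)) powr q) \<partial>lborel) = (\<integral>\<^sup>+ t. ?h (x - t) * ?k t \<partial>lborel)" for x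
  proof -
    have "(\<integral>\<^sup>+ y. ennreal (norm (g y) powr p * norm (K (x - y)) powr q) \<partial>lborel) = (\<integral>\<^sup>+ y. (\<lambda>t. ?h (x - t) * ?k t) (x - y) \<partial>lborel)"
      by (simp add: ennreal_mult)
    also have "\<dots> = (\<integral>\<^sup>+ t. ?h (x - t) * ?k t \<partial>lborel)"
      using g K by (intro lborel_nn_integral_reflect) measurable
    finally show ?thesis .
  qed
  have "(\<integral>\<^sup>+ x\<in>ball z r. H x \<partial>lborel) \<le> (\<integral>\<^sup>+ x. A * (\<integral>\<^sup>+ t. indicator (ball z r) x * (?h (x - t) * ?k t) \<partial>lborel) \<partial>lborel)"
  proof (intro nn_integral_mono)
    fix x
    show "H x * indicator (ball z r) x \<le> A * (\<integral>\<^sup>+ t. indicator (ball z r) x * (?h (x - t) * ?k t) \<partial>lborel)"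
      using H[of x] by (auto simp: indicator_def sub)
  qed
  also have "\<dots> = A * (\<integral>\<^sup>+ x. \<integral>\<^sup>+ t. indicator (ball z r) x * (?h (x - t) * ?k t) \<partial>lborel \<partial>lborel)"
    using ind g K by (intro nn_integral_cmult) measurable
  also have "(\<integral>\<^sup>+ x. \<integral>\<^sup>+ t. indicator (ball z r) x * (?h (x - t) * ?k t) \<partial>lborel \<partial>lborel) =
      (\<integral>\<^sup>+ t. \<integral>\<^sup>+ x. indicator (ball z r) x * (?h (x - t) * ?k t) \<partial>lborel \<partial>lborel)"
    using ind g K by (intro lborel_pair.Fubini'[symmetric]) measurable
  also have "\<dots> = (\<integral>\<^sup>+ t. ?k t * (\<integral>\<^sup>+ x\<in>ball (z - t) r. ?h x \<partial>lborel) \<partial>lborel)"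
  proof (intro nn_integral_cong)
    fix t
    have "(\<integral>\<^sup>+ x. indicator (ball z r) x * (?h (x - t) * ?k t) \<partial>lborel) = (\<integral>\<^sup>+ x. ?k t * (indicator (ball z r) x * ?h (x - t)) \<partial>lborel)"
      by (simp add: mult_ac)
    also have "\<dots> = ?k t * (\<integral>\<^sup>+ x. indicator (ball z r) x * ?h (x - t) \<partial>lborel)"
      using ind g by (intro nn_integral_cmult) measurable
    finally show "(\<integral>\<^sup>+ x. indicator (ball z r) x * (?h (x - t) * ?k t) \<partial>lborel) = ?k t * (\<integral>\<^sup>+ x\<in>ball (z - t) r. ?h x \<partial>lborel)"
      by (simp only: nn_integral_ball_translate[OF meas(2)])
  qed
  also have "\<dots> \<le> (\<integral>\<^sup>+ t. ?k t * E \<partial>lborel)"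
    by (intro nn_integral_mono mult_left_mono loc) auto
  also have "\<dots> = (\<integral>\<^sup>+ t. ?k t \<partial>lborel) * E"
    using meas by (intro nn_integral_multc) auto
  finally show ?thesis by (simp add: mult.assoc mult_left_mono)
qed

lemma norm_conv_le: "norm (conv g K x) \<le> (LINT y|lborel. norm (g y) * norm (K (x - y)))"
  unfolding conv_def by (rule order_trans[OF integral_norm_bound]) (simp add: norm_mult)

text \<open>The constant is a bound of the kernel divided by the modulus of its mean. Both depend on
  the cutoff alone, so C is fixed before g, M, m and l; this gives the uniformity claimed in the
  theorem.\<close>

lemma band_limited_sup_bound:
  obtains C where "C > 0" and "\<And>(f::'a::euclidean_space functional) g M l m x w. \<lbrakk>represented_by f g; dist_supp (dist_fourier f) \<subseteq> ball 0 l;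
      M \<in> schwartz; fun_supp M \<subseteq> ball 0 m; m > 0; l > 0\<rbrakk> \<Longrightarrow>
    norm (g w) * norm (inv_fourier M (x - w)) \<le>
      C * (m + l) ^ DIM('a) * (LINT y|lborel. norm (g y) * norm (inv_fourier M (x - y)))"
proof -
  let ?\<Theta> = "osc 1 (cutoff :: 'a \<Rightarrow> complex)"
  have \<Theta>: "?\<Theta> \<in> schwartz" by (intro osc_schwartz cutoff_schwartz) auto
  obtain C0 where C0: "C0 > 0" "\<And>z. norm (?\<Theta> z) \<le> C0" using rapid_bounded[OF schwartz_rapid[OF \<Theta>]] by metis
  define a where "a = (LINT z|lborel. ?\<Theta> z)"
  have a: "a \<noteq> 0" unfolding a_def by (rule integral_osc_cutoff_nonzero)
  show thesis
  proof (rule that[of "C0 / norm a"])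
    show "C0 / norm a > 0" using C0 a by simp
    fix f :: "'a functional" and g M :: "'a \<Rightarrow> complex" and l m x w
    assume f: "represented_by f g" and supp: "dist_supp (dist_fourier f) \<subseteq> ball 0 l"
      and M: "M \<in> schwartz" "fun_supp M \<subseteq> ball 0 m" and ml: "m > 0" "l > 0"
    define c where "c = (2 * pi) powr (- real DIM('a) / 2)"
    have c: "c > 0" by (simp add: c_def)
    have K: "inv_fourier M y = of_real c * osc 1 M y" for y
      by (simp add: inv_fourier_eq_osc c_def)
    have M0: "M \<xi> = 0" if "norm \<xi> \<ge> m" for \<xi>
    proof (rule ccontr)
      assume "M \<xi> \<noteq> 0"
      then have "\<xi> \<in> fun_supp M" unfolding fun_supp_def by (intro subsetD[OF closure_subset]) simp
      with M(2) that show False by auto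
    qed
    have eq: "g w * osc 1 M (x - w) * (LINT z|lborel. ?\<Theta> z) =
        (LINT y|lborel. g y * osc 1 M (x - y) * (of_real ((m + l) ^ DIM('a)) * ?\<Theta> ((m + l) *\<^sub>R (w - y))))"
      by (rule reproducing_formula[OF f supp M(1) M0 ml])
    have int: "integrable lborel (\<lambda>y. g y * osc 1 M (x - y))"
      using osc_schwartz[OF M(1), of 1]
      by (intro slow_conv_integrable represented_slow[OF f] schwartz_rapid schwartz_measurable) auto
    have "norm (g w) * norm (osc 1 M (x - w)) * norm a = norm (g w * osc 1 M (x - w) * (LINT z|lborel. ?\<Theta> z))"
      by (simp add: norm_mult a_def)
    also have "\<dots> \<le> (LINT y|lborel. norm (g y * osc 1 M (x - y) * (of_real ((m + l) ^ DIM('a)) * ?\<Theta> ((m + l) *\<^sub>R (w - y)))))"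
      unfolding eq by (rule integral_norm_bound)
    also have "\<dots> \<le> (LINT y|lborel. ((m + l) ^ DIM('a) * C0) * norm (g y * osc 1 M (x - y)))"
    proof (rule Bochner_Integration.integral_mono')
      show "integrable lborel (\<lambda>y. ((m + l) ^ DIM('a) * C0) * norm (g y * osc 1 M (x - y)))"
        using int by (intro integrable_mult_right integrable_norm)
      show "norm (g y * osc 1 M (x - y) * (of_real ((m + l) ^ DIM('a)) * ?\<Theta> ((m + l) *\<^sub>R (w - y)))) \<le>
          ((m + l) ^ DIM('a) * C0) * norm (g y * osc 1 M (x - y))" for y
      proof -
        have "norm (of_real ((m + l) ^ DIM('a)) * ?\<Theta> ((m + l) *\<^sub>R (w - y))) \<le> (m + l) ^ DIM('a) * C0"
          unfolding norm_mult norm_of_real using C0 ml by (intro mult_mono) auto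
        from mult_left_mono[OF this norm_ge_zero[of "g y * osc 1 M (x - y)"]] show ?thesis
          by (simp only: norm_mult mult_ac)
      qed
    qed (use C0 ml in auto)
    finally have "norm (g w) * norm (osc 1 M (x - w)) * norm a \<le> (m + l) ^ DIM('a) * C0 * (LINT y|lborel. norm (g y) * norm (osc 1 M (x - y)))"
      by (simp add: norm_mult)
    then have "norm (g w) * norm (osc 1 M (x - w)) \<le> C0 / norm a * (m + l) ^ DIM('a) * (LINT y|lborel. norm (g y) * norm (osc 1 M (x - y)))"
      using a by (simp add: field_simps)
    from mult_left_mono[OF this less_imp_le[OF c]]
    show "norm (g w) * norm (inv_fourier M (x - w)) \<le>
        C0 / norm a * (m + l) ^ DIM('a) * (LINT y|lborel. norm (g y) * norm (inv_fourier M (x - y)))"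
      using c by (simp add: K norm_mult mult.left_commute)
  qed
qed

text \<open>The common end of the cases p \<ge> 1 and p < 1. They differ only in the exponent q and
  the constant A of the pointwise inequality; D is the p-th root of A Q and becomes the factor in
  front of the norm of g.\<close>

lemma morrey_conv_le:
  fixes g K :: "'a::euclidean_space \<Rightarrow> complex"
  assumes g: "slow g" and K: "rapid K" "K \<in> borel_measurable borel" and p: "p > 0"
    and N: "morrey_norm u p g \<le> ennreal N" "N \<ge> 0" and A: "A \<ge> 0" and D: "D \<ge> 0"
    and Q: "(\<integral>\<^sup>+ t. ennreal (norm (K t) powr q) \<partial>lborel) = ennreal Q" "Q \<ge> 0" "A * Q = D powr p"
    and pointwise: "\<And>x. ennreal ((LINT y|lborel. norm (g y) * norm (K (x - y))) powr p) \<le>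
      ennreal A * (\<integral>\<^sup>+ y. ennreal (norm (g y) powr p * norm (K (x - y)) powr q) \<partial>lborel)"
    and c: "c \<ge> 0" and G: "\<And>x. G x = of_real c * conv g K x" "G \<in> borel_measurable borel"
  shows "morrey_norm u p G \<le> ennreal (c * D * N)" and "G \<in> Lp_loc p"
proof -
  have ball: "(\<integral>\<^sup>+ x\<in>ball z r. ennreal (norm (G x) powr p) \<partial>lborel) \<le>
      ennreal ((c * D * N * measure lborel (ball (0::'a) r) powr (1 / p - 1 / u)) powr p)" if r: "r > 0" for z r
  proof -
    let ?V = "measure lborel (ball (0::'a) r) powr (1 / p - 1 / u)"
    have "(\<integral>\<^sup>+ x\<in>ball z r. ennreal (norm (G x) powr p) \<partial>lborel) \<le>
        ennreal (c powr p * A) * (\<integral>\<^sup>+ t. ennreal (norm (K t) powr q) \<partial>lborel) * ennreal ((N * ?V) powr p)"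
    proof (rule nn_integral_conv_power_le[OF slow_measurable[OF g] K(2)])
      fix x
      define I where "I = (LINT y|lborel. norm (g y) * norm (K (x - y)))"
      have "norm (G x) \<le> c * I"
        using norm_conv_le[of g K x] c by (simp add: G(1) norm_mult I_def mult_left_mono)
      then have "norm (G x) powr p \<le> (c * I) powr p" using p by (intro powr_mono2) auto
      also have "\<dots> = c powr p * I powr p"
        using c by (intro powr_mult)
      finally have "ennreal (norm (G x) powr p) \<le> ennreal (c powr p) * ennreal (I powr p)"
        by (simp add: ennreal_leI flip: ennreal_mult)
      also have "\<dots> \<le> ennreal (c powr p) * (ennreal A * (\<integral>\<^sup>+ y. ennreal (norm (g y) powr p * norm (K (x - y)) powr q) \<partial>lborel))"
        unfolding I_def by (intro mult_left_mono pointwise) auto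
      finally show "ennreal (norm (G x) powr p) \<le> ennreal (c powr p * A) * (\<integral>\<^sup>+ y. ennreal (norm (g y) powr p * norm (K (x - y)) powr q) \<partial>lborel)"
        using A by (simp add: ennreal_mult mult.assoc)
    qed (rule morrey_norm_local[OF p N r])
    also have "\<dots> = ennreal (c powr p * A * Q * (N * ?V) powr p)"
      using A Q by (simp add: ennreal_mult)
    also have "c powr p * A * Q * (N * ?V) powr p = (c * D * N * ?V) powr p"
    proof -
      have "c powr p * A * Q * (N * ?V) powr p = c powr p * D powr p * (N * ?V) powr p"
        using Q(3) by (simp add: mult.assoc)
      also have "\<dots> = (c * D * (N * ?V)) powr p"
        using c D N by (simp add: powr_mult)
      finally show ?thesis by (simp add: mult.assoc)
    qed
    finally show ?thesis .
  qed
  show "morrey_norm u p G \<le> ennreal (c * D * N)"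
    using c D N(2) ball by (intro morrey_norm_leI[OF p]) auto
  show "G \<in> Lp_loc p"
    unfolding Lp_loc_def mem_Collect_eq
  proof (intro conjI allI impI)
    show "G \<in> borel_measurable lebesgue"
      using G(2) by (intro measurable_completion) simp
    fix S :: "'a set" assume "compact S"
    then obtain r where r: "r > 0" "S \<subseteq> ball 0 r"
      using bounded_subset_ballD[OF compact_imp_bounded] by metis
    have "(\<integral>\<^sup>+ x\<in>S. ennreal (norm (G x) powr p) \<partial>lebesgue) \<le> (\<integral>\<^sup>+ x\<in>ball 0 r. ennreal (norm (G x) powr p) \<partial>lborel)"
      unfolding nn_integral_completion using r by (intro nn_integral_mono) (auto simp: indicator_def)
    also have "\<dots> < top" using ball[OF r(1), of 0] by (rule order_le_less_trans) simp
    finally show "(\<integral>\<^sup>+ x\<in>S. ennreal (norm (G x) powr p) \<partial>lebesgue) < top" .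
  qed
qed

theorem theorem2p4:
  fixes p u :: real
  assumes "0 < p" and "p \<le> u"
  shows "\<exists>C>0. \<forall>m>0. \<forall>l>0.
           \<forall>M :: 'a::euclidean_space \<Rightarrow> complex. \<forall>f :: 'a functional.
             M \<in> schwartz \<longrightarrow> fun_supp M \<subseteq> ball 0 m \<longrightarrow>
             tempered f \<longrightarrow> dist_in_morrey u p f \<longrightarrow>
             dist_supp (dist_fourier f) \<subseteq> ball 0 l \<longrightarrow>
             (let h = dist_inv_fourier (dist_mult M (dist_fourier f)) in
               dist_in_morrey u p h \<and>
               morrey_norm u p (dist_fun h)
                 \<le> ennreal (C * (m + l) powr sigma_p DIM('a) p) *
                    Lp_norm (min 1 p) (inv_fourier M) * morrey_norm u p (dist_fun f))"
proof -
  note p = assms(1)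
  obtain C0 where C0: "C0 > 0" and sup: "\<And>(f::'a functional) g M l m x w. \<lbrakk>represented_by f g; dist_supp (dist_fourier f) \<subseteq> ball 0 l;
      M \<in> schwartz; fun_supp M \<subseteq> ball 0 m; m > 0; l > 0\<rbrakk> \<Longrightarrow>
    norm (g w) * norm (inv_fourier M (x - w)) \<le>
      C0 * (m + l) ^ DIM('a) * (LINT y|lborel. norm (g y) * norm (inv_fourier M (x - y)))"
    by (rule band_limited_sup_bound[where 'a = 'a]) (rule that)
  define c where "c = (2 * pi) powr (- real DIM('a) / 2)"
  have c: "c > 0" by (simp add: c_def)
  \<comment> \<open>The factor c stems from the normalization of the transform, which makes the
    multiplier c times a convolution; the other factor is the p-th root of C0^(1-p).\<close>
  define C where "C = c * (if p < 1 then C0 powr (1 / p - 1) else 1)"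
  have C: "C > 0" using c C0 by (simp add: C_def)
  show ?thesis
  proof (intro exI[of _ C] conjI C allI impI)
    fix m l :: real and M :: "'a \<Rightarrow> complex" and f :: "'a functional"
    assume ml: "m > 0" "l > 0" and M: "M \<in> schwartz" "fun_supp M \<subseteq> ball 0 m"
      and f: "dist_in_morrey u p f" and supp: "dist_supp (dist_fourier f) \<subseteq> ball 0 l"
    define h where "h = dist_inv_fourier (dist_mult M (dist_fourier f))"
    obtain g where g: "represented_by f g" "g \<in> morrey u p" using f by (auto simp: dist_in_morrey_def)
    define K where "K = inv_fourier M"
    have K: "K \<in> schwartz" unfolding K_def by (intro inv_fourier_schwartz M)
    note Kr = schwartz_rapid[OF K] and Km = schwartz_measurable[OF K]
    define G where "G x = of_real c * conv g K x" for x
    have hG: "represented_by h G"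
      using represented_multiplier[OF g(1) M(1)] by (simp add: h_def G_def[abs_def] c_def K_def)
    note slow = represented_slow[OF g(1)]
    define N where "N = enn2real (morrey_norm u p g)"
    have N: "morrey_norm u p g = ennreal N" "N \<ge> 0"
      using g(2) by (auto simp: N_def morrey_def)
    define q where "q = min 1 p"
    have q: "q > 0" using p by (simp add: q_def)
    define Q where "Q = (LINT t|lborel. norm (K t) powr q)"
    have Qint: "integrable lborel (\<lambda>t. norm (K t) powr q)"
      using Km by (intro rapid_integrable rapid_powr Kr q) auto
    have Q: "(\<integral>\<^sup>+ t. ennreal (norm (K t) powr q) \<partial>lborel) = ennreal Q" "Q \<ge> 0"
      unfolding Q_def using Qint by (auto simp: nn_integral_eq_integral intro!: Bochner_Integration.integral_nonneg)
    have gK: "integrable lborel (\<lambda>y. norm (g y) * norm (K (x - y)))" for x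
      using Km by (intro slow_integrable_norm[OF slow] rapid_reflect Kr) auto
    have "\<exists>A\<ge>0. \<exists>D\<ge>0. A * Q = D powr p \<and> c * D = C * (m + l) powr sigma_p DIM('a) p * Q powr (1 / q) \<and>
      (\<forall>x. ennreal ((LINT y|lborel. norm (g y) * norm (K (x - y))) powr p) \<le>
        ennreal A * (\<integral>\<^sup>+ y. ennreal (norm (g y) powr p * norm (K (x - y)) powr q) \<partial>lborel))"
    proof (cases "p < 1")
      case False
      then have q1: "q = 1" and s: "sigma_p DIM('a) p = 0" and CC: "C = c"
        by (auto simp: q_def sigma_p_def C_def max_def)
      have QL: "Q = (LINT y|lborel. norm (K (x - y)))" for x
        using lborel_integral_reflect[of "\<lambda>y. norm (K y)" x] Km by (simp add: Q_def q1)
      show ?thesis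
      \<comment> \<open>Here Q is the integral of |K|, and Jensen's inequality supplies A, so that A
        Q = Q^p and D = Q.\<close>
      proof (rule exI[of _ "Q powr (p - 1)"], rule conjI, simp, rule exI[of _ Q], intro conjI allI)
        show "Q powr (p - 1) * Q = Q powr p"
        proof (cases "Q = 0")
          case False
          then show ?thesis using Q(2) powr_add[of Q "p - 1" 1] by simp
        qed simp
        show "c * Q = C * (m + l) powr sigma_p DIM('a) p * Q powr (1 / q)"
          using ml Q(2) by (simp add: q1 s CC)
        fix x
        have "integrable lborel (\<lambda>y. norm (K (x - y)))"
          using Km by (intro rapid_integrable rapid_norm rapid_reflect Kr) auto
        then show "ennreal ((LINT y|lborel. norm (g y) * norm (K (x - y))) powr p) \<le>
          ennreal (Q powr (p - 1)) * (\<integral>\<^sup>+ y. ennreal (norm (g y) powr p * norm (K (x - y)) powr q) \<partial>lborel)"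
          using False integral_mult_power_le[of p "\<lambda>y. norm (g y)" lborel "\<lambda>y. norm (K (x - y))"]
            slow_measurable[OF slow] gK[of x] QL[of x] by (simp add: q1)
      qed (use Q(2) in auto)
    next
      case True
      \<comment> \<open>The constant of the sup bound. Since D contains
        \<open>B powr (1 / p - 1)\<close>, its factor (m + l)^d is what becomes the power
        \<open>sigma_p\<close> of m + l.\<close>
      define B where "B = C0 * (m + l) ^ DIM('a)"
      have B: "B > 0" using C0 ml by (simp add: B_def)
      have qp: "q = p" and s: "sigma_p DIM('a) p = real DIM('a) * (1 / p - 1)"
        using True p by (auto simp: q_def sigma_p_def max_def field_simps)
      show ?thesis
      proof (rule exI[of _ "B powr (1 - p)"], rule conjI, simp, rule exI[of _ "B powr (1 / p - 1) * Q powr (1 / p)"], intro conjI allI)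
        have "(1 / p - 1) * p = 1 - p" using p by (simp add: field_simps)
        then show "B powr (1 - p) * Q = (B powr (1 / p - 1) * Q powr (1 / p)) powr p"
          using B Q(2) p by (simp add: powr_mult powr_powr)
        have "B powr (1 / p - 1) = C0 powr (1 / p - 1) * (m + l) powr (real DIM('a) * (1 / p - 1))"
          using C0 ml by (simp add: B_def powr_mult powr_powr flip: powr_realpow)
        then show "c * (B powr (1 / p - 1) * Q powr (1 / p)) = C * (m + l) powr sigma_p DIM('a) p * Q powr (1 / q)"
          using True by (simp add: C_def s qp)
        fix x
        have "ennreal ((LINT y|lborel. norm (g y) * norm (K (x - y))) powr p) \<le>
          ennreal (B powr (1 - p)) * (\<integral>\<^sup>+ y. ennreal ((norm (g y) * norm (K (x - y))) powr p) \<partial>lborel)"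
          using sup[OF g(1) supp M ml] True p B gK[of x]
          by (intro integral_power_le_of_sup_bound) (auto simp: B_def K_def)
        then show "ennreal ((LINT y|lborel. norm (g y) * norm (K (x - y))) powr p) \<le>
          ennreal (B powr (1 - p)) * (\<integral>\<^sup>+ y. ennreal (norm (g y) powr p * norm (K (x - y)) powr q) \<partial>lborel)"
          by (simp add: powr_mult qp)
      qed (use B in auto)
    qed
    then obtain A D where AD: "A \<ge> 0" "D \<ge> 0" "A * Q = D powr p"
      and D: "c * D = C * (m + l) powr sigma_p DIM('a) p * Q powr (1 / q)"
      and pw: "\<And>x. ennreal ((LINT y|lborel. norm (g y) * norm (K (x - y))) powr p) \<le>
        ennreal A * (\<integral>\<^sup>+ y. ennreal (norm (g y) powr p * norm (K (x - y)) powr q) \<partial>lborel)"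
      by blast
    note bound = morrey_conv_le[OF slow Kr Km p eq_refl[OF N(1)] N(2) AD(1,2) Q AD(3) pw less_imp_le[OF c] G_def
        smooth_measurable[OF represented_smooth[OF hG]]]
    have "morrey_norm u p G \<le> ennreal (C * (m + l) powr sigma_p DIM('a) p * Q powr (1 / q) * N)"
      using bound(1) by (simp add: D)
    also have "\<dots> = ennreal (C * (m + l) powr sigma_p DIM('a) p) * Lp_norm (min 1 p) (inv_fourier M) * morrey_norm u p g"
      using C Q N by (simp add: Lp_norm_def nn_integral_completion enn_powr_ennreal ennreal_mult flip: K_def q_def)
    finally have "morrey_norm u p G \<le> ennreal (C * (m + l) powr sigma_p DIM('a) p) * Lp_norm (min 1 p) (inv_fourier M) * morrey_norm u p g" .
    moreover have "G \<in> morrey u p"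
      using bound by (auto simp: morrey_def intro: order_le_less_trans)
    ultimately show "let h = dist_inv_fourier (dist_mult M (dist_fourier f)) in
        dist_in_morrey u p h \<and>
        morrey_norm u p (dist_fun h)
          \<le> ennreal (C * (m + l) powr sigma_p DIM('a) p) *
             Lp_norm (min 1 p) (inv_fourier M) * morrey_norm u p (dist_fun f)"
      using hG by (auto simp: Let_def dist_in_morrey_def dist_fun_eq[OF hG] dist_fun_eq[OF g(1)] simp flip: h_def)
  qed
qed

end
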